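(* Let $\mathcal H$ be an infinite-dimensional separable complex Hilbert space, let $C\in\mathcal B^1(\mathcal H)$ and $T\in\mathcal B(\mathcal H)$. If $C$ is normal with collinear eigenvalues or if $T$ is essentially self-adjoint, then the closure $\overline{W_C(T)}$ of the $C$-numerical range of $T$ is a convex subset of $\mathbb C$.
   Context: $\mathcal B(\mathcal H)$ denotes the bounded linear operators on $\mathcal H$ and $\mathcal B^1(\mathcal H)$ the trace-class operators on $\mathcal H$. The $C$-numerical range of $T$ is $W_C(T):=\{\operatorname{tr}(CU^\dagger TU)\mid U\in\mathcal B(\mathcal H)\text{ unitary}\}\subset\mathbb C$, where $\dagger$ denotes the adjoint. A subset of $\mathbb C$ is collinear if all its elements lie on a common (real) line in the complex plane. An operator $T\in\mathcal B(\mathcal H)$ is called essentially self-adjoint (in this paper's sense) if there exist $\theta\in\mathbb R$ and $\xi\in\mathbb C$ such that $e^{-i\theta}(T-\xi\operatorname{id}_{\mathcal H})$ is self-adjoint. *)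

theory Defs
  imports "HOL-Analysis.Analysis"
begin

text \<open>
  Complex Hilbert spaces are rendered as a type class on top of the real normed spaces of the
  library. The inner product is antilinear in the first and linear in the second argument.
\<close>

class complex_vector = real_vector +
  fixes scaleC :: "complex \<Rightarrow> 'a \<Rightarrow> 'a" (infixr "*\<^sub>C" 75)
  assumes scaleC_add_right: "a *\<^sub>C (x + y) = a *\<^sub>C x + a *\<^sub>C y"
    and scaleC_add_left: "(a + b) *\<^sub>C x = a *\<^sub>C x + b *\<^sub>C x"
    and scaleC_scaleC: "a *\<^sub>C (b *\<^sub>C x) = (a * b) *\<^sub>C x"
    and scaleC_one: "1 *\<^sub>C x = x"
    and scaleR_scaleC: "r *\<^sub>R x = complex_of_real r *\<^sub>C x"

global_interpretation complex_vector:
  vector_space "scaleC :: complex \<Rightarrow> 'a \<Rightarrow> 'a::complex_vector"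
  defines cspan = complex_vector.span
  by unfold_locales (use scaleC_add_right scaleC_add_left scaleC_scaleC scaleC_one in auto)

class complex_inner = complex_vector + real_normed_vector +
  fixes cinner :: "'a \<Rightarrow> 'a \<Rightarrow> complex"
  assumes cinner_commute: "cinner x y = cnj (cinner y x)"
    and cinner_add_right: "cinner x (y + z) = cinner x y + cinner x z"
    and cinner_scaleC_right: "cinner x (c *\<^sub>C y) = c * cinner x y"
    and cinner_self: "cinner x x = complex_of_real ((norm x)\<^sup>2)"

class complex_hilbert = complex_inner + complete_space

definition infinite_dimensional :: "'h::complex_vector itself \<Rightarrow> bool" where
  "infinite_dimensional _ \<longleftrightarrow> \<not> (\<exists>B::'h set. finite B \<and> cspan B = UNIV)"

definition bounded_clinear :: "('h::complex_inner \<Rightarrow> 'h) \<Rightarrow> bool" where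
  "bounded_clinear A \<longleftrightarrow> bounded_linear A \<and> (\<forall>c x. A (c *\<^sub>C x) = c *\<^sub>C A x)"

text \<open>On a complex Hilbert space the adjoint of a bounded operator exists and is unique.\<close>

definition cadjoint :: "('h::complex_hilbert \<Rightarrow> 'h) \<Rightarrow> ('h \<Rightarrow> 'h)" where
  "cadjoint A = (SOME B. \<forall>x y. cinner (A x) y = cinner x (B y))"

definition unitary_op :: "('h::complex_hilbert \<Rightarrow> 'h) \<Rightarrow> bool" where
  "unitary_op U \<longleftrightarrow> bounded_clinear U \<and> cadjoint U \<circ> U = id \<and> U \<circ> cadjoint U = id"

definition normal_op :: "('h::complex_hilbert \<Rightarrow> 'h) \<Rightarrow> bool" where
  "normal_op A \<longleftrightarrow> bounded_clinear A \<and> cadjoint A \<circ> A = A \<circ> cadjoint A"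

definition selfadjoint_op :: "('h::complex_hilbert \<Rightarrow> 'h) \<Rightarrow> bool" where
  "selfadjoint_op A \<longleftrightarrow> bounded_clinear A \<and> cadjoint A = A"

definition positive_op :: "('h::complex_hilbert \<Rightarrow> 'h) \<Rightarrow> bool" where
  "positive_op A \<longleftrightarrow> bounded_clinear A \<and> (\<forall>x. cinner x (A x) \<in> \<real>\<^sub>\<ge>\<^sub>0)"

text \<open>This is not the usual notion for unbounded operators: the operator is bounded, and it is
  self-adjoint up to a translation and a rotation of the complex plane.\<close>

definition essentially_selfadjoint :: "('h::complex_hilbert \<Rightarrow> 'h) \<Rightarrow> bool" where
  "essentially_selfadjoint T \<longleftrightarrow>
     (\<exists>(\<theta>::real) (\<xi>::complex).
        selfadjoint_op (\<lambda>x. exp (- \<i> * complex_of_real \<theta>) *\<^sub>C (T x - \<xi> *\<^sub>C x)))"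

definition eigenvalues_op :: "('h::complex_hilbert \<Rightarrow> 'h) \<Rightarrow> complex set" where
  "eigenvalues_op A = {\<mu>. \<exists>x. x \<noteq> 0 \<and> A x = \<mu> *\<^sub>C x}"

definition is_onb :: "'h::complex_hilbert set \<Rightarrow> bool" where
  "is_onb E \<longleftrightarrow> (\<forall>e\<in>E. norm e = 1) \<and> pairwise (\<lambda>e f. cinner e f = 0) E \<and>
     closure (cspan E) = UNIV"

text \<open>\<open>is_modulus P A\<close> says that \<open>P = |A|\<close>, the unique positive square root of
  \<open>cadjoint A \<circ> A\<close>.\<close>

definition is_modulus :: "('h::complex_hilbert \<Rightarrow> 'h) \<Rightarrow> ('h \<Rightarrow> 'h) \<Rightarrow> bool" where
  "is_modulus P A \<longleftrightarrow> positive_op P \<and> P \<circ> P = cadjoint A \<circ> A"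

text \<open>Trace class means that \<open>|A|\<close> has finite trace. As \<open>|A|\<close> is positive, this
  does not depend on the orthonormal basis.\<close>

definition trace_class :: "('h::complex_hilbert \<Rightarrow> 'h) \<Rightarrow> bool" where
  "trace_class A \<longleftrightarrow> bounded_clinear A \<and>
     (\<exists>P E. is_modulus P A \<and> is_onb E \<and> (\<lambda>e. cinner e (P e)) summable_on E)"

text \<open>The trace is taken in an arbitrarily chosen orthonormal basis; on trace-class operators its
  value does not depend on this choice.\<close>

definition ctrace :: "('h::complex_hilbert \<Rightarrow> 'h) \<Rightarrow> complex" where
  "ctrace A = (\<Sum>\<^sub>\<infinity>e\<in>(SOME E. is_onb E). cinner e (A e))"

definition C_numerical_range ::
    "('h::complex_hilbert \<Rightarrow> 'h) \<Rightarrow> ('h \<Rightarrow> 'h) \<Rightarrow> complex set" where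
  "C_numerical_range C T = {ctrace (C \<circ> cadjoint U \<circ> T \<circ> U) | U. unitary_op U}"

end

theory Submission
  imports Defs
begin

text \<open>
  After multiplication by a phase and a translation, one of the two operators is self-adjoint. For
  \<open>T\<close> this is the definition of essential self-adjointness. A normal trace class operator \<open>C\<close> with
  collinear eigenvalues on an infinite-dimensional space is a multiple of a self-adjoint operator,
  because the line must pass through \<open>0\<close>: otherwise \<open>C\<close>, being compact, would have only finitely
  many eigenvalues and finite-dimensional eigenspaces, and these could not fill the space
  (\<open>normal_collinear_imp_rotated_symmetric\<close>).

  A trace class operator is a convergent series of rank one operators (\<open>trace_class_nuclear\<close>). Hence
  \<open>C\<close> can be approximated by compressions of finite rank such that the traces
  \<open>tr (C U\<^sup>* T U)\<close> change by less than \<open>\<epsilon>\<close> simultaneously for all unitary \<open>U\<close>. It therefore suffices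
  to find, for finite rank \<open>C\<close>, every point of the segment between two points of the numerical range.
  Everything then takes place in a finite-dimensional space, where the two operators play symmetric
  roles.

  In finite dimensions the theorem is due to Westwick, and the argument is Poon's. Let \<open>X\<close> be Hermitian
  with eigenvalues \<open>s\<close>, and let \<open>X' = V X V\<^sup>*\<close>. The point \<open>(1 - t) tr (X A) + t tr (X' A)\<close> is
  \<open>tr (Z A)\<close> with the Hermitian operator \<open>Z = (1 - t) X + t X'\<close>, whose eigenvalues \<open>l\<close> are majorised by \<open>s\<close>
  (\<open>convex_combination_of_bases\<close>). In an eigenbasis \<open>g\<close> of \<open>Z\<close> the point is
  \<open>\<Sum>i. l\<^sub>i \<langle>g\<^sub>i, A g\<^sub>i\<rangle>\<close>. By the Hardy--Littlewood--Polya theorem the weights \<open>l\<close> are reached from \<open>s\<close>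
  by averaging two weights at a time. Every such step is undone by a rotation in the plane of the two
  basis vectors, which is the Toeplitz--Hausdorff theorem for a two-dimensional space
  (\<open>weights_spread\<close>). At the end the same point is written with the weights \<open>s\<close> and another
  orthonormal basis \<open>h\<close>, that is, as \<open>tr (W X W\<^sup>* A)\<close> for a unitary \<open>W\<close> (\<open>majorised_weights\<close>).
\<close>

section \<open>Complex inner product spaces\<close>

lemma cinner_scaleC_left: "cinner (c *\<^sub>C x) y = cnj c * cinner x (y::'h::complex_inner)"
  by (metis cinner_commute cinner_scaleC_right complex_cnj_mult)

lemma cinner_add_left: "cinner (x + y) z = cinner x z + cinner y (z::'h::complex_inner)"
  by (metis cinner_add_right cinner_commute complex_cnj_add)

lemma cinner_zero_right [simp]: "cinner x (0::'h::complex_inner) = 0"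
  using cinner_add_right [of x 0 0] by simp

lemma cinner_zero_left [simp]: "cinner (0::'h::complex_inner) x = 0"
  using cinner_add_left [of 0 0 x] by simp

lemma cinner_minus_right: "cinner x (- y) = - cinner x (y::'h::complex_inner)"
  using cinner_add_right [of x y "-y"] by (simp add: add_eq_0_iff)

lemma cinner_minus_left: "cinner (- x) y = - cinner x (y::'h::complex_inner)"
  using cinner_add_left [of x "-x" y] by (simp add: add_eq_0_iff)

lemma cinner_diff_right: "cinner x (y - z) = cinner x y - cinner x (z::'h::complex_inner)"
  using cinner_add_right [of x y "-z"] by (simp add: cinner_minus_right)

lemma cinner_diff_left: "cinner (x - y) z = cinner x z - cinner y (z::'h::complex_inner)"
  using cinner_add_left [of x "-y" z] by (simp add: cinner_minus_left)

lemma cinner_sum_right: "cinner x (sum f I) = (\<Sum>i\<in>I. cinner x (f i::'h::complex_inner))"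
  by (induction I rule: infinite_finite_induct) (auto simp: cinner_add_right)

lemma cinner_sum_left: "cinner (sum f I) x = (\<Sum>i\<in>I. cinner (f i) (x::'h::complex_inner))"
  by (induction I rule: infinite_finite_induct) (auto simp: cinner_add_left)

lemma cinner_scaleR_left: "cinner (r *\<^sub>R x) y = of_real r * cinner x (y::'h::complex_inner)"
  by (simp add: scaleR_scaleC cinner_scaleC_left)

lemma cinner_scaleR_right: "cinner x (r *\<^sub>R y) = of_real r * cinner x (y::'h::complex_inner)"
  by (simp add: scaleR_scaleC cinner_scaleC_right)

lemma scaleC_zero_left [simp]: "0 *\<^sub>C (x::'h::complex_vector) = 0"
  using complex_vector.scale_zero_left .

lemma scaleC_zero_right [simp]: "c *\<^sub>C (0::'h::complex_vector) = 0"
  using complex_vector.scale_zero_right .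

lemma scaleC_minus_left: "(- c) *\<^sub>C (x::'h::complex_vector) = - (c *\<^sub>C x)"
  using complex_vector.scale_minus_left .

lemma scaleC_minus_right: "c *\<^sub>C (- x::'h::complex_vector) = - (c *\<^sub>C x)"
  using complex_vector.scale_minus_right .

lemma scaleC_diff_right: "c *\<^sub>C (x - y::'h::complex_vector) = c *\<^sub>C x - c *\<^sub>C y"
  using complex_vector.scale_right_diff_distrib .

lemma scaleC_diff_left: "(c - d) *\<^sub>C (x::'h::complex_vector) = c *\<^sub>C x - d *\<^sub>C x"
  using complex_vector.scale_left_diff_distrib .

lemma scaleC_sum_right: "c *\<^sub>C (sum f I) = (\<Sum>i\<in>I. c *\<^sub>C (f i::'h::complex_vector))"
  using complex_vector.scale_sum_right .

lemmas cinner_simps = cinner_add_left cinner_add_right cinner_diff_left cinner_diff_right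
  cinner_minus_left cinner_minus_right cinner_scaleC_left cinner_scaleC_right
  cinner_sum_left cinner_sum_right

lemma cinner_eq_0_norm: "cinner x x = 0 \<longleftrightarrow> (x::'h::complex_inner) = 0"
  by (simp add: cinner_self)

lemma Re_cinner_self: "Re (cinner x x) = (norm (x::'h::complex_inner))\<^sup>2"
  by (simp add: cinner_self)

lemma cinner_eqI:
  assumes "\<And>z. cinner z x = cinner z (y::'h::complex_inner)"
  shows "x = y"
proof -
  have "cinner (x - y) (x - y) = 0"
    using assms by (simp add: cinner_diff_right)
  thus ?thesis
    by (simp add: cinner_eq_0_norm)
qed

lemma norm_scaleC: "norm (c *\<^sub>C x) = cmod c * norm (x::'h::complex_inner)"
proof -
  have "cinner (c *\<^sub>C x) (c *\<^sub>C x) = (c * cnj c) * cinner x x"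
    by (simp only: cinner_scaleC_left cinner_scaleC_right mult_ac)
  also have "\<dots> = of_real ((cmod c * norm x)\<^sup>2)"
    by (simp add: cinner_self power_mult_distrib flip: complex_norm_square)
  finally have "complex_of_real ((norm (c *\<^sub>C x))\<^sup>2) = of_real ((cmod c * norm x)\<^sup>2)"
    by (simp only: cinner_self)
  hence "(norm (c *\<^sub>C x))\<^sup>2 = (cmod c * norm x)\<^sup>2"
    using of_real_eq_iff by blast
  thus ?thesis
    by (simp add: power2_eq_iff_nonneg)
qed

lemma norm_diff_sq: "(norm (x - y))\<^sup>2 = (norm x)\<^sup>2 - 2 * Re (cinner x y) + (norm (y::'h::complex_inner))\<^sup>2"
proof -
  have "Re (cinner y x) = Re (cinner x y)"
    by (subst cinner_commute) simp
  thus ?thesis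
    unfolding Re_cinner_self [symmetric] by (simp add: cinner_diff_left cinner_diff_right)
qed

lemma norm_add_sq: "(norm (x + y))\<^sup>2 = (norm x)\<^sup>2 + 2 * Re (cinner x y) + (norm (y::'h::complex_inner))\<^sup>2"
  using norm_diff_sq [of x "-y"] by (simp add: cinner_minus_right)

section \<open>Finite orthonormal families and their projections\<close>

definition ortho :: "('i \<Rightarrow> 'h::complex_inner) \<Rightarrow> 'i set \<Rightarrow> bool" where
  "ortho f I \<longleftrightarrow> (\<forall>i\<in>I. \<forall>j\<in>I. cinner (f i) (f j) = (if i = j then 1 else 0))"

definition oproj :: "('i \<Rightarrow> 'h::complex_inner) \<Rightarrow> 'i set \<Rightarrow> 'h \<Rightarrow> 'h" where
  "oproj f I x = (\<Sum>i\<in>I. cinner (f i) x *\<^sub>C f i)"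

lemma orthoD: "ortho f I \<Longrightarrow> i \<in> I \<Longrightarrow> j \<in> I \<Longrightarrow> cinner (f i) (f j) = (if i = j then 1 else 0)"
  by (auto simp: ortho_def)

lemma ortho_norm: "ortho f I \<Longrightarrow> i \<in> I \<Longrightarrow> norm (f i) = 1"
  by (metis Re_cinner_self abs_norm_cancel one_complex.simps(1) orthoD power2_eq_1_iff
      real_sqrt_abs real_sqrt_one)

lemma ortho_subset: "ortho f I \<Longrightarrow> J \<subseteq> I \<Longrightarrow> ortho f J"
  unfolding ortho_def by blast

lemma cinner_oproj: "finite I \<Longrightarrow> ortho f I \<Longrightarrow> i \<in> I \<Longrightarrow> cinner (f i) (oproj f I x) = cinner (f i) x"
  by (simp add: oproj_def cinner_simps orthoD if_distrib [of "\<lambda>z. _ * z"] cong: if_cong)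

lemma oproj_family: "finite I \<Longrightarrow> ortho f I \<Longrightarrow> i \<in> I \<Longrightarrow> oproj f I (f i) = f i"
  by (simp add: oproj_def orthoD if_distrib [of "\<lambda>z. z *\<^sub>C _"] scaleC_one cong: if_cong)

lemma oproj_selfadjoint: "cinner (oproj f I x) y = cinner x (oproj f I y)"
  unfolding oproj_def
  by (simp add: cinner_simps cinner_commute [of x] mult_ac)

lemma oproj_idem: "finite I \<Longrightarrow> ortho f I \<Longrightarrow> oproj f I (oproj f I x) = oproj f I x"
  unfolding oproj_def [of f I "oproj f I x"] by (simp add: cinner_oproj) (simp add: oproj_def)

lemma oproj_add: "oproj f I (x + y) = oproj f I x + oproj f I y"
  by (simp add: oproj_def cinner_add_right scaleC_add_left sum.distrib)

lemma oproj_scaleC: "oproj f I (c *\<^sub>C x) = c *\<^sub>C oproj f I x"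
  by (simp add: oproj_def cinner_scaleC_right scaleC_sum_right scaleC_scaleC)

lemma oproj_diff: "oproj f I (x - y) = oproj f I x - oproj f I y"
  by (simp add: oproj_def cinner_diff_right scaleC_diff_left sum_subtractf)

lemma oproj_zero [simp]: "oproj f I 0 = 0"
  by (simp add: oproj_def)

lemma oproj_sum: "oproj f I (sum g J) = (\<Sum>j\<in>J. oproj f I (g j))"
  by (induction J rule: infinite_finite_induct) (auto simp: oproj_add)

lemma cinner_oproj_self:
  "cinner x (oproj f I x) = of_real (\<Sum>i\<in>I. (cmod (cinner (f i) x))\<^sup>2)"
proof -
  have "cinner (f i) x * cinner x (f i) = of_real ((cmod (cinner (f i) x))\<^sup>2)" for i
    by (subst (2) cinner_commute) (simp add: complex_norm_square del: of_real_power)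
  thus ?thesis
    unfolding oproj_def by (simp add: cinner_simps del: of_real_power)
qed

lemma norm_oproj_sq:
  assumes "finite I" "ortho f I"
  shows "(norm (oproj f I x))\<^sup>2 = (\<Sum>i\<in>I. (cmod (cinner (f i) x))\<^sup>2)"
proof -
  have "cinner (oproj f I x) (oproj f I x) = cinner x (oproj f I x)"
    by (simp add: oproj_selfadjoint oproj_idem assms)
  thus ?thesis
    unfolding cinner_self cinner_oproj_self using of_real_eq_iff by blast
qed

lemma norm_minus_oproj_sq:
  assumes "finite I" "ortho f I"
  shows "(norm (x - oproj f I x))\<^sup>2 = (norm x)\<^sup>2 - (\<Sum>i\<in>I. (cmod (cinner (f i) x))\<^sup>2)"
  by (simp add: norm_diff_sq norm_oproj_sq assms cinner_oproj_self)

lemma bessel: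
  assumes "finite I" "ortho f I"
  shows "(\<Sum>i\<in>I. (cmod (cinner (f i) x))\<^sup>2) \<le> (norm x)\<^sup>2"
  using norm_minus_oproj_sq [OF assms, of x] by (smt (verit) zero_le_power2)

lemma norm_oproj_le: "finite I \<Longrightarrow> ortho f I \<Longrightarrow> norm (oproj f I x) \<le> norm x"
  by (rule power2_le_imp_le) (simp_all add: norm_oproj_sq bessel)

lemma norm_minus_oproj_le: "finite I \<Longrightarrow> ortho f I \<Longrightarrow> norm (x - oproj f I x) \<le> norm x"
  by (rule power2_le_imp_le) (simp_all add: norm_minus_oproj_sq sum_nonneg)

lemma oproj_closest:
  assumes "finite I" "ortho f I" "oproj f I y = y"
  shows "norm (x - oproj f I x) \<le> norm (x - y)"
proof -
  have "x - oproj f I x = (x - y) - oproj f I (x - y)"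
    by (simp add: oproj_diff assms)
  thus ?thesis
    by (metis assms(1,2) norm_minus_oproj_le)
qed

lemma cauchy_schwarz: "cmod (cinner x y) \<le> norm x * norm (y::'h::complex_inner)"
proof (cases "x = 0")
  case False
  define u where "u = (1 / of_real (norm x)) *\<^sub>C x"
  have "ortho (\<lambda>_::unit. u) UNIV"
    using False
    by (simp add: ortho_def u_def cinner_self norm_scaleC norm_divide)
  from bessel [OF _ this, of y] have "cmod (cinner u y) \<le> norm y"
    by (simp add: UNIV_unit)
  thus ?thesis
    using False by (simp add: u_def cinner_simps norm_mult norm_divide field_simps)
qed simp

lemma bounded_linear_cinner_right: "bounded_linear (\<lambda>y. cinner x (y::'h::complex_inner))"
proof (rule bounded_linear_intro [of _ "norm x"])
  show "norm (cinner x y) \<le> norm y * norm x" for y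
    using cauchy_schwarz [of x y] by (simp add: mult.commute)
qed (simp_all add: cinner_add_right scaleR_scaleC cinner_scaleC_right scaleR_conv_of_real)

lemma bounded_linear_scaleC_left: "bounded_linear (\<lambda>c. c *\<^sub>C (x::'h::complex_inner))"
  by (rule bounded_linear_intro [of _ "norm x"])
    (simp_all add: scaleC_add_left norm_scaleC scaleR_scaleC scaleC_scaleC scaleR_conv_of_real)

lemma bounded_linear_scaleC_right: "bounded_linear (\<lambda>x. c *\<^sub>C (x::'h::complex_inner))"
  by (rule bounded_linear_intro [of _ "cmod c"])
    (simp_all add: scaleC_add_right norm_scaleC scaleR_scaleC scaleC_scaleC mult.commute)

lemma continuous_on_scaleC [continuous_intros]:
  assumes "continuous_on S f" "continuous_on S g"
  shows "continuous_on S (\<lambda>z. f z *\<^sub>C (g z :: 'h::complex_inner))"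
proof -
  have "bounded_bilinear (\<lambda>c (x::'h). c *\<^sub>C x)"
    by unfold_locales (auto simp: scaleC_add_left scaleC_add_right scaleR_scaleC scaleC_scaleC
        mult.commute norm_scaleC scaleR_conv_of_real intro!: exI [of _ 1])
  from bounded_bilinear.continuous_on [OF this assms] show ?thesis .
qed

lemma tendsto_cinner_right:
  "(f \<longlongrightarrow> l) F \<Longrightarrow> ((\<lambda>z. cinner x (f z)) \<longlongrightarrow> cinner x (l::'h::complex_inner)) F"
  by (rule bounded_linear.tendsto [OF bounded_linear_cinner_right])

lemma continuous_on_cinner [continuous_intros]:
  assumes "continuous_on S f" "continuous_on S g"
  shows "continuous_on S (\<lambda>z. cinner (f z) (g z :: 'h::complex_inner))"
proof -
  have "bounded_bilinear (\<lambda>x (y::'h). cinner x y)"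
    by unfold_locales (auto simp: cinner_simps cinner_scaleR_left cinner_scaleR_right
        scaleR_conv_of_real intro!: exI [of _ 1] cauchy_schwarz)
  from bounded_bilinear.continuous_on [OF this assms] show ?thesis .
qed

lemma csubspace_oproj: "complex_vector.subspace {x::'h::complex_inner. oproj f I x = x}"
  by (rule complex_vector.subspaceI) (simp_all add: oproj_add oproj_scaleC)

lemma oproj_in_cspan: "oproj f I x \<in> cspan (f ` I)"
  unfolding oproj_def
  by (intro complex_vector.span_sum complex_vector.span_scale complex_vector.span_base) auto

lemma oproj_cspan:
  assumes "x \<in> cspan S" "\<And>y. y \<in> S \<Longrightarrow> oproj f I y = y"
  shows "oproj f I x = x"
  using complex_vector.span_minimal [OF _ csubspace_oproj, of S f I] assms by blast

text \<open>The Gram--Schmidt process, started from an orthonormal family instead of from nothing. The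
  span in the last conclusion is what later shows that extensions of two different families
  exhaust the same space.\<close>

lemma gram_schmidt_extend:
  fixes u :: "nat \<Rightarrow> 'h::complex_inner"
  assumes "ortho u {..<k}" "finite S"
  shows "\<exists>n\<ge>k. \<exists>u'. (\<forall>i<k. u' i = u i) \<and> ortho u' {..<n} \<and> (\<forall>x\<in>S. oproj u' {..<n} x = x) \<and>
    u' ` {..<n} \<subseteq> cspan (u ` {..<k} \<union> S)"
  using assms(2)
proof induction
  case empty
  show ?case
    using assms(1) by (intro exI [of _ k] conjI exI [of _ u]) (auto intro: complex_vector.span_base)
next
  case (insert x S)
  then obtain n u' where n: "n \<ge> k" and u': "\<forall>i<k. u' i = u i" "ortho u' {..<n}"
      "\<forall>x\<in>S. oproj u' {..<n} x = x" "u' ` {..<n} \<subseteq> cspan (u ` {..<k} \<union> S)"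
    by blast
  have sub: "cspan (u ` {..<k} \<union> S) \<subseteq> cspan (u ` {..<k} \<union> insert x S)"
    by (rule complex_vector.span_mono) auto
  define r where "r = x - oproj u' {..<n} x"
  show ?case
  proof (cases "r = 0")
    case True
    thus ?thesis
      using n u' sub by (intro exI [of _ n] conjI exI [of _ u']) (auto simp: r_def)
  next
    case False
    define e where "e = (1 / of_real (norm r)) *\<^sub>C r"
    define w where "w = u'(n := e)"
    have ue: "cinner (u' i) e = 0" if "i < n" for i
      using that cinner_oproj [OF _ u'(2)] by (simp add: e_def r_def cinner_simps)
    have eu: "cinner e (u' i) = 0" if "i < n" for i
      using ue [OF that] by (subst cinner_commute) simp
    have ee: "cinner e e = 1"
      using False by (simp add: e_def cinner_self norm_scaleC norm_divide)
    have ow: "ortho w {..<Suc n}"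
      using ue eu ee orthoD [OF u'(2)] by (auto simp: ortho_def w_def less_Suc_eq)
    have pw: "oproj w {..<Suc n} y = oproj u' {..<n} y + cinner e y *\<^sub>C e" for y
      by (simp add: oproj_def w_def)
    have er: "cinner e (oproj u' {..<n} y) = 0" for y
      by (simp add: oproj_def cinner_simps eu)
    have "cinner e x = cinner e r"
      by (simp add: r_def cinner_simps er)
    also have "\<dots> = of_real (norm r)"
      using False by (simp add: e_def cinner_simps cinner_self power2_eq_square)
    finally have "cinner e x *\<^sub>C e = r"
      using False by (simp add: e_def scaleC_scaleC scaleC_one)
    hence px: "oproj w {..<Suc n} x = x"
      by (simp add: pw r_def)
    have pS: "oproj w {..<Suc n} y = y" if "y \<in> S" for y
      using er [of y] u'(3) that by (simp add: pw)
    have span1: "u' ` {..<n} \<subseteq> cspan (u ` {..<k} \<union> insert x S)"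
      using u'(4) sub by blast
    have "oproj u' {..<n} x \<in> cspan (u ` {..<k} \<union> insert x S)"
      using oproj_in_cspan [of u' "{..<n}" x] complex_vector.span_minimal [OF span1]
        complex_vector.subspace_span by blast
    moreover have "x \<in> cspan (u ` {..<k} \<union> insert x S)"
      by (rule complex_vector.span_base) simp
    ultimately have "e \<in> cspan (u ` {..<k} \<union> insert x S)"
      unfolding e_def r_def by (intro complex_vector.span_scale complex_vector.span_diff)
    hence "w ` {..<Suc n} \<subseteq> cspan (u ` {..<k} \<union> insert x S)"
      using span1 by (auto simp: w_def less_Suc_eq)
    moreover have "\<forall>i<k. w i = u i"
      using u'(1) n by (simp add: w_def)
    moreover have "\<forall>y\<in>insert x S. oproj w {..<Suc n} y = y"
      using px pS by blast
    ultimately show ?thesis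
      using n ow le_Suc_eq by blast
  qed
qed

lemma gram_schmidt_extendE:
  fixes u :: "nat \<Rightarrow> 'h::complex_inner"
  assumes "ortho u {..<k}" "finite S"
  obtains n u' where "n \<ge> k" "\<forall>i<k. u' i = u i" "ortho u' {..<n}"
    "\<forall>x\<in>S. oproj u' {..<n} x = x" "\<forall>i<n. u' i \<in> cspan (u ` {..<k} \<union> S)"
  using gram_schmidt_extend [OF assms] by (elim exE conjE) blast

lemma oproj_eqI:
  assumes "\<And>i. i \<in> I \<Longrightarrow> oproj g J (f i) = f i" and "\<And>j. j \<in> J \<Longrightarrow> oproj f I (g j) = g j"
  shows "oproj f I = oproj g J"
proof
  fix x
  have 1: "oproj g J (oproj f I y) = oproj f I y" for y
    by (rule oproj_cspan [OF oproj_in_cspan]) (use assms(1) in auto)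
  have 2: "oproj f I (oproj g J y) = oproj g J y" for y
    by (rule oproj_cspan [OF oproj_in_cspan]) (use assms(2) in auto)
  show "oproj f I x = oproj g J x"
    by (rule cinner_eqI) (metis 1 2 oproj_selfadjoint)
qed

text \<open>Both numbers are \<open>\<Sum>i j. \<bar>\<langle>g\<^sub>j, f\<^sub>i\<rangle>\<bar>\<^sup>2\<close>.\<close>

lemma ortho_same_card:
  fixes f g :: "nat \<Rightarrow> 'h::complex_inner"
  assumes "ortho f {..<n}" "ortho g {..<m}" "oproj f {..<n} = oproj g {..<m}"
  shows "n = m"
proof -
  have *: "cmod (cinner a b) = cmod (cinner b a)" for a b :: 'h
    by (subst cinner_commute) simp
  have f: "(\<Sum>j<m. (cmod (cinner (g j) (f i)))\<^sup>2) = 1" if "i < n" for i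
    using norm_oproj_sq [OF _ assms(2), of "f i"] oproj_family [OF _ assms(1), of i]
      ortho_norm [OF assms(1), of i] that by (simp add: assms(3))
  have g: "(\<Sum>i<n. (cmod (cinner (f i) (g j)))\<^sup>2) = 1" if "j < m" for j
    using norm_oproj_sq [OF _ assms(1), of "g j"] oproj_family [OF _ assms(2), of j]
      ortho_norm [OF assms(2), of j] that by (simp add: assms(3))
  have "real n = (\<Sum>i<n. \<Sum>j<m. (cmod (cinner (g j) (f i)))\<^sup>2)"
    by (simp add: f)
  also have "\<dots> = (\<Sum>j<m. \<Sum>i<n. (cmod (cinner (f i) (g j)))\<^sup>2)"
    by (subst sum.swap) (simp only: *)
  also have "\<dots> = real m"
    by (simp add: g)
  finally show ?thesis
    by simp
qed

section \<open>Eigenvectors of symmetric operators\<close>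

lemma bounded_clinear_linear: "bounded_clinear A \<Longrightarrow> bounded_linear A"
  by (simp add: bounded_clinear_def)

lemma bounded_clinear_scaleC: "bounded_clinear A \<Longrightarrow> A (c *\<^sub>C x) = c *\<^sub>C A x"
  by (simp add: bounded_clinear_def)

lemma bounded_clinear_add: "bounded_clinear A \<Longrightarrow> A (x + y) = A x + A y"
  by (simp add: bounded_clinear_def bounded_linear.linear linear_add)

lemma bounded_clinear_diff: "bounded_clinear A \<Longrightarrow> A (x - y) = A x - A y"
  by (simp add: bounded_clinear_def bounded_linear.linear linear_diff)

lemma bounded_clinear_uminus: "bounded_clinear A \<Longrightarrow> A (- x) = - A x"
  by (simp add: bounded_clinear_def bounded_linear.linear linear_neg)

lemma bounded_clinear_zero: "bounded_clinear A \<Longrightarrow> A 0 = 0"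
  by (simp add: bounded_clinear_def bounded_linear.linear linear_0)

lemma bounded_clinear_sum: "bounded_clinear A \<Longrightarrow> A (sum f I) = (\<Sum>i\<in>I. A (f i))"
  by (simp add: bounded_clinear_def bounded_linear.linear linear_sum)

lemma bounded_clinear_bound:
  assumes "bounded_clinear A"
  obtains b where "b > 0" "\<And>x. norm (A x) \<le> b * norm x"
  using bounded_linear.pos_bounded [OF bounded_clinear_linear [OF assms]]
  by (metis mult.commute)

lemma bounded_clinear_tendsto:
  "bounded_clinear A \<Longrightarrow> (f \<longlongrightarrow> l) F \<Longrightarrow> ((\<lambda>x. A (f x)) \<longlongrightarrow> A l) F"
  by (simp add: bounded_clinear_def bounded_linear.tendsto)

lemma bounded_clinear_continuous: "bounded_clinear A \<Longrightarrow> continuous_on S A"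
  by (simp add: bounded_clinear_def linear_continuous_on)

lemma bounded_clinearI:
  assumes "\<And>x y. A (x + y) = A x + A y" "\<And>c x. A (c *\<^sub>C x) = c *\<^sub>C A x"
    "\<And>x. norm (A x) \<le> b * norm x"
  shows "bounded_clinear (A :: 'h::complex_inner \<Rightarrow> 'h)"
proof -
  have "bounded_linear A"
    by (rule bounded_linear_intro [of _ b]) (simp_all add: assms scaleR_scaleC mult.commute [of _ b])
  thus ?thesis
    by (simp add: bounded_clinear_def assms)
qed

lemma bounded_clinear_compose:
  "bounded_clinear A \<Longrightarrow> bounded_clinear B \<Longrightarrow> bounded_clinear (\<lambda>x. A (B x))"
  by (simp add: bounded_clinear_def bounded_linear_compose)

lemma bounded_clinear_plus:
  "bounded_clinear A \<Longrightarrow> bounded_clinear B \<Longrightarrow> bounded_clinear (\<lambda>x. A x + B x)"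
  by (simp add: bounded_clinear_def bounded_linear_add scaleC_add_right)

lemma bounded_clinear_minus:
  "bounded_clinear A \<Longrightarrow> bounded_clinear B \<Longrightarrow> bounded_clinear (\<lambda>x. A x - B x)"
  by (simp add: bounded_clinear_def bounded_linear_sub scaleC_diff_right)

lemma bounded_clinear_ident: "bounded_clinear (\<lambda>x. x)"
  by (simp add: bounded_clinear_def bounded_linear_ident)

lemma bounded_clinear_const_scaleC:
  "bounded_clinear A \<Longrightarrow> bounded_clinear (\<lambda>x. c *\<^sub>C A x)"
  by (simp add: bounded_clinear_def scaleC_scaleC mult.commute
      bounded_linear_compose [OF bounded_linear_scaleC_right])

lemma bounded_clinear_rank_one: "bounded_clinear (\<lambda>x. cinner v x *\<^sub>C a)"
proof (rule bounded_clinearI)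
  show "norm (cinner v x *\<^sub>C a) \<le> (norm v * norm a) * norm x" for x
    using mult_right_mono [OF cauchy_schwarz [of v x], of "norm a"]
    by (simp add: norm_scaleC mult_ac)
qed (simp_all add: cinner_simps scaleC_add_left scaleC_scaleC)

lemma bounded_clinear_sum_ops:
  assumes "\<And>i. i \<in> I \<Longrightarrow> bounded_clinear (A i :: 'h::complex_inner \<Rightarrow> 'h)"
  shows "bounded_clinear (\<lambda>x. \<Sum>i\<in>I. A i x)"
  using assms
proof (induction I rule: infinite_finite_induct)
  case (insert i I)
  thus ?case
    by (simp add: bounded_clinear_plus)
qed (auto intro: bounded_clinearI [of _ 0])

lemma bounded_clinear_oproj: "bounded_clinear (oproj f I)"
  unfolding oproj_def [abs_def] by (intro bounded_clinear_sum_ops bounded_clinear_rank_one)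

definition symmetric_op :: "('h::complex_inner \<Rightarrow> 'h) \<Rightarrow> bool" where
  "symmetric_op R \<longleftrightarrow> (\<forall>x y. cinner (R x) y = cinner x (R y))"

lemma quadratic_nonneg_imp_zero:
  fixes a b :: real
  assumes "\<And>e. 0 \<le> 2 * e * a + e\<^sup>2 * b"
  shows "a = 0"
proof (rule ccontr)
  assume "a \<noteq> 0"
  define d where "d = \<bar>b\<bar> + 1"
  have d: "d > 0" "b \<le> d"
    by (simp_all add: d_def)
  have "2 * (- a / d) * a + (- a / d)\<^sup>2 * b = (a\<^sup>2 / d) * (b / d - 2)"
    using d by (simp add: field_simps power2_eq_square)
  also have "\<dots> < 0"
    using d \<open>a \<noteq> 0\<close> by (intro mult_pos_neg) (simp_all add: field_simps)
  finally show False
    using assms [of "- a / d"] by simp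
qed

text \<open>The quadratic form attains its maximum on the compact unit sphere of \<open>K\<close>, and a maximiser
  \<open>x\<close> is an eigenvector: moving from \<open>x\<close> in the direction \<open>r x - R x\<close>, which stays in \<open>K\<close>,
  would otherwise increase the form.\<close>

lemma eigenvector_on_compact_sphere:
  fixes R :: "'h::complex_inner \<Rightarrow> 'h"
  assumes R: "bounded_clinear R" "symmetric_op R"
    and K: "complex_vector.subspace K" "\<And>x. x \<in> K \<Longrightarrow> R x \<in> K"
    and S: "compact (K \<inter> {x. norm x = 1})" "y \<in> K" "y \<noteq> 0"
  obtains x r where "x \<in> K" "norm x = 1" "R x = complex_of_real r *\<^sub>C x"
    "\<And>z. z \<in> K \<Longrightarrow> Re (cinner z (R z)) \<le> r * (norm z)\<^sup>2"
proof -
  have scale: "c *\<^sub>C z \<in> K" if "z \<in> K" for c z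
    using complex_vector.subspace_scale [OF K(1) that] .
  have unit: "(1 / of_real (norm z)) *\<^sub>C z \<in> K \<inter> {x. norm x = 1}" if "z \<in> K" "z \<noteq> 0" for z
    using that scale by (simp add: norm_scaleC norm_divide)
  hence "K \<inter> {x. norm x = 1} \<noteq> {}"
    using S by blast
  moreover have "continuous_on (K \<inter> {x. norm x = 1}) (\<lambda>x. Re (cinner x (R x)))"
    by (intro continuous_intros bounded_clinear_continuous R)
  ultimately obtain x where x: "x \<in> K" "norm x = 1"
    and max: "\<And>z. z \<in> K \<Longrightarrow> norm z = 1 \<Longrightarrow> Re (cinner z (R z)) \<le> Re (cinner x (R x))"
    using continuous_attains_sup [OF S(1)] by blast
  define r where "r = Re (cinner x (R x))"
  have bound: "Re (cinner z (R z)) \<le> r * (norm z)\<^sup>2" if "z \<in> K" for z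
  proof (cases "z = 0")
    case False
    define w where "w = (1 / of_real (norm z)) *\<^sub>C z"
    have "w \<in> K" "norm w = 1"
      using unit [OF that False] by (simp_all add: w_def)
    hence "Re (cinner w (R w)) \<le> r"
      using max by (simp add: r_def)
    moreover have z: "z = of_real (norm z) *\<^sub>C w"
      using False by (simp add: w_def scaleC_scaleC scaleC_one)
    have "Re (cinner z (R z)) = (norm z)\<^sup>2 * Re (cinner w (R w))"
      by (subst z, subst (2) z)
        (simp add: bounded_clinear_scaleC [OF R(1)] cinner_simps power2_eq_square)
    ultimately show ?thesis
      by (simp add: mult.commute [of r] mult_left_mono)
  qed (simp add: bounded_clinear_zero [OF R(1)])
  define z where "z = of_real r *\<^sub>C x - R x"
  have zK: "z \<in> K"
    unfolding z_def using x(1) K scale by (intro complex_vector.subspace_diff) auto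
  define Q where "Q = r * (norm z)\<^sup>2 - Re (cinner z (R z))"
  have quad: "0 \<le> 2 * e * (norm z)\<^sup>2 + e\<^sup>2 * Q" for e :: real
  proof -
    have "x + of_real e *\<^sub>C z \<in> K"
      using x(1) zK scale complex_vector.subspace_add [OF K(1)] by blast
    from bound [OF this]
    have 1: "Re (cinner (x + of_real e *\<^sub>C z) (R (x + of_real e *\<^sub>C z)))
        \<le> r * (norm (x + of_real e *\<^sub>C z))\<^sup>2" .
    have s: "Re (cinner x (R z)) = Re (cinner z (R x))"
      using R(2) unfolding symmetric_op_def by (subst cinner_commute) simp
    have s': "Re (cinner x z) = Re (cinner z x)"
      by (subst cinner_commute) simp
    have 2: "Re (cinner (x + of_real e *\<^sub>C z) (R (x + of_real e *\<^sub>C z)))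
      = r + 2 * e * Re (cinner z (R x)) + e\<^sup>2 * Re (cinner z (R z))"
      by (simp add: bounded_clinear_add [OF R(1)] bounded_clinear_scaleC [OF R(1)] cinner_simps s
          r_def power2_eq_square algebra_simps)
    have 3: "(norm (x + of_real e *\<^sub>C z))\<^sup>2 = 1 + 2 * e * Re (cinner z x) + e\<^sup>2 * (norm z)\<^sup>2"
      by (simp add: norm_add_sq x cinner_simps s' norm_scaleC power_mult_distrib)
    have "(norm z)\<^sup>2 = r * Re (cinner z x) - Re (cinner z (R x))"
      unfolding Re_cinner_self [symmetric] by (subst (2) z_def) (simp add: cinner_simps)
    hence "e * (norm z)\<^sup>2 = e * (r * Re (cinner z x) - Re (cinner z (R x)))"
      by simp
    thus ?thesis
      using 1 unfolding 2 3 Q_def by (simp add: algebra_simps)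
  qed
  have "z = 0"
    using quadratic_nonneg_imp_zero [of "(norm z)\<^sup>2" Q] quad by simp
  hence "R x = of_real r *\<^sub>C x"
    by (simp add: z_def)
  thus thesis
    using that x bound by blast
qed

lemma compact_coefficient_box:
  fixes f :: "nat \<Rightarrow> 'h::complex_inner"
  shows "compact {(\<Sum>i<n. c i *\<^sub>C f i) |c. \<forall>i<n. cmod (c i) \<le> b i}"
proof (induction n)
  case 0
  thus ?case
    by simp
next
  case (Suc n)
  let ?K = "{(\<Sum>i<n. c i *\<^sub>C f i) |c. \<forall>i<n. cmod (c i) \<le> b i}"
  have "{(\<Sum>i<Suc n. c i *\<^sub>C f i) |c. \<forall>i<Suc n. cmod (c i) \<le> b i}
      = (\<lambda>(d, y). y + d *\<^sub>C f n) ` (cball 0 (b n) \<times> ?K)" (is "?L = ?R")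
  proof
    show "?L \<subseteq> ?R"
    proof clarsimp
      fix c
      assume "\<forall>i<Suc n. cmod (c i) \<le> b i"
      thus "(\<Sum>i<n. c i *\<^sub>C f i) + c n *\<^sub>C f n \<in> (\<lambda>(d, y). y + d *\<^sub>C f n) ` (cball 0 (b n) \<times> ?K)"
        by (intro image_eqI [of _ _ "(c n, \<Sum>i<n. c i *\<^sub>C f i)"]) auto
    qed
    show "?R \<subseteq> ?L"
    proof clarsimp
      fix d c
      assume "cmod d \<le> b n" "\<forall>i<n. cmod (c i) \<le> b i"
      thus "\<exists>c'. (\<Sum>i<n. c i *\<^sub>C f i) + d *\<^sub>C f n = (\<Sum>i<n. c' i *\<^sub>C f i) + c' n *\<^sub>C f n \<and>
          (\<forall>i<Suc n. cmod (c' i) \<le> b i)"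
        by (intro exI [of _ "c(n := d)"]) (auto simp: less_Suc_eq)
    qed
  qed
  also have "compact \<dots>"
    by (intro compact_continuous_image compact_Times Suc compact_cball)
      (auto simp: case_prod_unfold intro!: continuous_intros)
  finally show ?case .
qed

lemma compact_sphere_oproj:
  fixes f :: "nat \<Rightarrow> 'h::complex_inner"
  assumes "ortho f {..<n}"
  shows "compact ({x. oproj f {..<n} x = x} \<inter> {x. norm x = 1})"
proof -
  let ?B = "{(\<Sum>i<n. c i *\<^sub>C f i) |c. \<forall>i<n. cmod (c i) \<le> 1}"
  have "closed ({x. oproj f {..<n} x = x} \<inter> {x. norm x = 1})"
    by (intro closed_Int closed_Collect_eq continuous_intros bounded_clinear_continuous
        bounded_clinear_oproj)
  moreover have "{x. oproj f {..<n} x = x} \<inter> {x. norm x = 1} \<subseteq> ?B"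
  proof clarsimp
    fix x
    assume x: "oproj f {..<n} x = x" "norm x = 1"
    have "cmod (cinner (f i) x) \<le> 1" if "i < n" for i
      using cauchy_schwarz [of "f i" x] ortho_norm [OF assms, of i] x that by simp
    thus "\<exists>c. x = (\<Sum>i<n. c i *\<^sub>C f i) \<and> (\<forall>i<n. cmod (c i) \<le> 1)"
      using x(1) by (intro exI [of _ "\<lambda>i. cinner (f i) x"]) (simp add: oproj_def)
  qed
  ultimately show ?thesis
    using compact_Int_closed [OF compact_coefficient_box [of f n "\<lambda>_. 1"],
        of "{x. oproj f {..<n} x = x} \<inter> {x. norm x = 1}"] by (simp only: inf.absorb2)
qed

lemma oproj_lessThan_Suc_shift:
  "oproj f {..<Suc n} x = cinner (f 0) x *\<^sub>C f 0 + oproj (\<lambda>i. f (Suc i)) {..<n} x"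
  unfolding oproj_def by (rule sum.lessThan_Suc_shift)

lemma ortho_shift: "ortho f {..<Suc n} \<Longrightarrow> ortho (\<lambda>i. f (Suc i)) {..<n}"
  by (auto simp: ortho_def)

text \<open>The maximiser of the quadratic form comes first, and the induction hypothesis is applied to
  its orthogonal complement; this is what sorts the eigenvalues in decreasing order.\<close>

lemma sorted_eigenbasis:
  fixes R :: "'h::complex_inner \<Rightarrow> 'h" and p :: "nat \<Rightarrow> 'h"
  assumes R: "bounded_clinear R" "symmetric_op R"
    and p: "ortho p {..<n}" "\<And>x. oproj p {..<n} x = x \<Longrightarrow> oproj p {..<n} (R x) = R x"
  shows "\<exists>f s. ortho f {..<n} \<and> oproj f {..<n} = oproj p {..<n} \<and>
    (\<forall>i<n. R (f i) = complex_of_real (s i) *\<^sub>C f i) \<and> (\<forall>i j. i \<le> j \<longrightarrow> j < n \<longrightarrow> s j \<le> s i)"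
  using p
proof (induction n arbitrary: p)
  case 0
  show ?case
    by (auto simp: ortho_def)
next
  case (Suc n)
  let ?K = "{x. oproj p {..<Suc n} x = x}"
  have "p 0 \<in> ?K" "p 0 \<noteq> 0"
    using oproj_family [OF _ Suc.prems(1)] ortho_norm [OF Suc.prems(1), of 0] by auto
  moreover have "R y \<in> ?K" if "y \<in> ?K" for y
    using Suc.prems(2) that by simp
  ultimately obtain x r where x: "x \<in> ?K" "norm x = 1" "R x = complex_of_real r *\<^sub>C x"
    and max: "\<And>z. z \<in> ?K \<Longrightarrow> Re (cinner z (R z)) \<le> r * (norm z)\<^sup>2"
    using eigenvector_on_compact_sphere [OF R csubspace_oproj _ compact_sphere_oproj [OF Suc.prems(1)],
        of "p 0"] by blast
  have "ortho (\<lambda>_. x) {..<(1::nat)}"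
    using x(2) by (simp add: ortho_def cinner_self)
  then obtain m :: nat and u where m: "m \<ge> 1" and ux: "\<forall>i<1. u i = x" and u2: "ortho u {..<m}"
    and u3: "\<forall>y\<in>p ` {..<Suc n}. oproj u {..<m} y = y"
    and u4: "\<forall>i<m. u i \<in> cspan ((\<lambda>_. x) ` {..<(1::nat)} \<union> p ` {..<Suc n})"
    by (rule gram_schmidt_extendE [OF _ finite_imageI [OF finite_lessThan], of _ _ p "Suc n"])
  have u1: "u 0 = x"
    using ux by simp
  have "(\<lambda>_. x) ` {..<(1::nat)} \<union> p ` {..<Suc n} = insert x (p ` {..<Suc n})"
    by auto
  note u4 = u4 [unfolded this]
  note u = u1 u2
  have "oproj p {..<Suc n} (u i) = u i" if "i < m" for i
  proof (rule oproj_cspan)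
    show "u i \<in> cspan (insert x (p ` {..<Suc n}))"
      using u4 that by blast
    show "oproj p {..<Suc n} y = y" if "y \<in> insert x (p ` {..<Suc n})" for y
      using that x(1) oproj_family [OF _ Suc.prems(1)] by auto
  qed
  hence pu: "oproj u {..<m} = oproj p {..<Suc n}"
    using u3 by (intro oproj_eqI) auto
  hence "m = Suc n"
    using ortho_same_card u(2) Suc.prems(1) by blast
  note u' = u(2) [unfolded this] and pu = pu [unfolded this]
  define q where "q = (\<lambda>i. u (Suc i))"
  have oq: "ortho q {..<n}"
    unfolding q_def by (rule ortho_shift [OF u'])
  have split: "oproj p {..<Suc n} y = cinner x y *\<^sub>C x + oproj q {..<n} y" for y
    by (simp add: oproj_lessThan_Suc_shift u(1) q_def flip: pu)
  have xx: "cinner x x = 1"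
    by (simp add: cinner_self x(2))
  have xq: "cinner x (oproj q {..<n} y) = 0" for y
    using orthoD [OF u', of 0] by (simp add: oproj_def cinner_simps q_def flip: u(1))
  have inv: "oproj q {..<n} (R y) = R y" if y: "oproj q {..<n} y = y" for y
  proof -
    have xy: "cinner x y = 0"
      using xq [of y] y by simp
    have "cinner x (R y) = cinner (R x) y"
      using R(2) by (simp add: symmetric_op_def)
    also have "\<dots> = 0"
      by (simp add: x(3) cinner_simps xy)
    finally show ?thesis
      using split [of "R y"] Suc.prems(2) [of y] split [of y] xy y by simp
  qed
  from Suc.IH [OF oq inv]
  obtain f s where f: "ortho f {..<n}" "oproj f {..<n} = oproj q {..<n}"
      "\<And>i. i < n \<Longrightarrow> R (f i) = complex_of_real (s i) *\<^sub>C f i"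
      "\<And>i j. i \<le> j \<Longrightarrow> j < n \<Longrightarrow> s j \<le> s i"
    by blast
  define f' s' where "f' = case_nat x f" and "s' = case_nat r s"
  have fq: "oproj q {..<n} (f i) = f i" if "i < n" for i
    using oproj_family [OF _ f(1), of i] that f(2) by simp
  have xf: "cinner x (f i) = 0" "cinner (f i) x = 0" if "i < n" for i
  proof -
    show "cinner x (f i) = 0"
      using xq [of "f i"] fq [OF that] by simp
    thus "cinner (f i) x = 0"
      by (subst cinner_commute) simp
  qed
  have "ortho f' {..<Suc n}"
    unfolding ortho_def f'_def using xf xx orthoD [OF f(1)] by (auto split: nat.splits)
  moreover have "oproj f' {..<Suc n} = oproj p {..<Suc n}"
    unfolding fun_eq_iff split by (simp add: oproj_lessThan_Suc_shift f'_def f(2))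
  moreover have "\<forall>i<Suc n. R (f' i) = complex_of_real (s' i) *\<^sub>C f' i"
    using f(3) x(3) by (auto simp: f'_def s'_def split: nat.splits)
  moreover have "s' j \<le> s' i" if "i \<le> j" "j < Suc n" for i j
  proof -
    have "s j' \<le> r" if "j' < n" for j'
    proof -
      have "f j' \<in> ?K"
        using fq [OF that] xf [OF that] by (simp add: split)
      from max [OF this] show ?thesis
        using ortho_norm [OF f(1), of j'] that
        by (simp add: f(3) cinner_simps Re_cinner_self orthoD [OF f(1)])
    qed
    thus ?thesis
      using that f(4) by (auto simp: s'_def split: nat.splits)
  qed
  ultimately show ?case
    by blast
qed

section \<open>Majorisation and the convexity argument in finite dimensions\<close>

lemma cinner_zero_sym: "cinner x y = 0 \<Longrightarrow> cinner y (x::'h::complex_inner) = 0"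
  by (subst cinner_commute) simp

text \<open>This is the Toeplitz--Hausdorff argument. Among the unit vectors
  \<open>cos \<phi> u + \<omega> sin \<phi> v\<close> the phase \<open>\<omega>\<close> is chosen such that the values of the quadratic form lie
  on the line through its values at \<open>u\<close> and \<open>v\<close>; the intermediate value theorem in \<open>\<phi>\<close> then
  reaches every point of the segment.\<close>

lemma quadratic_form_on_segment:
  fixes A :: "'h::complex_inner \<Rightarrow> 'h"
  assumes A: "bounded_clinear A"
    and uv: "cinner u u = 1" "cinner v v = 1" "cinner u v = 0"
    and \<tau>: "0 \<le> \<tau>" "\<tau> \<le> 1"
  obtains u' v' where "cinner u' u' = 1" "cinner v' v' = 1" "cinner u' v' = 0"
    "\<And>x. cinner u' x *\<^sub>C u' + cinner v' x *\<^sub>C v' = cinner u x *\<^sub>C u + cinner v x *\<^sub>C v"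
    "cinner u' (A u') = complex_of_real \<tau> * cinner u (A u) + complex_of_real (1 - \<tau>) * cinner v (A v)"
    "cinner u' (A u') + cinner v' (A v') = cinner u (A u) + cinner v (A v)"
proof -
  have vu: "cinner v u = 0"
    by (rule cinner_zero_sym [OF uv(3)])
  define x y \<alpha> \<beta> where "x = cinner u (A u)" and "y = cinner v (A v)"
    and "\<alpha> = cinner u (A v)" and "\<beta> = cinner v (A u)"
  have "\<exists>c s :: real. \<exists>\<omega>. c\<^sup>2 + s\<^sup>2 = 1 \<and> cmod \<omega> = 1 \<and>
     complex_of_real (c\<^sup>2) * x + of_real (s\<^sup>2) * y + of_real (c * s) * (\<omega> * \<alpha> + cnj \<omega> * \<beta>)
     = of_real \<tau> * x + of_real (1 - \<tau>) * y"
  proof (cases "x = y")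
    case True
    have "complex_of_real \<tau> * y + of_real (1 - \<tau>) * y = y"
      by (simp add: algebra_simps)
    thus ?thesis
      using True by (intro exI [of _ 1] exI [of _ 0] conjI) auto
  next
    case False
    define \<gamma> where "\<gamma> = \<alpha> / (x - y) - cnj (\<beta> / (x - y))"
    define \<omega> where "\<omega> = (if \<gamma> = 0 then 1 else cnj \<gamma> / of_real (cmod \<gamma>))"
    define w where "w = (\<omega> * \<alpha> + cnj \<omega> * \<beta>) / (x - y)"
    have \<omega>: "cmod \<omega> = 1"
      by (simp add: \<omega>_def norm_divide)
    have wxy: "\<omega> * \<alpha> + cnj \<omega> * \<beta> = w * (x - y)"
      using False by (simp add: w_def)
    have im: "Im (\<omega> * \<gamma>) = 0"
      by (simp add: \<omega>_def field_simps)
    define q where "q = \<omega> * cnj (\<beta> / (x - y))"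
    have "w = \<omega> * \<gamma> + (q + cnj q)"
      by (simp add: w_def \<gamma>_def q_def field_simps add_divide_distrib)
    hence "Im w = Im (\<omega> * \<gamma>) + Im (q + cnj q)"
      by (simp only: plus_complex.sel)
    also have "\<dots> = 0"
      unfolding im by simp
    finally have "Im w = 0" .
    hence w: "complex_of_real (Re w) = w"
      by (simp add: complex_eq_iff)
    define g where "g = (\<lambda>\<phi>. (cos \<phi>)\<^sup>2 + Re w * (cos \<phi> * sin \<phi>))"
    have "\<exists>\<phi>\<ge>0. \<phi> \<le> pi / 2 \<and> g \<phi> = \<tau>"
      by (rule IVT2') (use \<tau> in \<open>auto simp: g_def intro!: continuous_intros\<close>)
    then obtain \<phi> where \<phi>: "g \<phi> = \<tau>"
      by blast
    have "complex_of_real ((cos \<phi>)\<^sup>2) * x + of_real ((sin \<phi>)\<^sup>2) * y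
        + of_real (cos \<phi> * sin \<phi>) * (\<omega> * \<alpha> + cnj \<omega> * \<beta>)
      = y + (complex_of_real ((cos \<phi>)\<^sup>2) + of_real (cos \<phi> * sin \<phi>) * w) * (x - y)"
      unfolding wxy by (simp add: sin_squared_eq algebra_simps)
    also have "complex_of_real ((cos \<phi>)\<^sup>2) + of_real (cos \<phi> * sin \<phi>) * w = of_real (g \<phi>)"
      by (subst w [symmetric]) (simp add: g_def mult.commute)
    also have "y + complex_of_real (g \<phi>) * (x - y) = of_real \<tau> * x + of_real (1 - \<tau>) * y"
      by (simp add: \<phi> algebra_simps)
    finally show ?thesis
      using \<omega> by (intro exI [of _ "cos \<phi>"] exI [of _ "sin \<phi>"] exI [of _ \<omega>]) simp
  qed
  then obtain c s :: real and \<omega> where cs: "c\<^sup>2 + s\<^sup>2 = 1" and \<omega>: "cmod \<omega> = 1"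
    and val: "complex_of_real (c\<^sup>2) * x + of_real (s\<^sup>2) * y + of_real (c * s) * (\<omega> * \<alpha> + cnj \<omega> * \<beta>)
     = of_real \<tau> * x + of_real (1 - \<tau>) * y"
    by blast
  define C S where "C = complex_of_real c" and "S = complex_of_real s"
  have CS: "C * C + S * S = 1"
    using cs unfolding C_def S_def
    by (metis of_real_1 of_real_add of_real_mult power2_eq_square)
  have ww: "\<omega> * cnj \<omega> = 1"
    using \<omega> by (simp flip: complex_norm_square)
  have [simp]: "cnj C = C" "cnj S = S"
    by (simp_all add: C_def S_def)
  define u' v' where "u' = C *\<^sub>C u + (\<omega> * S) *\<^sub>C v" and "v' = (- (S * cnj \<omega>)) *\<^sub>C u + C *\<^sub>C v"
  note A_simps = bounded_clinear_add [OF A] bounded_clinear_diff [OF A] bounded_clinear_scaleC [OF A]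
  have "cinner u' u' = C * C + (\<omega> * cnj \<omega>) * (S * S)"
    by (simp add: u'_def cinner_simps uv vu algebra_simps)
  hence 1: "cinner u' u' = 1"
    by (simp add: ww CS)
  have "cinner v' v' = (\<omega> * cnj \<omega>) * (S * S) + C * C"
    by (simp add: v'_def cinner_simps uv vu algebra_simps)
  hence 2: "cinner v' v' = 1"
    using CS by (simp add: ww add.commute)
  have 3: "cinner u' v' = 0"
    by (simp add: u'_def v'_def cinner_simps uv vu algebra_simps)
  have 4: "cinner u' z *\<^sub>C u' + cinner v' z *\<^sub>C v' = cinner u z *\<^sub>C u + cinner v z *\<^sub>C v" for z
  proof -
    define \<xi> \<eta> where "\<xi> = cinner u z" and "\<eta> = cinner v z"
    have a: "cinner u' z = C * \<xi> + cnj \<omega> * S * \<eta>" and b: "cinner v' z = - (S * \<omega>) * \<xi> + C * \<eta>"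
      by (simp_all add: u'_def v'_def cinner_simps \<xi>_def \<eta>_def)
    have "cinner u' z *\<^sub>C u' + cinner v' z *\<^sub>C v'
      = (C * cinner u' z - S * cnj \<omega> * cinner v' z) *\<^sub>C u + (\<omega> * S * cinner u' z + C * cinner v' z) *\<^sub>C v"
      by (simp only: u'_def [of] v'_def [of]) (simp add: scaleC_add_right scaleC_add_left
        scaleC_diff_left scaleC_scaleC scaleC_minus_left scaleC_minus_right algebra_simps)
    also have "C * cinner u' z - S * cnj \<omega> * cinner v' z = \<xi>"
      unfolding a b using CS ww by algebra
    also have "\<omega> * S * cinner u' z + C * cinner v' z = \<eta>"
      unfolding a b using CS ww by algebra
    finally show ?thesis
      by (simp add: \<xi>_def \<eta>_def)
  qed
  have u': "cinner u' (A u') = C * C * x + (\<omega> * cnj \<omega>) * S * S * y + C * S * (\<omega> * \<alpha> + cnj \<omega> * \<beta>)"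
    by (simp add: u'_def A_simps cinner_simps x_def y_def \<alpha>_def \<beta>_def algebra_simps)
  have v': "cinner v' (A v') = (\<omega> * cnj \<omega>) * S * S * x + C * C * y - C * S * (\<omega> * \<alpha> + cnj \<omega> * \<beta>)"
    by (simp add: v'_def A_simps cinner_simps x_def y_def \<alpha>_def \<beta>_def algebra_simps)
  have 5: "cinner u' (A u') = complex_of_real \<tau> * x + complex_of_real (1 - \<tau>) * y"
    unfolding u' val [symmetric] by (simp add: ww C_def S_def power2_eq_square mult.assoc)
  have 6: "cinner u' (A u') + cinner v' (A v') = x + y"
    unfolding u' v' using CS ww by algebra
  show thesis
    using that [OF 1 2 3 4] 5 6 by (simp add: x_def y_def)
qed

text \<open>Rotating an orthonormal pair within its span turns the weights \<open>a, b\<close> into any more spread out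
  pair \<open>p, q\<close> with the same sum, without changing the weighted sum of the values of the form.\<close>

lemma weights_spread:
  fixes A :: "'h::complex_inner \<Rightarrow> 'h" and a b p q :: real
  assumes A: "bounded_clinear A"
    and uv: "cinner u u = 1" "cinner v v = 1" "cinner u v = 0"
    and ab: "a + b = p + q" "q \<le> a" "a \<le> p"
  obtains u' v' where "cinner u' u' = 1" "cinner v' v' = 1" "cinner u' v' = 0"
    "\<And>x. cinner u' x *\<^sub>C u' + cinner v' x *\<^sub>C v' = cinner u x *\<^sub>C u + cinner v x *\<^sub>C v"
    "of_real p * cinner u' (A u') + of_real q * cinner v' (A v')
      = of_real a * cinner u (A u) + of_real b * cinner v (A v)"
proof -
  define \<tau> where "\<tau> = (a - q) / (p - q)"
  have \<tau>: "0 \<le> \<tau>" "\<tau> \<le> 1"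
    using ab by (auto simp: \<tau>_def divide_le_eq_1)
  have "\<tau> * (p - q) = a - q"
    using ab by (cases "p = q") (auto simp: \<tau>_def)
  hence a: "a = q + \<tau> * (p - q)" and b: "b = q + (1 - \<tau>) * (p - q)"
    using ab by (simp_all add: algebra_simps)
  from quadratic_form_on_segment [OF A uv \<tau>] obtain u' v' where
    *: "cinner u' u' = 1" "cinner v' v' = 1" "cinner u' v' = 0"
    "\<And>x. cinner u' x *\<^sub>C u' + cinner v' x *\<^sub>C v' = cinner u x *\<^sub>C u + cinner v x *\<^sub>C v"
    and 5: "cinner u' (A u') = complex_of_real \<tau> * cinner u (A u) + complex_of_real (1 - \<tau>) * cinner v (A v)"
    and 6: "cinner u' (A u') + cinner v' (A v') = cinner u (A u) + cinner v (A v)"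
    by blast
  have "of_real p * cinner u' (A u') + of_real q * cinner v' (A v')
    = of_real (p - q) * cinner u' (A u') + of_real q * (cinner u' (A u') + cinner v' (A v'))"
    by (simp add: algebra_simps)
  also have "\<dots> = of_real a * cinner u (A u) + of_real b * cinner v (A v)"
    unfolding 6 unfolding 5 a b by (simp add: algebra_simps)
  finally show thesis
    using that * by blast
qed

text \<open>The Hardy--Littlewood--Polya theorem, carried out on the vectors. Splitting off the last
  weight \<open>a = l\<^sub>m\<close>, which lies between two consecutive entries \<open>s\<^sub>k \<ge> a \<ge> s\<^sub>k\<^sub>+\<^sub>1\<close>, replaces these
  two by the single entry \<open>b = s\<^sub>k + s\<^sub>k\<^sub>+\<^sub>1 - a\<close>. The remaining weights are majorised by the
  shorter sequence, so the induction hypothesis applies, and afterwards the weights \<open>b\<close> and \<open>a\<close>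
  are spread to \<open>s\<^sub>k\<close> and \<open>s\<^sub>k\<^sub>+\<^sub>1\<close> by a rotation in one plane.\<close>

lemma majorised_weights:
  fixes A :: "'h::complex_inner \<Rightarrow> 'h" and g :: "nat \<Rightarrow> 'h" and s l :: "nat \<Rightarrow> real"
  assumes A: "bounded_clinear A"
    and "ortho g {..<n}"
    and "\<And>i j. i \<le> j \<Longrightarrow> j < n \<Longrightarrow> s j \<le> s i"
    and "\<And>J. J \<subseteq> {..<n} \<Longrightarrow> (\<Sum>i\<in>J. l i) \<le> (\<Sum>i<card J. s i)"
    and "(\<Sum>i<n. l i) = (\<Sum>i<n. s i)"
  shows "\<exists>h. ortho h {..<n} \<and> oproj h {..<n} = oproj g {..<n} \<and>
    (\<Sum>i<n. complex_of_real (s i) * cinner (h i) (A (h i))) =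
    (\<Sum>i<n. complex_of_real (l i) * cinner (g i) (A (g i)))"
  using assms(2-)
proof (induction n arbitrary: s)
  case 0
  show ?case
    by (intro exI [of _ g]) (auto simp: ortho_def)
next
  case (Suc m)
  note og = Suc.prems(1) and s_decr = Suc.prems(2) and maj = Suc.prems(3) and tot = Suc.prems(4)
  define a where "a = l m"
  show ?case
  proof (cases "m = 0")
    case True
    thus ?thesis
      using og tot by (intro exI [of _ g]) auto
  next
    case False
    have "a \<le> s 0"
      using maj [of "{m}"] by (simp add: a_def)
    have "s m \<le> a"
      using maj [of "{..<m}"] tot by (simp add: a_def)
    have "\<exists>k<m. a \<le> s k \<and> s (Suc k) \<le> a"
    proof (rule ccontr)
      assume *: "\<not> ?thesis"
      have "a \<le> s k" if "k \<le> m" for k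
        using that
      proof (induction k)
        case (Suc k)
        thus ?case
          using * by (meson Suc_le_eq less_imp_le linear)
      qed (use \<open>a \<le> s 0\<close> in simp)
      from this [of "m - 1"] show False
        using * \<open>s m \<le> a\<close> False by (metis Suc_diff_1 bot_nat_0.not_eq_extremum diff_le_self lessI)
    qed
    then obtain k where k: "k < m" "a \<le> s k" "s (Suc k) \<le> a"
      by blast
    define b where "b = s k + s (Suc k) - a"
    define s' where "s' = (\<lambda>i. if i < k then s i else if i = k then b else s (Suc i))"
    have s'_decr: "s' j \<le> s' i" if "i \<le> j" "j < m" for i j
    proof -
      have "b \<le> s k" "s (Suc k) \<le> b"
        using k by (simp_all add: b_def)
      moreover have "s k \<le> s i" if "i \<le> k"
        using s_decr [of i k] that k by simp
      moreover have "s (Suc j) \<le> s (Suc k)" if "k \<le> j"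
        using s_decr [of "Suc k" "Suc j"] that \<open>j < m\<close> by simp
      ultimately show ?thesis
        using that s_decr [of i j] s_decr [of i "Suc j"] s_decr [of "Suc i" "Suc j"]
        by (auto simp: s'_def)
    qed
    have sum_lo: "(\<Sum>i<j. s' i) = (\<Sum>i<j. s i)" if "j \<le> k" for j
      by (rule sum.cong) (use that in \<open>auto simp: s'_def\<close>)
    have sum_hi: "(\<Sum>i<j. s' i) = (\<Sum>i<Suc j. s i) - a" if "Suc k \<le> j" for j
      using that
    proof (induction j rule: dec_induct)
      case base
      have "(\<Sum>i<Suc k. s' i) = (\<Sum>i<k. s i) + b"
        using sum_lo [of k] by (simp add: s'_def)
      thus ?case
        by (simp add: b_def)
    next
      case (step j)
      thus ?case
        by (simp add: s'_def)
    qed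
    have maj': "(\<Sum>i\<in>J. l i) \<le> (\<Sum>i<card J. s' i)" if "J \<subseteq> {..<m}" for J
    proof (cases "card J \<le> k")
      case True
      have "J \<subseteq> {..<Suc m}"
        using that by auto
      thus ?thesis
        using maj [of J] sum_lo [OF True] by simp
    next
      case False
      have J: "finite J" "m \<notin> J"
        using that finite_subset by auto
      have "insert m J \<subseteq> {..<Suc m}"
        using that by auto
      from maj [OF this] show ?thesis
        using False J sum_hi [of "card J"] by (simp add: a_def)
    qed
    have tot': "(\<Sum>i<m. l i) = (\<Sum>i<m. s' i)"
      using sum_hi [of m] k tot by (simp add: a_def)
    have og': "ortho g {..<m}"
      by (rule ortho_subset [OF og]) auto
    obtain h where h: "ortho h {..<m}" "oproj h {..<m} = oproj g {..<m}"
      "(\<Sum>i<m. complex_of_real (s' i) * cinner (h i) (A (h i))) =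
       (\<Sum>i<m. complex_of_real (l i) * cinner (g i) (A (g i)))"
      using Suc.IH [OF og' s'_decr maj' tot'] by blast
    have gh: "cinner (g m) (h i) = 0" if "i < m" for i
    proof -
      have "cinner (g m) (oproj g {..<m} (h i)) = 0"
        using orthoD [OF og, of m] by (simp add: oproj_def cinner_simps)
      thus ?thesis
        using oproj_family [OF _ h(1), of i] that by (simp add: h(2))
    qed
    have hk: "cinner (h k) (h k) = 1" and gm: "cinner (g m) (g m) = 1" and hg: "cinner (h k) (g m) = 0"
      using orthoD [OF h(1), of k k] orthoD [OF og, of m m] cinner_zero_sym [OF gh [of k]] k by simp_all
    have ba: "b + a = s k + s (Suc k)" "s (Suc k) \<le> b" "b \<le> s k"
      using k by (simp_all add: b_def)
    obtain u v where uv: "cinner u u = 1" "cinner v v = 1" "cinner u v = 0"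
      and uv_proj: "\<And>x. cinner u x *\<^sub>C u + cinner v x *\<^sub>C v = cinner (h k) x *\<^sub>C h k + cinner (g m) x *\<^sub>C g m"
      and uv_val: "of_real (s k) * cinner u (A u) + of_real (s (Suc k)) * cinner v (A v)
        = of_real b * cinner (h k) (A (h k)) + of_real a * cinner (g m) (A (g m))"
      using weights_spread [OF A hk gm hg ba] by blast
    have vu: "cinner v u = 0"
      by (rule cinner_zero_sym [OF uv(3)])
    have uh: "cinner u (h i) = 0" "cinner v (h i) = 0" if "i < m" "i \<noteq> k" for i
    proof -
      have *: "cinner u (h i) *\<^sub>C u + cinner v (h i) *\<^sub>C v = 0"
        using uv_proj [of "h i"] gh [of i] orthoD [OF h(1), of k i] that k by simp
      show "cinner u (h i) = 0"
        using arg_cong [OF *, of "cinner u"] by (simp add: cinner_simps uv)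
      show "cinner v (h i) = 0"
        using arg_cong [OF *, of "cinner v"] by (simp add: cinner_simps uv vu)
    qed
    \<comment> \<open>In \<open>w\<close> the rotated pair sits at the positions \<open>k\<close> and \<open>m\<close>; \<open>\<pi>\<close> below moves it to \<open>k\<close> and \<open>k + 1\<close>,
      where the weights \<open>s\<^sub>k\<close> and \<open>s\<^sub>k\<^sub>+\<^sub>1\<close> belong.\<close>
    define w where "w = h(k := u, m := v)"
    have w: "w k = u" "w m = v" "\<And>i. i < m \<Longrightarrow> i \<noteq> k \<Longrightarrow> w i = h i"
      using k by (auto simp: w_def)
    have "cinner (w i) (w j) = (if i = j then 1 else 0)" if "i < Suc m" "j < Suc m" for i j
    proof -
      have hu: "cinner (h i) u = 0" "cinner (h i) v = 0" if "i < m" "i \<noteq> k" for i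
        using uh [OF that] cinner_zero_sym by blast+
      have "i = k \<or> i = m \<or> i < m \<and> i \<noteq> k" "j = k \<or> j = m \<or> j < m \<and> j \<noteq> k"
        using that by linarith+
      thus ?thesis
        using k w uv vu uh hu orthoD [OF h(1)] by (elim disjE conjE) simp_all
    qed
    hence ow: "ortho w {..<Suc m}"
      by (simp add: ortho_def)
    have split: "sum F {..<Suc m} = sum F ({..<m} - {k}) + F k + F m" for F :: "nat \<Rightarrow> 'b::ab_group_add"
      using sum.remove [of "{..<m}" k F] k by (simp add: add.commute)
    have split': "sum F {..<m} = sum F ({..<m} - {k}) + F k" for F :: "nat \<Rightarrow> 'b::ab_group_add"
      using sum.remove [of "{..<m}" k F] k by (simp add: add.commute)
    have w_proj: "oproj w {..<Suc m} = oproj g {..<Suc m}"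
    proof
      fix x
      have "oproj w {..<Suc m} x = (\<Sum>i\<in>{..<m} - {k}. cinner (h i) x *\<^sub>C h i)
          + (cinner u x *\<^sub>C u + cinner v x *\<^sub>C v)"
        unfolding oproj_def split using w by (simp add: add.assoc)
      also have "\<dots> = oproj h {..<m} x + cinner (g m) x *\<^sub>C g m"
        unfolding uv_proj unfolding oproj_def split' by (simp add: add.assoc)
      also have "\<dots> = oproj g {..<Suc m} x"
        unfolding h(2) by (simp add: oproj_def)
      finally show "oproj w {..<Suc m} x = oproj g {..<Suc m} x" .
    qed
    define \<pi> where "\<pi> = (\<lambda>i. if i \<le> k then i else if i = Suc k then m else i - 1)"
    define r where "r = (\<lambda>j. if j = k then s k else if j = m then s (Suc k) else s' j)"
    have \<pi>: "bij_betw \<pi> {..<Suc m} {..<Suc m}"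
    proof -
      have inj: "inj_on \<pi> {..<Suc m}"
        using k by (auto simp: inj_on_def \<pi>_def split: if_splits)
      moreover have "\<pi> ` {..<Suc m} \<subseteq> {..<Suc m}"
        using k by (auto simp: \<pi>_def)
      ultimately show ?thesis
        by (simp add: bij_betw_def endo_inj_surj)
    qed
    have r\<pi>: "r (\<pi> i) = s i" if "i < Suc m" for i
      using that k by (auto simp: r_def \<pi>_def s'_def)
    have "ortho (\<lambda>i. w (\<pi> i)) {..<Suc m}"
      using ow \<pi> unfolding ortho_def bij_betw_def inj_on_def by (metis image_eqI)
    moreover have "oproj (\<lambda>i. w (\<pi> i)) {..<Suc m} = oproj g {..<Suc m}"
      unfolding w_proj [symmetric] fun_eq_iff oproj_def
      using sum.reindex_bij_betw [OF \<pi>, where g = "\<lambda>i. cinner (w i) x *\<^sub>C w i" for x] by blast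
    moreover have "(\<Sum>i<Suc m. complex_of_real (s i) * cinner (w (\<pi> i)) (A (w (\<pi> i)))) =
      (\<Sum>i<Suc m. complex_of_real (l i) * cinner (g i) (A (g i)))"
    proof -
      have "(\<Sum>i<Suc m. complex_of_real (s i) * cinner (w (\<pi> i)) (A (w (\<pi> i)))) =
        (\<Sum>i<Suc m. complex_of_real (r (\<pi> i)) * cinner (w (\<pi> i)) (A (w (\<pi> i))))"
        by (rule sum.cong) (simp_all add: r\<pi>)
      also have "\<dots> = (\<Sum>j<Suc m. complex_of_real (r j) * cinner (w j) (A (w j)))"
        by (rule sum.reindex_bij_betw [OF \<pi>])
      also have "\<dots> = (\<Sum>i\<in>{..<m} - {k}. complex_of_real (s' i) * cinner (h i) (A (h i)))
          + (of_real (s k) * cinner u (A u) + of_real (s (Suc k)) * cinner v (A v))"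
        unfolding split using w k by (simp add: r_def add.assoc)
      also have "\<dots> = (\<Sum>i<m. complex_of_real (s' i) * cinner (h i) (A (h i)))
          + of_real a * cinner (g m) (A (g m))"
        unfolding uv_val split' by (simp add: s'_def add.assoc)
      finally show ?thesis
        by (simp add: h(3) a_def)
    qed
    ultimately show ?thesis
      by blast
  qed
qed

text \<open>Among all weights between \<open>0\<close> and \<open>1\<close> with total \<open>c\<close> the best choice puts weight \<open>1\<close> on the \<open>c\<close>
  largest entries.\<close>

lemma weighted_sum_le_top:
  fixes s w :: "nat \<Rightarrow> real"
  assumes s: "\<And>i j. i \<le> j \<Longrightarrow> j < n \<Longrightarrow> s j \<le> s i"
    and w: "\<And>i. i < n \<Longrightarrow> 0 \<le> w i" "\<And>i. i < n \<Longrightarrow> w i \<le> 1" "(\<Sum>i<n. w i) = real c" "c \<le> n"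
  shows "(\<Sum>i<n. w i * s i) \<le> (\<Sum>i<c. s i)"
proof (cases "c = 0")
  case True
  hence "\<forall>i\<in>{..<n}. w i = 0"
    using w by (subst sum_nonneg_eq_0_iff [symmetric]) auto
  thus ?thesis
    using True by simp
next
  case False
  \<comment> \<open>Subtracting the threshold \<open>r\<close> changes nothing, as both sides have total weight \<open>c\<close>; afterwards the
    inequality holds term by term.\<close>
  define r where "r = s (c - 1)"
  define ind where "ind = (\<lambda>i. (if i < c then 1 else 0) :: real)"
  have *: "(\<Sum>i<n. ind i * F i) = (\<Sum>i<c. F i)" for F
  proof -
    have "(\<Sum>i<n. ind i * F i) = (\<Sum>i<n. if i \<in> {..<c} then F i else 0)"
      by (rule sum.cong) (simp_all add: ind_def)
    also have "\<dots> = sum F ({..<n} \<inter> {..<c})"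
      by (rule sum.inter_restrict [symmetric]) simp
    also have "{..<n} \<inter> {..<c} = {..<c}"
      using w(4) by auto
    finally show ?thesis .
  qed
  have "(\<Sum>i<n. (w i - ind i) * (s i - r)) \<le> (\<Sum>i<n. 0)"
  proof (rule sum_mono)
    fix i
    assume "i \<in> {..<n}"
    hence i: "i < n"
      by simp
    show "(w i - ind i) * (s i - r) \<le> 0"
    proof (cases "i < c")
      case True
      have "r \<le> s i"
        unfolding r_def by (rule s) (use True w(4) in auto)
      thus ?thesis
        using w(2) [OF i] True by (simp add: ind_def mult_le_0_iff)
    next
      case False
      have "s i \<le> r"
        unfolding r_def by (rule s) (use False i in auto)
      thus ?thesis
        using w(1) [OF i] False by (simp add: ind_def mult_le_0_iff)
    qed
  qed
  moreover have "(\<Sum>i<n. (w i - ind i) * (s i - r))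
     = ((\<Sum>i<n. w i * s i) - (\<Sum>i<n. ind i * s i)) - ((\<Sum>i<n. w i) - (\<Sum>i<n. ind i * 1)) * r"
    by (simp add: sum_subtractf algebra_simps sum_distrib_left sum_distrib_right sum.distrib)
  ultimately show ?thesis
    unfolding * by (simp add: w(3))
qed

text \<open>Poon's argument. The convex combination on the right is \<open>tr (Z A)\<close> with
  \<open>Z = (1 - t) X + t X'\<close>, where \<open>X\<close> and \<open>X'\<close> have the eigenvalues \<open>s\<close> on the bases \<open>f\<close> and \<open>f'\<close>.
  The eigenvalues \<open>l\<close> of the Hermitian operator \<open>Z\<close> arise from \<open>s\<close> by a doubly stochastic matrix,
  hence are majorised by \<open>s\<close>.\<close>

lemma convex_combination_of_bases:
  fixes A :: "'h::complex_inner \<Rightarrow> 'h" and f f' :: "nat \<Rightarrow> 'h" and s :: "nat \<Rightarrow> real"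
  assumes A: "bounded_clinear A"
    and f: "ortho f {..<n}" and f': "ortho f' {..<n}" and ff': "oproj f' {..<n} = oproj f {..<n}"
    and s: "\<And>i j. i \<le> j \<Longrightarrow> j < n \<Longrightarrow> s j \<le> s i"
    and t: "0 \<le> t" "t \<le> 1"
  shows "\<exists>h. ortho h {..<n} \<and> oproj h {..<n} = oproj f {..<n} \<and>
    (\<Sum>i<n. complex_of_real (s i) * cinner (h i) (A (h i))) =
    complex_of_real (1 - t) * (\<Sum>i<n. complex_of_real (s i) * cinner (f i) (A (f i))) +
    complex_of_real t * (\<Sum>i<n. complex_of_real (s i) * cinner (f' i) (A (f' i)))"
proof -
  define Z where "Z = (\<lambda>x. (\<Sum>j<n. of_real ((1 - t) * s j) *\<^sub>C cinner (f j) x *\<^sub>C f j)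
    + (\<Sum>j<n. of_real (t * s j) *\<^sub>C cinner (f' j) x *\<^sub>C f' j))"
  have Z: "bounded_clinear Z"
    unfolding Z_def by (intro bounded_clinear_plus bounded_clinear_sum_ops
        bounded_clinear_const_scaleC bounded_clinear_rank_one)
  have "symmetric_op Z"
    unfolding symmetric_op_def Z_def
    by (simp add: cinner_simps cinner_commute [of _ "f _"] cinner_commute [of _ "f' _"] mult_ac)
  moreover have "oproj f {..<n} (Z x) = Z x" for x
    unfolding Z_def oproj_add oproj_sum oproj_scaleC
    using oproj_family [OF _ f] oproj_family [OF _ f'] by (simp add: ff')
  ultimately obtain g l where g: "ortho g {..<n}" and gf: "oproj g {..<n} = oproj f {..<n}"
    and Zg: "\<And>i. i < n \<Longrightarrow> Z (g i) = complex_of_real (l i) *\<^sub>C g i"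
    using sorted_eigenbasis [OF Z _ f] by blast
  \<comment> \<open>the doubly stochastic matrix with \<open>l = D s\<close>\<close>
  define D where "D = (\<lambda>i j. (1 - t) * (cmod (cinner (f j) (g i)))\<^sup>2 + t * (cmod (cinner (f' j) (g i)))\<^sup>2)"
  have sq: "cinner y x * cinner x y = of_real ((cmod (cinner x y))\<^sup>2)" for x y :: 'h
    by (subst cinner_commute) (simp add: complex_norm_square mult.commute del: of_real_power)
  have l: "l i = (\<Sum>j<n. D i j * s j)" if "i < n" for i
  proof -
    have "of_real (l i) = cinner (g i) (Z (g i))"
      using that by (simp add: Zg cinner_simps orthoD [OF g])
    also have "\<dots> = (\<Sum>j<n. of_real ((1 - t) * s j) * (cinner (g i) (f j) * cinner (f j) (g i)))
       + (\<Sum>j<n. of_real (t * s j) * (cinner (g i) (f' j) * cinner (f' j) (g i)))"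
      unfolding Z_def by (simp add: cinner_simps mult_ac)
    also have "\<dots> = of_real (\<Sum>j<n. D i j * s j)"
      unfolding sq of_real_mult [symmetric] of_real_sum [symmetric] of_real_add [symmetric]
      by (simp only: D_def sum.distrib [symmetric]) (simp add: algebra_simps)
    finally show ?thesis
      using of_real_eq_iff by blast
  qed
  have flip: "cmod (cinner x y) = cmod (cinner y x)" for x y :: 'h
    by (subst cinner_commute) simp
  have D0: "0 \<le> D i j" for i j
    using t by (simp add: D_def)
  have row: "(\<Sum>j<n. D i j) = 1" if "i < n" for i
  proof -
    have "oproj f {..<n} (g i) = g i"
      using oproj_family [OF _ g, of i] that by (simp add: gf)
    hence "(\<Sum>j<n. (cmod (cinner (f j) (g i)))\<^sup>2) = 1" "(\<Sum>j<n. (cmod (cinner (f' j) (g i)))\<^sup>2) = 1"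
      using norm_oproj_sq [OF _ f, of "g i"] norm_oproj_sq [OF _ f', of "g i"]
        ortho_norm [OF g, of i] that by (simp_all add: ff')
    thus ?thesis
      by (simp add: D_def sum.distrib flip: sum_distrib_left)
  qed
  have col: "(\<Sum>i\<in>J. D i j) \<le> 1" if "J \<subseteq> {..<n}" "j < n" for J j
  proof -
    have J: "finite J" "ortho g J"
      using that finite_subset ortho_subset [OF g] by auto
    have *: "(\<Sum>i\<in>J. (cmod (cinner (e j) (g i)))\<^sup>2) \<le> 1" if "ortho e {..<n}" for e :: "nat \<Rightarrow> 'h"
      using bessel [OF J, of "e j"] ortho_norm [OF that, of j] \<open>j < n\<close> by (simp add: flip [of "e j"])
    have "(\<Sum>i\<in>J. D i j) = (1 - t) * (\<Sum>i\<in>J. (cmod (cinner (f j) (g i)))\<^sup>2)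
        + t * (\<Sum>i\<in>J. (cmod (cinner (f' j) (g i)))\<^sup>2)"
      by (simp add: D_def sum.distrib sum_distrib_left)
    also have "\<dots> \<le> (1 - t) * 1 + t * 1"
      using t by (intro add_mono mult_left_mono * f f') auto
    finally show ?thesis
      by simp
  qed
  have lJ: "(\<Sum>i\<in>J. l i) = (\<Sum>j<n. (\<Sum>i\<in>J. D i j) * s j)" if "J \<subseteq> {..<n}" for J
  proof -
    have "(\<Sum>i\<in>J. l i) = (\<Sum>i\<in>J. \<Sum>j<n. D i j * s j)"
      by (rule sum.cong) (use that l in auto)
    also have "\<dots> = (\<Sum>j<n. (\<Sum>i\<in>J. D i j) * s j)"
      by (subst sum.swap) (simp add: sum_distrib_right)
    finally show ?thesis .
  qed
  have wJ: "(\<Sum>j<n. \<Sum>i\<in>J. D i j) = real (card J)" if "J \<subseteq> {..<n}" for J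
  proof -
    have "(\<Sum>j<n. \<Sum>i\<in>J. D i j) = (\<Sum>i\<in>J. \<Sum>j<n. D i j)"
      by (rule sum.swap)
    also have "\<dots> = (\<Sum>i\<in>J. 1)"
      by (rule sum.cong) (use that row in auto)
    finally show ?thesis
      by simp
  qed
  have maj: "(\<Sum>i\<in>J. l i) \<le> (\<Sum>i<card J. s i)" if "J \<subseteq> {..<n}" for J
    unfolding lJ [OF that]
    by (rule weighted_sum_le_top [OF s])
      (use that in \<open>auto intro!: sum_nonneg D0 col wJ simp: card_mono [of "{..<n}" J, simplified]\<close>)
  have tot: "(\<Sum>i<n. l i) = (\<Sum>i<n. s i)"
  proof -
    have 1: "(\<Sum>i<n. D i j) = 1" if "j < n" for j
    proof -
      have "(\<Sum>j<n. 1 - (\<Sum>i<n. D i j)) = 0"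
        using wJ [of "{..<n}"] by (simp add: sum_subtractf)
      hence "\<forall>j\<in>{..<n}. 1 - (\<Sum>i<n. D i j) = 0"
        using col [of "{..<n}"] by (subst sum_nonneg_eq_0_iff [symmetric]) auto
      thus ?thesis
        using that by auto
    qed
    show ?thesis
      unfolding lJ [OF order_refl] by (simp add: 1)
  qed
  obtain h where h: "ortho h {..<n}" "oproj h {..<n} = oproj g {..<n}"
      and hs: "(\<Sum>i<n. complex_of_real (s i) * cinner (h i) (A (h i))) =
       (\<Sum>i<n. complex_of_real (l i) * cinner (g i) (A (g i)))"
    using majorised_weights [OF A g s maj tot] by blast
  have trace: "(\<Sum>i<n. cinner (e j) (g i) * cinner (g i) (A (e j))) = cinner (e j) (A (e j))"
    if "ortho e {..<n}" "oproj e {..<n} = oproj f {..<n}" "j < n" for e :: "nat \<Rightarrow> 'h" and j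
  proof -
    have "(\<Sum>i<n. cinner (e j) (g i) * cinner (g i) (A (e j))) = cinner (e j) (oproj g {..<n} (A (e j)))"
      by (simp add: oproj_def cinner_simps mult.commute)
    also have "\<dots> = cinner (oproj g {..<n} (e j)) (A (e j))"
      by (rule oproj_selfadjoint [symmetric])
    also have "oproj g {..<n} (e j) = e j"
      using oproj_family [OF _ that(1), of j] that by (simp add: gf)
    finally show ?thesis .
  qed
  have "(\<Sum>i<n. complex_of_real (l i) * cinner (g i) (A (g i))) = (\<Sum>i<n. cinner (g i) (A (Z (g i))))"
    by (rule sum.cong) (simp_all add: Zg bounded_clinear_scaleC [OF A] cinner_simps)
  also have "\<dots> = (\<Sum>i<n. \<Sum>j<n. of_real ((1 - t) * s j) * (cinner (f j) (g i) * cinner (g i) (A (f j))))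
     + (\<Sum>i<n. \<Sum>j<n. of_real (t * s j) * (cinner (f' j) (g i) * cinner (g i) (A (f' j))))"
    unfolding Z_def bounded_clinear_add [OF A] bounded_clinear_sum [OF A] bounded_clinear_scaleC [OF A]
    by (simp add: cinner_simps sum.distrib mult.assoc)
  also have "\<dots> = (\<Sum>j<n. of_real ((1 - t) * s j) * cinner (f j) (A (f j)))
     + (\<Sum>j<n. of_real (t * s j) * cinner (f' j) (A (f' j)))"
    using trace [OF f refl] trace [OF f' ff']
    by (subst (1 2) sum.swap) (simp flip: sum_distrib_left)
  finally show ?thesis
    using h gf hs by (intro exI [of _ h]) (simp add: sum_distrib_left mult.assoc)
qed

section \<open>Adjoints and unitary operators\<close>

text \<open>The representing vector is the minimiser of \<open>\<parallel>x\<parallel>\<^sup>2 - 2 Re (f x)\<close>; minimising sequences are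
  Cauchy by the parallelogram law.\<close>

lemma riesz_representation:
  fixes f :: "'h::complex_hilbert \<Rightarrow> complex"
  assumes add: "\<And>x y. f (x + y) = f x + f y" and scale: "\<And>c x. f (c *\<^sub>C x) = c * f x"
    and bound: "\<And>x. cmod (f x) \<le> b * norm x"
  shows "\<exists>y. \<forall>x. f x = cinner y x"
proof -
  define J where "J = (\<lambda>x. (norm x)\<^sup>2 - 2 * Re (f x))"
  define m where "m = Inf (range J)"
  have lower: "- b\<^sup>2 \<le> J x" for x
  proof -
    have "Re (f x) \<le> b * norm x"
      using bound [of x] complex_Re_le_cmod [of "f x"] by linarith
    moreover have "0 \<le> (norm x - b)\<^sup>2"
      by simp
    ultimately show ?thesis
      unfolding J_def by (simp add: power2_diff mult.commute [of b])
  qed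
  have bdd: "bdd_below (range J)"
    using lower by (auto simp: bdd_below_def)
  have mJ: "m \<le> J x" for x
    unfolding m_def by (rule cInf_lower [OF _ bdd]) simp
  have "\<exists>x. J x < m + 1 / real (Suc n)" for n
  proof -
    have "m < m + 1 / real (Suc n)"
      by simp
    thus ?thesis
      using cInf_less_iff [OF _ bdd, of "m + 1 / real (Suc n)"] by (simp add: m_def)
  qed
  then obtain X where X: "\<And>n. J (X n) < m + 1 / real (Suc n)"
    by metis
  have par: "(norm (x - y))\<^sup>2 = 2 * J x + 2 * J y - 4 * J ((1/2) *\<^sub>C (x + y))" for x y
  proof -
    have n: "(norm ((1/2) *\<^sub>C (x + y)))\<^sup>2 = (norm (x + y))\<^sup>2 / 4"
      by (simp add: norm_scaleC power_divide)
    have f: "f ((1/2) *\<^sub>C (x + y)) = (f x + f y) / 2"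
      by (simp add: add scale)
    show ?thesis
      unfolding J_def n f norm_diff_sq by (simp add: norm_add_sq field_simps)
  qed
  have dist: "(norm (X i - X j))\<^sup>2 \<le> 4 / real (Suc k)" if "k \<le> i" "k \<le> j" for i j k
  proof -
    have "(norm (X i - X j))\<^sup>2 \<le> 2 * J (X i) + 2 * J (X j) - 4 * m"
      unfolding par using mJ by simp
    also have "\<dots> \<le> 2 / real (Suc i) + 2 / real (Suc j)"
      using X [of i] X [of j] by simp
    also have "\<dots> \<le> 2 / real (Suc k) + 2 / real (Suc k)"
      using that by (intro add_mono divide_left_mono) auto
    finally show ?thesis
      by simp
  qed
  have "Cauchy X"
  proof (rule CauchyI)
    fix e :: real
    assume "e > 0"
    hence "e\<^sup>2 / 4 > 0"
      by simp
    then obtain k where "inverse (real (Suc k)) < e\<^sup>2 / 4"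
      using reals_Archimedean by blast
    hence k: "4 / real (Suc k) < e\<^sup>2"
      by (simp add: field_simps)
    have "norm (X i - X j) < e" if "k \<le> i" "k \<le> j" for i j
      using dist [OF that] k \<open>e > 0\<close> power_less_imp_less_base [of _ 2 e] by fastforce
    thus "\<exists>M. \<forall>i\<ge>M. \<forall>j\<ge>M. norm (X i - X j) < e"
      by blast
  qed
  then obtain y where y: "X \<longlonglongrightarrow> y"
    using Cauchy_convergent_iff convergent_def by blast
  have f: "bounded_linear f"
    by (rule bounded_linear_intro [of _ b])
      (use bound in \<open>simp_all add: add scale scaleR_scaleC mult.commute scaleR_conv_of_real\<close>)
  have "(\<lambda>n. J (X n)) \<longlonglongrightarrow> J y"
    unfolding J_def by (intro tendsto_intros y bounded_linear.tendsto [OF f])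
  moreover have "(\<lambda>n. m + 1 / real (Suc n)) \<longlonglongrightarrow> m + 0"
    by (intro tendsto_intros lim_1_over_n [THEN LIMSEQ_Suc])
  ultimately have "J y \<le> m + 0"
    by (rule LIMSEQ_le) (use X less_imp_le in blast)
  hence min: "J y \<le> J x" for x
    using mJ [of x] by simp
  have Re: "Re (f z) = Re (cinner y z)" for z
  proof -
    have "0 \<le> 2 * e * (Re (cinner y z) - Re (f z)) + e\<^sup>2 * (norm z)\<^sup>2" for e :: real
      using min [of "y + of_real e *\<^sub>C z"]
      by (simp add: J_def norm_add_sq cinner_simps norm_scaleC power_mult_distrib add scale algebra_simps)
    from quadratic_nonneg_imp_zero [OF this] show ?thesis
      by simp
  qed
  have "f z = cinner y z" for z
    using Re [of z] Re [of "\<i> *\<^sub>C z"] by (simp add: scale cinner_simps complex_eq_iff)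
  thus ?thesis
    by blast
qed

lemma cinner_cadjoint:
  fixes A :: "'h::complex_hilbert \<Rightarrow> 'h"
  assumes "bounded_clinear A"
  shows "cinner (A x) y = cinner x (cadjoint A y)"
proof -
  obtain b where b: "b > 0" "\<And>x. norm (A x) \<le> b * norm x"
    using bounded_clinear_bound [OF assms] by blast
  have "\<exists>z. \<forall>x. cinner y (A x) = cinner z x" for y
  proof (rule riesz_representation [of _ "norm y * b"])
    show "cmod (cinner y (A x)) \<le> norm y * b * norm x" for x
      using order_trans [OF cauchy_schwarz [of y "A x"] mult_left_mono [OF b(2) [of x]]]
      by (simp add: mult.assoc)
  qed (simp_all add: bounded_clinear_add [OF assms] bounded_clinear_scaleC [OF assms] cinner_simps)
  then obtain B where "\<And>y x. cinner y (A x) = cinner (B y) x"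
    by metis
  hence "\<forall>x y. cinner (A x) y = cinner x (B y)"
    by (metis cinner_commute)
  hence "\<forall>x y. cinner (A x) y = cinner x (cadjoint A y)"
    unfolding cadjoint_def by (rule someI [of "\<lambda>B. \<forall>x y. cinner (A x) y = cinner x (B y)"])
  thus ?thesis
    by blast
qed

lemma cinner_cadjoint':
  fixes A :: "'h::complex_hilbert \<Rightarrow> 'h"
  shows "bounded_clinear A \<Longrightarrow> cinner (cadjoint A x) y = cinner x (A y)"
  by (metis cinner_cadjoint cinner_commute)

lemma cadjointI:
  fixes A B :: "'h::complex_hilbert \<Rightarrow> 'h"
  assumes "bounded_clinear A" "\<And>x y. cinner (A x) y = cinner x (B y)"
  shows "cadjoint A = B"
  by (intro ext cinner_eqI) (metis assms cinner_cadjoint)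

lemma bounded_clinear_cadjoint:
  fixes A :: "'h::complex_hilbert \<Rightarrow> 'h"
  assumes A: "bounded_clinear A"
  shows "bounded_clinear (cadjoint A)"
proof -
  obtain b where b: "b > 0" "\<And>x. norm (A x) \<le> b * norm x"
    using bounded_clinear_bound [OF A] by blast
  show ?thesis
  proof (rule bounded_clinearI)
    fix x
    have "(norm (cadjoint A x))\<^sup>2 = Re (cinner (A (cadjoint A x)) x)"
      by (simp add: cinner_cadjoint [OF A] Re_cinner_self)
    also have "\<dots> \<le> norm (A (cadjoint A x)) * norm x"
      using complex_Re_le_cmod cauchy_schwarz order_trans by blast
    also have "\<dots> \<le> b * norm (cadjoint A x) * norm x"
      by (intro mult_right_mono b) simp
    finally show "norm (cadjoint A x) \<le> b * norm x"
      using b by (cases "cadjoint A x = 0") (simp_all add: power2_eq_square mult_ac)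
  qed (intro cinner_eqI, simp add: cinner_simps flip: cinner_cadjoint [OF A])+
qed

lemma cadjoint_cadjoint:
  fixes A :: "'h::complex_hilbert \<Rightarrow> 'h"
  shows "bounded_clinear A \<Longrightarrow> cadjoint (cadjoint A) = A"
  by (intro cadjointI bounded_clinear_cadjoint cinner_cadjoint')

lemma selfadjoint_imp_symmetric:
  fixes A :: "'h::complex_hilbert \<Rightarrow> 'h"
  shows "selfadjoint_op A \<Longrightarrow> symmetric_op A"
  unfolding selfadjoint_op_def symmetric_op_def using cinner_cadjoint by metis

lemma unitary_opI:
  fixes U V :: "'h::complex_hilbert \<Rightarrow> 'h"
  assumes "bounded_clinear U" "\<And>x y. cinner (U x) y = cinner x (V y)"
    "\<And>x. U (V x) = x" "\<And>x. V (U x) = x"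
  shows "unitary_op U" and "cadjoint U = V"
proof -
  show "cadjoint U = V"
    using assms cadjointI by blast
  thus "unitary_op U"
    using assms by (auto simp: unitary_op_def)
qed

lemma unitary_bounded: "unitary_op U \<Longrightarrow> bounded_clinear U"
  by (simp add: unitary_op_def)

lemma unitary_cadjoint_left: "unitary_op U \<Longrightarrow> cadjoint U (U x) = x"
  unfolding unitary_op_def by (metis comp_apply id_apply)

lemma unitary_cadjoint_right: "unitary_op U \<Longrightarrow> U (cadjoint U x) = x"
  unfolding unitary_op_def by (metis comp_apply id_apply)

lemma unitary_cadjoint: "unitary_op U \<Longrightarrow> unitary_op (cadjoint U)"
  by (rule unitary_opI(1) [of _ U])
    (simp_all add: bounded_clinear_cadjoint unitary_bounded cinner_cadjoint' unitary_cadjoint_left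
      unitary_cadjoint_right)

lemma unitary_cinner: "unitary_op U \<Longrightarrow> cinner (U x) (U y) = cinner x y"
  by (simp add: cinner_cadjoint unitary_bounded unitary_cadjoint_left)

lemma unitary_norm: "unitary_op U \<Longrightarrow> norm (U x) = norm x"
  by (metis Re_cinner_self norm_ge_zero power2_eq_iff_nonneg unitary_cinner)

lemma unitary_compose:
  assumes "unitary_op U" "unitary_op V"
  shows "unitary_op (\<lambda>x. U (V x))" and "cadjoint (\<lambda>x. U (V x)) = (\<lambda>x. cadjoint V (cadjoint U x))"
  by (rule unitary_opI [of "\<lambda>x. U (V x)" "\<lambda>x. cadjoint V (cadjoint U x)"],
      simp_all add: assms bounded_clinear_compose unitary_bounded cinner_cadjoint
        unitary_cadjoint_left unitary_cadjoint_right)+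

lemma ortho_unitary: "unitary_op U \<Longrightarrow> ortho f I \<Longrightarrow> ortho (\<lambda>i. U (f i)) I"
  by (simp add: ortho_def unitary_cinner)

text \<open>Two orthonormal bases of the same finite-dimensional subspace are exchanged by a unitary
  operator that is the identity on the orthogonal complement.\<close>

lemma unitary_between_bases:
  fixes f h :: "nat \<Rightarrow> 'h::complex_hilbert"
  assumes f: "ortho f {..<n}" and h: "ortho h {..<n}" and fh: "oproj h {..<n} = oproj f {..<n}"
  obtains U where "unitary_op U" "\<forall>i<n. U (f i) = h i" "\<forall>i<n. cadjoint U (h i) = f i"
    "\<forall>x. oproj f {..<n} (U x) = U (oproj f {..<n} x)"
proof -
  define T where "T = (\<lambda>f h x. (x - oproj f {..<n} x) + (\<Sum>i<n. cinner (f i) x *\<^sub>C (h i :: 'h)))"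
  have T: "T f h x = (x - oproj f {..<n} x) + (\<Sum>i<n. cinner (f i) x *\<^sub>C h i)" for f h x
    by (simp add: T_def)
  have bT: "bounded_clinear (T f h)" for f h
    unfolding T_def by (intro bounded_clinear_plus bounded_clinear_minus bounded_clinear_ident
        bounded_clinear_oproj bounded_clinear_sum_ops bounded_clinear_rank_one)
  have adj: "cinner (T f h x) y = cinner x (T h f y)"
    if "oproj h {..<n} = oproj f {..<n}" for f h x y
    unfolding T_def
    by (simp add: cinner_simps oproj_selfadjoint that cinner_commute [of x "f _"] mult.commute)
  have coeff: "cinner (h i) (T f h x) = cinner (f i) x"
    if "ortho h {..<n}" "oproj h {..<n} = oproj f {..<n}" "i < n" for f h x i
  proof -
    have "cinner (h i) (oproj f {..<n} x) = cinner (h i) x"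
      using cinner_oproj [OF _ that(1), of i x] that by simp
    thus ?thesis
      unfolding T_def using that orthoD [OF that(1), of i]
      by (simp add: cinner_simps if_distrib [of "\<lambda>z. _ * z"] cong: if_cong)
  qed
  have proj: "oproj h {..<n} (T f h x) = (\<Sum>i<n. cinner (f i) x *\<^sub>C h i)"
    if "ortho h {..<n}" "oproj h {..<n} = oproj f {..<n}" for f h x
    unfolding oproj_def by (rule sum.cong) (simp_all add: coeff [OF that])
  have inv: "T h f (T f h x) = x"
    if "ortho h {..<n}" "oproj h {..<n} = oproj f {..<n}" for f h x
  proof -
    have "T h f (T f h x) = T f h x - (\<Sum>i<n. cinner (f i) x *\<^sub>C h i) + (\<Sum>i<n. cinner (f i) x *\<^sub>C f i)"
      unfolding T [of h f] proj [OF that] by (simp add: coeff [OF that])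
    also have "\<dots> = x"
      by (simp add: T_def oproj_def)
    finally show ?thesis .
  qed
  have img: "T f h (f i) = h i" if "ortho f {..<n}" "i < n" for f h i
    using orthoD [OF that(1)] that oproj_family [OF _ that(1)]
    by (simp add: T_def if_distrib [of "\<lambda>z. z *\<^sub>C _"] scaleC_one cong: if_cong)
  note U = unitary_opI [OF bT adj [OF fh] inv [OF f fh [symmetric]] inv [OF h fh]]
  have "oproj f {..<n} (T f h x) = T f h (oproj f {..<n} x)" for x
  proof -
    have "T f h (oproj f {..<n} x) = (\<Sum>i<n. cinner (f i) x *\<^sub>C h i)"
      unfolding T_def by (simp add: oproj_idem f cinner_oproj)
    thus ?thesis
      using proj [OF h fh, of x] by (simp add: fh)
  qed
  thus thesis
    using that [OF U(1)] img [OF f] img [OF h] by (simp add: U(2))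
qed

section \<open>Orthonormal bases and nuclear representations\<close>

lemma onb_ortho:
  assumes "is_onb E" "F \<subseteq> E"
  shows "ortho (\<lambda>e. e) F"
  unfolding ortho_def
proof (intro ballI)
  fix a b
  assume "a \<in> F" "b \<in> F"
  hence "a \<in> E" "b \<in> E"
    using assms by auto
  thus "cinner a b = (if a = b then 1 else 0)"
    using assms(1) unfolding is_onb_def pairwise_def by (cases "a = b") (simp_all add: cinner_self)
qed

lemma onb_oproj_tendsto:
  assumes "is_onb E"
  shows "((\<lambda>F. oproj (\<lambda>e. e) F x) \<longlongrightarrow> x) (finite_subsets_at_top E)"
proof (rule tendstoI)
  fix \<epsilon> :: real
  assume "\<epsilon> > 0"
  note ortho = onb_ortho [OF assms]
  have "x \<in> closure (cspan E)"
    using assms by (simp add: is_onb_def)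
  then obtain y where y: "y \<in> cspan E" "dist y x < \<epsilon>"
    using \<open>\<epsilon> > 0\<close> by (meson closure_approachable)
  then obtain F c where F: "finite F" "F \<subseteq> E" "y = (\<Sum>a\<in>F. c a *\<^sub>C a)"
    unfolding complex_vector.span_explicit by blast
  have "dist (oproj (\<lambda>e. e) G x) x < \<epsilon>" if "finite G" "F \<subseteq> G" "G \<subseteq> E" for G
  proof -
    have "oproj (\<lambda>e. e) G y = y"
      unfolding F(3) oproj_sum oproj_scaleC
      by (rule sum.cong [OF refl]) (use oproj_family [OF that(1) ortho [OF that(3)]] that in auto)
    from oproj_closest [OF that(1) ortho [OF that(3)] this, of x] show ?thesis
      using y(2) by (simp add: dist_norm norm_minus_commute)
  qed
  thus "\<forall>\<^sub>F G in finite_subsets_at_top E. dist (oproj (\<lambda>e. e) G x) x < \<epsilon>"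
    unfolding eventually_finite_subsets_at_top using F by blast
qed

lemma parseval:
  assumes "is_onb E"
  shows "((\<lambda>e. (cmod (cinner e x))\<^sup>2) has_sum (norm x)\<^sup>2) E"
proof -
  have "((\<lambda>F. (norm (oproj (\<lambda>e. e) F x))\<^sup>2) \<longlongrightarrow> (norm x)\<^sup>2) (finite_subsets_at_top E)"
    by (intro tendsto_intros onb_oproj_tendsto assms)
  moreover have "\<forall>\<^sub>F F in finite_subsets_at_top E.
      (norm (oproj (\<lambda>e. e) F x))\<^sup>2 = (\<Sum>e\<in>F. (cmod (cinner e x))\<^sup>2)"
    by (rule eventually_finite_subsets_at_top_weakI)
      (simp add: norm_oproj_sq onb_ortho [OF assms])
  ultimately show ?thesis
    unfolding has_sum_def by (rule Lim_transform_eventually)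
qed

text \<open>The series \<open>D = \<Sum>n. \<bar>a\<^sub>n\<rangle>\<langle>v\<^sub>n\<bar>\<close> of rank one operators, absolutely convergent in trace norm.\<close>

definition nuclear_rep :: "('h::complex_inner \<Rightarrow> 'h) \<Rightarrow> (nat \<Rightarrow> 'h) \<Rightarrow> (nat \<Rightarrow> 'h) \<Rightarrow> bool" where
  "nuclear_rep D a v \<longleftrightarrow> summable (\<lambda>n. norm (a n) * norm (v n)) \<and>
     (\<forall>x. (\<lambda>n. cinner (v n) x *\<^sub>C a n) sums D x)"

text \<open>For a finite set \<open>F\<close> of basis vectors the partial trace is
  \<open>\<Sum>n. \<langle>v\<^sub>n, B (\<Pi>\<^sub>F a\<^sub>n)\<rangle>\<close>, with the projection \<open>\<Pi>\<^sub>F\<close> on the span of \<open>F\<close>; dominated convergence for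
  series gives the limit. The value is therefore the same for all orthonormal bases.\<close>

lemma nuclear_has_trace:
  fixes D B :: "'h::complex_hilbert \<Rightarrow> 'h"
  assumes D: "nuclear_rep D a v" and B: "bounded_clinear B" and E: "is_onb E"
  shows "((\<lambda>e. cinner e (D (B e))) has_sum (\<Sum>n. cinner (v n) (B (a n)))) E"
proof -
  obtain b where b: "b > 0" "\<And>x. norm (B x) \<le> b * norm x"
    using bounded_clinear_bound [OF B] by blast
  let ?g = "\<lambda>n F. cinner (v n) (B (oproj (\<lambda>e. e) F (a n)))"
  have partial: "(\<Sum>e\<in>F. cinner e (D (B e))) = (\<Sum>n. ?g n F)" for F
  proof -
    have "(\<lambda>n. cinner e (cinner (v n) (B e) *\<^sub>C a n)) sums cinner e (D (B e))" for e
      using D unfolding nuclear_rep_def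
      by (intro bounded_linear.sums [OF bounded_linear_cinner_right]) blast
    hence "(\<lambda>n. \<Sum>e\<in>F. cinner e (cinner (v n) (B e) *\<^sub>C a n)) sums (\<Sum>e\<in>F. cinner e (D (B e)))"
      by (rule sums_sum)
    moreover have "(\<Sum>e\<in>F. cinner e (cinner (v n) (B e) *\<^sub>C a n)) = ?g n F" for n
      unfolding oproj_def
      by (simp add: bounded_clinear_sum [OF B] bounded_clinear_scaleC [OF B] cinner_simps mult.commute)
    ultimately show ?thesis
      by (simp add: sums_iff)
  qed
  have "((\<lambda>F. \<Sum>n. ?g n F) \<longlongrightarrow> (\<Sum>n. cinner (v n) (B (a n)))) (finite_subsets_at_top E)"
  proof (rule tannerys_theorem [THEN conjunct2, THEN conjunct2])
    show "((\<lambda>F. ?g n F) \<longlongrightarrow> cinner (v n) (B (a n))) (finite_subsets_at_top E)" for n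
      by (intro tendsto_cinner_right bounded_clinear_tendsto [OF B] onb_oproj_tendsto E)
    show "summable (\<lambda>n. b * (norm (a n) * norm (v n)))"
      using D by (intro summable_mult) (simp add: nuclear_rep_def)
    have "norm (?g n F) \<le> b * (norm (a n) * norm (v n))" if "finite F" "F \<subseteq> E" for n F
    proof -
      have "norm (?g n F) \<le> norm (v n) * norm (B (oproj (\<lambda>e. e) F (a n)))"
        by (rule cauchy_schwarz)
      also have "\<dots> \<le> norm (v n) * (b * norm (oproj (\<lambda>e. e) F (a n)))"
        by (intro mult_left_mono b) simp
      also have "\<dots> \<le> norm (v n) * (b * norm (a n))"
        using b(1) norm_oproj_le [OF that(1) onb_ortho [OF E that(2)]]
        by (intro mult_left_mono) auto
      finally show ?thesis
        by (simp add: mult_ac)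
    qed
    thus "\<forall>\<^sub>F (n, F) in at_top \<times>\<^sub>F finite_subsets_at_top E. norm (?g n F) \<le> b * (norm (a n) * norm (v n))"
      by (intro eventually_prod_filter [THEN iffD2] exI [of _ "\<lambda>_. True"]
          exI [of _ "\<lambda>F. finite F \<and> F \<subseteq> E"]) (auto simp: eventually_finite_subsets_at_top)
    show "finite_subsets_at_top E \<noteq> bot"
      by simp
  qed
  thus ?thesis
    unfolding has_sum_def partial [abs_def] .
qed

lemma ctrace_nuclear:
  fixes D B :: "'h::complex_hilbert \<Rightarrow> 'h"
  assumes "nuclear_rep D a v" and "bounded_clinear B" and "\<exists>E::'h set. is_onb E"
  shows "ctrace (\<lambda>x. D (B x)) = (\<Sum>n. cinner (v n) (B (a n)))"
  unfolding ctrace_def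
  by (rule infsumI [OF nuclear_has_trace [OF assms(1,2) someI_ex [OF assms(3)]]])

section \<open>Trace class operators are nuclear\<close>

lemma has_sum_sum:
  fixes f :: "'i \<Rightarrow> 'a \<Rightarrow> 'b::topological_comm_monoid_add"
  assumes "\<And>i. i \<in> I \<Longrightarrow> (f i has_sum s i) A"
  shows "((\<lambda>x. \<Sum>i\<in>I. f i x) has_sum (\<Sum>i\<in>I. s i)) A"
  using assms by (induction I rule: infinite_finite_induct) (auto intro: has_sum_add)


lemma positive_imp_symmetric:
  fixes P :: "'h::complex_hilbert \<Rightarrow> 'h"
  assumes "positive_op P"
  shows "symmetric_op P"
  unfolding symmetric_op_def
proof (intro allI)
  fix x y
  have P: "bounded_clinear P" and im: "Im (cinner z (P z)) = 0" for z
    using assms by (auto simp: positive_op_def complex_nonneg_Reals_iff)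
  have "Im (cinner x (P y)) + Im (cinner y (P x)) = 0"
    using im [of "x + y"] im [of x] im [of y] by (simp add: bounded_clinear_add [OF P] cinner_simps)
  moreover have "Re (cinner x (P y)) - Re (cinner y (P x)) = 0"
    using im [of "x + \<i> *\<^sub>C y"] im [of x] im [of y]
    by (simp add: bounded_clinear_add [OF P] bounded_clinear_scaleC [OF P] cinner_simps)
  ultimately have "cinner x (P y) = cnj (cinner y (P x))"
    by (simp add: complex_eq_iff)
  thus "cinner (P x) y = cinner x (P y)"
    by (metis cinner_commute)
qed

text \<open>The form is nonnegative at \<open>x - P x / b\<close>; the step \<open>1 / b\<close> matches the estimate of the
  quadratic term \<open>\<langle>P x, P (P x)\<rangle>\<close> by \<open>b \<parallel>P x\<parallel>\<^sup>2\<close>.\<close>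

lemma positive_norm_sq_le:
  fixes P :: "'h::complex_hilbert \<Rightarrow> 'h"
  assumes "positive_op P" and b: "b > 0" "\<And>x. norm (P x) \<le> b * norm x"
  shows "(norm (P x))\<^sup>2 \<le> b * Re (cinner x (P x))"
proof -
  have P: "bounded_clinear P" and pos: "0 \<le> Re (cinner z (P z))" for z
    using assms(1) by (auto simp: positive_op_def complex_nonneg_Reals_iff)
  have sym: "cinner (P x) y = cinner x (P y)" for x y
    using positive_imp_symmetric [OF assms(1)] by (simp add: symmetric_op_def)
  define N where "N = (norm (P x))\<^sup>2"
  define y where "y = x - of_real (1 / b) *\<^sub>C P x"
  have "Re (cinner (P x) (P (P x))) \<le> norm (P x) * norm (P (P x))"
    using complex_Re_le_cmod cauchy_schwarz order_trans by blast
  also have "\<dots> \<le> norm (P x) * (b * norm (P x))"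
    by (intro mult_left_mono b) simp
  finally have Q: "Re (cinner (P x) (P (P x))) \<le> b * N"
    by (simp add: N_def power2_eq_square mult_ac)
  have "0 \<le> Re (cinner y (P y))"
    by (rule pos)
  also have "cinner y (P y) = cinner x (P x) - of_real (1 / b) * cinner (P x) (P x)
     - of_real (1 / b) * cinner (P x) (P x) + of_real ((1 / b)\<^sup>2) * cinner (P x) (P (P x))"
    unfolding y_def bounded_clinear_diff [OF P] bounded_clinear_scaleC [OF P]
    by (simp add: cinner_simps power2_eq_square algebra_simps flip: sym [of x "P x"])
  also have "Re \<dots> = Re (cinner x (P x)) - 2 * N / b + (1 / b)\<^sup>2 * Re (cinner (P x) (P (P x)))"
    by (simp add: cinner_self N_def field_simps)
  also have "\<dots> \<le> Re (cinner x (P x)) - 2 * N / b + (1 / b)\<^sup>2 * (b * N)"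
    by (intro add_left_mono mult_left_mono Q) simp
  also have "\<dots> = Re (cinner x (P x)) - N / b"
    using b(1) by (simp add: field_simps power2_eq_square)
  finally show ?thesis
    using b(1) by (simp add: N_def field_simps)
qed

text \<open>Gram--Schmidt for the positive semidefinite form \<open>\<langle>x, P y\<rangle>\<close>. A vector whose residual has length
  zero in this form is replaced by \<open>0\<close>, because division by zero yields zero.\<close>

fun form_gram_schmidt :: "('h::complex_inner \<Rightarrow> 'h) \<Rightarrow> (nat \<Rightarrow> 'h) \<Rightarrow> nat \<Rightarrow> 'h" where
  "form_gram_schmidt P e n =
    (let r = e n - (\<Sum>k<n. cinner (form_gram_schmidt P e k) (P (e n)) *\<^sub>C form_gram_schmidt P e k)
     in (1 / complex_of_real (sqrt (Re (cinner r (P r))))) *\<^sub>C r)"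

declare form_gram_schmidt.simps [simp del]

context
  fixes P :: "'h::complex_hilbert \<Rightarrow> 'h" and e u :: "nat \<Rightarrow> 'h"
  assumes P: "positive_op P"
  defines "u \<equiv> form_gram_schmidt P e"
begin

lemma positive_bounded: "bounded_clinear P"
  using P by (simp add: positive_op_def)

lemma positive_sym: "cinner (P x) y = cinner x (P y)"
  using positive_imp_symmetric [OF P] by (simp add: symmetric_op_def)

lemma positive_form_real: "cinner x (P x) = of_real (Re (cinner x (P x)))"
  using P by (auto simp: positive_op_def complex_nonneg_Reals_iff complex_eq_iff)

lemma positive_form_nonneg: "0 \<le> Re (cinner x (P x))"
  using P by (auto simp: positive_op_def complex_nonneg_Reals_iff)

lemma positive_form_null: "cinner x (P x) = 0 \<Longrightarrow> P x = 0"
proof -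
  obtain b where b: "b > 0" "\<And>x. norm (P x) \<le> b * norm x"
    using bounded_clinear_bound [OF positive_bounded] by blast
  show "cinner x (P x) = 0 \<Longrightarrow> P x = 0"
    using positive_norm_sq_le [OF P b, of x] by simp
qed

text \<open>The value \<open>0\<close> on the diagonal occurs for degenerate steps. The last conclusion says that \<open>e\<^sub>n\<close> lies,
  up to a null vector of \<open>P\<close>, in the span of \<open>u\<^sub>0, \<dots>, u\<^sub>n\<close>.\<close>

lemma form_gram_schmidt_props:
  "(\<forall>k<n. cinner (u k) (P (u n)) = 0) \<and> cinner (u n) (P (u n)) \<in> {0, 1} \<and>
   P (e n - (\<Sum>k<Suc n. cinner (u k) (P (e n)) *\<^sub>C u k)) = 0"
proof (induction n rule: less_induct)
  case (less n)
  define r where "r = e n - (\<Sum>k<n. cinner (u k) (P (e n)) *\<^sub>C u k)"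
  define d where "d = sqrt (Re (cinner r (P r)))"
  have un: "u n = (1 / complex_of_real d) *\<^sub>C r"
    unfolding u_def r_def d_def by (subst form_gram_schmidt.simps) (simp add: Let_def)
  have dd: "cinner r (P r) = complex_of_real d * of_real d"
    by (subst positive_form_real) (simp add: d_def positive_form_nonneg flip: of_real_mult)
  have off: "cinner (u j) (P (u k)) = 0" if "j < n" "k < n" "j \<noteq> k" for j k
  proof (cases "j < k")
    case True
    thus ?thesis
      using less.IH [of k] that by blast
  next
    case False
    hence "cinner (u k) (P (u j)) = 0"
      using less.IH [of j] that by simp
    thus ?thesis
      using positive_sym cinner_zero_sym by metis
  qed
  have ur: "cinner (u j) (P r) = 0" if j: "j < n" for j
  proof -
    have "cinner (u j) (P r) = cinner (u j) (P (e n))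
        - (\<Sum>k<n. cinner (u k) (P (e n)) * cinner (u j) (P (u k)))"
      by (simp add: r_def bounded_clinear_diff [OF positive_bounded] bounded_clinear_sum [OF positive_bounded]
          bounded_clinear_scaleC [OF positive_bounded] cinner_simps)
    also have "(\<Sum>k<n. cinner (u k) (P (e n)) * cinner (u j) (P (u k)))
        = (\<Sum>k<n. if k = j then cinner (u j) (P (e n)) * cinner (u j) (P (u j)) else 0)"
      by (rule sum.cong) (use off j in auto)
    also have "\<dots> = cinner (u j) (P (e n)) * cinner (u j) (P (u j))"
      using j by simp
    finally have *: "cinner (u j) (P r) = cinner (u j) (P (e n)) * (1 - cinner (u j) (P (u j)))"
      by (simp add: algebra_simps)
    have "cinner (u j) (P (u j)) = 0 \<or> cinner (u j) (P (u j)) = 1"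
      using less.IH [OF j] by blast
    thus ?thesis
    proof
      assume "cinner (u j) (P (u j)) = 0"
      hence "P (u j) = 0"
        by (rule positive_form_null)
      hence "cinner (u j) (P (e n)) = 0"
        by (simp flip: positive_sym)
      thus ?thesis
        using * by simp
    qed (use * in simp)
  qed
  have Pr: "P r = 0" if "d = 0"
    using dd that by (intro positive_form_null) simp
  have 1: "\<forall>k<n. cinner (u k) (P (u n)) = 0"
    using ur by (simp add: un bounded_clinear_scaleC [OF positive_bounded] cinner_simps)
  have 2: "cinner (u n) (P (u n)) \<in> {0, 1}"
    by (simp add: un bounded_clinear_scaleC [OF positive_bounded] cinner_simps dd)
  have "cinner (u n) (P (e n)) = cinner (u n) (P r)
      + (\<Sum>k<n. cinner (u k) (P (e n)) * cinner (u n) (P (u k)))"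
    by (simp add: r_def bounded_clinear_diff [OF positive_bounded] bounded_clinear_sum [OF positive_bounded]
        bounded_clinear_scaleC [OF positive_bounded] cinner_simps)
  also have "(\<Sum>k<n. cinner (u k) (P (e n)) * cinner (u n) (P (u k))) = 0"
    using 1 by (intro sum.neutral) (metis positive_sym cinner_zero_sym lessThan_iff mult_zero_right)
  finally have "cinner (u n) (P (e n)) = cinner (u n) (P r)"
    by simp
  also have "\<dots> = of_real d"
    by (simp add: un cinner_simps dd)
  finally have c: "cinner (u n) (P (e n)) = of_real d" .
  have "e n - (\<Sum>k<Suc n. cinner (u k) (P (e n)) *\<^sub>C u k) = r - of_real d *\<^sub>C u n"
    by (simp add: r_def c)
  also have "P \<dots> = 0"
  proof (cases "d = 0")
    case False
    thus ?thesis
      by (simp add: un scaleC_scaleC scaleC_one bounded_clinear_zero [OF positive_bounded])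
  qed (simp add: Pr)
  finally show ?case
    using 1 2 by blast
qed

lemma form_orthogonal:
  assumes "j \<noteq> k"
  shows "cinner (u j) (P (u k)) = 0"
proof (cases "j < k")
  case True
  thus ?thesis
    using form_gram_schmidt_props [of k] by blast
next
  case False
  hence "cinner (P (u k)) (u j) = 0"
    using form_gram_schmidt_props [of j] assms by (simp add: positive_sym)
  thus ?thesis
    by (rule cinner_zero_sym)
qed

definition "residual N x = x - (\<Sum>k<N. cinner (u k) (P x) *\<^sub>C u k)"

lemma residual_form:
  "Re (cinner (residual N x) (P (residual N x)))
    = Re (cinner x (P x)) - (\<Sum>k<N. (cmod (cinner (u k) (P x)))\<^sup>2)"
proof -
  define c where "c = (\<lambda>k. cinner (u k) (P x))"
  have c: "c k * cinner (u k) (P (u k)) = c k" for k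
  proof (cases "cinner (u k) (P (u k)) = 0")
    case True
    hence "P (u k) = 0"
      by (rule positive_form_null)
    hence "c k = 0"
      unfolding c_def positive_sym [symmetric] by simp
    thus ?thesis
      by simp
  next
    case False
    thus ?thesis
      using form_gram_schmidt_props [of k] by auto
  qed
  have cc: "cinner x (P (u k)) = cnj (c k)" for k
    unfolding c_def by (metis positive_sym cinner_commute)
  have cu: "cinner (u k) (P x) = c k" for k
    by (simp add: c_def)
  have "cinner (residual N x) (P (residual N x)) = cinner x (P x) - (\<Sum>k<N. cnj (c k) * c k)
      - (\<Sum>k<N. c k * cnj (c k)) + (\<Sum>k<N. c k * (\<Sum>j<N. cnj (c j) * cinner (u j) (P (u k))))"
    unfolding residual_def
    by (simp add: bounded_clinear_diff [OF positive_bounded] bounded_clinear_sum [OF positive_bounded]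
        bounded_clinear_scaleC [OF positive_bounded] cinner_simps cu cc right_diff_distrib sum_subtractf)
  also have "(\<Sum>k<N. c k * (\<Sum>j<N. cnj (c j) * cinner (u j) (P (u k)))) = (\<Sum>k<N. c k * cnj (c k))"
  proof (rule sum.cong [OF refl])
    fix k
    assume k: "k \<in> {..<N}"
    have "(\<Sum>j<N. cnj (c j) * cinner (u j) (P (u k)))
        = (\<Sum>j<N. if j = k then cnj (c k) * cinner (u k) (P (u k)) else 0)"
      by (rule sum.cong) (auto simp: form_orthogonal)
    also have "\<dots> = cnj (c k) * cinner (u k) (P (u k))"
      using k by simp
    finally show "c k * (\<Sum>j<N. cnj (c j) * cinner (u j) (P (u k))) = c k * cnj (c k)"
      using c [of k] by (metis mult.assoc mult.commute)
  qed
  finally have "cinner (residual N x) (P (residual N x)) = cinner x (P x) - (\<Sum>k<N. c k * cnj (c k))"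
    by (simp add: mult.commute)
  also have "(\<Sum>k<N. c k * cnj (c k)) = of_real (\<Sum>k<N. (cmod (c k))\<^sup>2)"
    unfolding of_real_sum complex_norm_square ..
  finally show ?thesis
    by (simp add: c_def)
qed

lemma form_bessel: "(\<Sum>k<N. (cmod (cinner (u k) (P x)))\<^sup>2) \<le> Re (cinner x (P x))"
  using residual_form [of N x] positive_form_nonneg [of "residual N x"] by simp

text \<open>The uniform bound allows passing from the dense span of a basis to all vectors.\<close>

lemma residual_bound:
  assumes b: "b > 0" "\<And>x. norm (P x) \<le> b * norm x"
  shows "norm (P (residual N x)) \<le> b * norm x"
proof (rule power2_le_imp_le)
  have "(norm (P (residual N x)))\<^sup>2 \<le> b * Re (cinner (residual N x) (P (residual N x)))"
    by (rule positive_norm_sq_le [OF P b])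
  also have "\<dots> \<le> b * Re (cinner x (P x))"
    unfolding residual_form using b(1) by (intro mult_left_mono) (auto simp: sum_nonneg)
  also have "\<dots> \<le> b * (norm x * norm (P x))"
    using b(1) order_trans [OF complex_Re_le_cmod cauchy_schwarz] by (intro mult_left_mono) simp_all
  also have "\<dots> \<le> b * (norm x * (b * norm x))"
    using b by (intro mult_left_mono) auto
  finally show "(norm (P (residual N x)))\<^sup>2 \<le> (b * norm x)\<^sup>2"
    by (simp add: power2_eq_square mult_ac)
qed (use b in simp)

lemma residual_add: "residual N (x + y) = residual N x + residual N y"
  by (simp add: residual_def bounded_clinear_add [OF positive_bounded] cinner_simps scaleC_add_left sum.distrib)

lemma residual_diff: "residual N (x - y) = residual N x - residual N y"
  by (simp add: residual_def bounded_clinear_diff [OF positive_bounded] cinner_simps scaleC_diff_left sum_subtractf)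

lemma residual_scaleC: "residual N (c *\<^sub>C x) = c *\<^sub>C residual N x"
  by (simp add: residual_def bounded_clinear_scaleC [OF positive_bounded] cinner_simps scaleC_diff_right
      scaleC_sum_right scaleC_scaleC)

lemma residual_null_e:
  assumes "n < N"
  shows "P (residual N (e n)) = 0"
proof -
  define r where "r = e n - (\<Sum>k<Suc n. cinner (u k) (P (e n)) *\<^sub>C u k)"
  have Pr: "P r = 0"
    using form_gram_schmidt_props [of n] by (simp add: r_def)
  have z: "cinner (u j) (P (e n)) = 0" if "n < j" for j
  proof -
    have "P (e n) = P r + (\<Sum>k<Suc n. cinner (u k) (P (e n)) *\<^sub>C P (u k))"
      by (simp add: r_def bounded_clinear_diff [OF positive_bounded] bounded_clinear_add [OF positive_bounded]
        bounded_clinear_sum [OF positive_bounded] bounded_clinear_scaleC [OF positive_bounded])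
    also have "cinner (u j) \<dots> = 0"
      unfolding Pr using that by (simp add: cinner_simps form_orthogonal del: sum.lessThan_Suc)
    finally show ?thesis .
  qed
  have "(\<Sum>k<N. cinner (u k) (P (e n)) *\<^sub>C u k) = (\<Sum>k<Suc n. cinner (u k) (P (e n)) *\<^sub>C u k)"
    by (rule sum.mono_neutral_right) (use assms z in auto)
  thus ?thesis
    using Pr by (simp add: residual_def r_def)
qed

end

text \<open>Let \<open>P = \<bar>C\<bar>\<close>, and let \<open>u\<^sub>n\<close> be orthonormal for the form \<open>\<langle>x, P y\<rangle>\<close>. Formally
  \<open>P = \<Sum>n. \<langle>P u\<^sub>n, \<cdot>\<rangle> P u\<^sub>n\<close>, and since \<open>\<parallel>C x\<parallel> = \<parallel>P x\<parallel>\<close> this turns into \<open>C = \<Sum>n. \<langle>P u\<^sub>n, \<cdot>\<rangle> C u\<^sub>n\<close>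
  with \<open>\<parallel>C u\<^sub>n\<parallel> = \<parallel>P u\<^sub>n\<parallel>\<close>. Bessel's inequality for the form gives
  \<open>\<Sum>n. \<parallel>P u\<^sub>n\<parallel>\<^sup>2 \<le> \<Sum>e\<in>E. \<langle>e, P e\<rangle>\<close>. Only countably many \<open>e \<in> E\<close> satisfy \<open>P e \<noteq> 0\<close>, so they can be enumerated.\<close>

lemma trace_class_nuclear:
  fixes C :: "'h::complex_hilbert \<Rightarrow> 'h"
  assumes "trace_class C"
  obtains a v where "nuclear_rep C a v"
proof -
  obtain P E where C: "bounded_clinear C" and PC: "is_modulus P C" and E: "is_onb E"
    and sm: "(\<lambda>e. cinner e (P e)) summable_on E"
    using assms unfolding trace_class_def by blast
  have P: "positive_op P" and PP: "P (P x) = cadjoint C (C x)" for x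
    using PC unfolding is_modulus_def by (auto simp: fun_eq_iff)
  note bP = positive_bounded [OF P]
  have norm_CP: "norm (C x) = norm (P x)" for x
  proof -
    have "cinner (C x) (C x) = cinner (P x) (P x)"
      unfolding cinner_cadjoint [OF C] positive_sym [OF P] PP ..
    thus ?thesis
      by (metis Re_cinner_self norm_ge_zero power2_eq_iff_nonneg)
  qed
  \<comment> \<open>The added zero vector makes \<open>S\<close> nonempty, so that it is the range of a sequence; neither zeros nor
    repetitions disturb Gram--Schmidt.\<close>
  define S where "S = insert 0 {e \<in> E. cinner e (P e) \<noteq> 0}"
  have "countable S"
    unfolding S_def using summable_countable_complex [OF sm] by simp
  define e where "e = from_nat_into S"
  have e: "range e = S"
    unfolding e_def using \<open>countable S\<close> by (intro range_from_nat_into) (auto simp: S_def)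
  define u where "u = form_gram_schmidt P e"
  define R where "R = residual P e"
  note R_defs = R_def residual_def [OF P]
  obtain b where b: "b > 0" "\<And>x. norm (P x) \<le> b * norm x"
    using bounded_clinear_bound [OF bP] by blast
  have Rb: "norm (P (R N x)) \<le> b * norm x" for N x
    unfolding R_def by (rule residual_bound [OF P b])
  \<comment> \<open>vectors on which the expansion terminates\<close>
  define G where "G = {x. \<exists>M. \<forall>N\<ge>M. P (R N x) = 0}"
  have "complex_vector.subspace G"
  proof (rule complex_vector.subspaceI)
    show "0 \<in> G"
      using residual_scaleC [OF P, of e _ 0 0] by (auto simp: G_def R_def bounded_clinear_zero [OF bP])
    fix x y
    assume "x \<in> G" "y \<in> G"
    then obtain M M' where "\<forall>N\<ge>M. P (R N x) = 0" "\<forall>N\<ge>M'. P (R N y) = 0"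
      by (auto simp: G_def)
    thus "x + y \<in> G"
      unfolding G_def by (intro CollectI exI [of _ "max M M'"])
        (simp add: R_def residual_add [OF P] bounded_clinear_add [OF bP])
  next
    fix c x
    assume "x \<in> G"
    thus "c *\<^sub>C x \<in> G"
      by (auto simp: G_def R_def residual_scaleC [OF P] bounded_clinear_scaleC [OF bP])
  qed
  moreover have "E \<subseteq> G"
  proof
    fix x
    assume x: "x \<in> E"
    show "x \<in> G"
    proof (cases "cinner x (P x) = 0")
      case True
      hence "P x = 0"
        by (rule positive_form_null [OF P])
      thus ?thesis
        by (simp add: G_def R_defs)
    next
      case False
      then obtain n where "x = e n"
        using x e by (auto simp: S_def)
      thus ?thesis
        unfolding G_def R_def using residual_null_e [OF P, of n _ e]
        by (intro CollectI exI [of _ "Suc n"]) auto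
    qed
  qed
  ultimately have EG: "cspan E \<subseteq> G"
    by (intro complex_vector.span_minimal)
  have lim: "(\<lambda>N. P (R N x)) \<longlonglongrightarrow> 0" for x
  proof (rule LIMSEQ_I)
    fix r :: real
    assume "r > 0"
    hence "r / b > 0"
      using b by simp
    moreover have "x \<in> closure (cspan E)"
      using E by (simp add: is_onb_def)
    ultimately obtain y where y: "y \<in> cspan E" "dist y x < r / b"
      by (meson closure_approachable)
    then obtain M where M: "\<And>N. N \<ge> M \<Longrightarrow> P (R N y) = 0"
      using EG by (auto simp: G_def)
    have "norm (P (R N x) - 0) < r" if "N \<ge> M" for N
    proof -
      have "P (R N x) = P (R N (x - y))"
        using M [OF that] by (simp add: R_def residual_diff [OF P] bounded_clinear_diff [OF bP])
      hence "norm (P (R N x)) \<le> b * norm (x - y)"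
        using Rb by simp
      also have "\<dots> < r"
        using y(2) b by (simp add: dist_norm norm_minus_commute field_simps)
      finally show ?thesis
        by simp
    qed
    thus "\<exists>M. \<forall>N\<ge>M. norm (P (R N x) - 0) < r"
      by blast
  qed
  have "(\<lambda>n. cinner (P (u n)) x *\<^sub>C C (u n)) sums C x" for x
  proof -
    have "(\<lambda>N. C (R N x)) \<longlonglongrightarrow> 0"
      by (rule tendsto_norm_zero_cancel) (unfold norm_CP, rule tendsto_norm_zero [OF lim])
    hence "(\<lambda>N. C x - C (R N x)) \<longlonglongrightarrow> C x - 0"
      by (intro tendsto_intros)
    moreover have "C x - C (R N x) = (\<Sum>n<N. cinner (P (u n)) x *\<^sub>C C (u n))" for N
      by (simp add: R_defs u_def bounded_clinear_diff [OF C] bounded_clinear_sum [OF C]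
          bounded_clinear_scaleC [OF C] positive_sym [OF P])
    ultimately show ?thesis
      unfolding sums_def by simp
  qed
  moreover have "summable (\<lambda>n. norm (C (u n)) * norm (P (u n)))"
  proof (rule summableI_nonneg_bounded)
    fix N
    have re: "((\<lambda>x. Re (cinner x (P x))) has_sum Re (infsum (\<lambda>e. cinner e (P e)) E)) E"
      using has_sum_Re [OF has_sum_infsum [OF sm]] .
    have hs: "((\<lambda>x. \<Sum>n<N. (cmod (cinner x (P (u n))))\<^sup>2) has_sum (\<Sum>n<N. (norm (P (u n)))\<^sup>2)) E"
      by (intro has_sum_sum parseval E)
    have le: "(\<Sum>n<N. (cmod (cinner x (P (u n))))\<^sup>2) \<le> Re (cinner x (P x))" for x
    proof -
      have "cmod (cinner x (P (u n))) = cmod (cinner (u n) (P x))" for n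
        by (metis positive_sym [OF P] cinner_commute complex_mod_cnj)
      thus ?thesis
        using form_bessel [OF P, of e x N] by (simp add: u_def)
    qed
    have "(\<Sum>n<N. (norm (P (u n)))\<^sup>2) \<le> Re (infsum (\<lambda>e. cinner e (P e)) E)"
      by (rule has_sum_mono [OF hs re le])
    thus "(\<Sum>n<N. norm (C (u n)) * norm (P (u n))) \<le> Re (infsum (\<lambda>e. cinner e (P e)) E)"
      by (simp add: norm_CP power2_eq_square)
  qed simp
  ultimately show thesis
    using that [of "\<lambda>n. C (u n)" "\<lambda>n. P (u n)"] by (simp add: nuclear_rep_def)
qed

section \<open>Compact operators, and normal operators with collinear eigenvalues\<close>

instance complex_hilbert \<subseteq> banach ..

lemma nuclear_tail:
  fixes D :: "'h::complex_hilbert \<Rightarrow> 'h"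
  assumes "nuclear_rep D a v"
  shows "norm (D x - (\<Sum>n<M. cinner (v n) x *\<^sub>C a n))
    \<le> (\<Sum>n. norm (a (n + M)) * norm (v (n + M))) * norm x"
proof (rule norm_sums_le)
  show "(\<lambda>n. cinner (v (n + M)) x *\<^sub>C a (n + M)) sums (D x - (\<Sum>n<M. cinner (v n) x *\<^sub>C a n))"
    using assms unfolding nuclear_rep_def by (intro sums_split_initial_segment) blast
  have "summable (\<lambda>n. norm (a (n + M)) * norm (v (n + M)))"
    using assms unfolding nuclear_rep_def by (intro summable_ignore_initial_segment) blast
  thus "(\<lambda>n. norm (a (n + M)) * norm (v (n + M)) * norm x) sums
      ((\<Sum>n. norm (a (n + M)) * norm (v (n + M))) * norm x)"
    by (intro sums_mult2 summable_sums)
  show "norm (cinner (v (n + M)) x *\<^sub>C a (n + M)) \<le> norm (a (n + M)) * norm (v (n + M)) * norm x" for n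
    using mult_right_mono [OF cauchy_schwarz [of "v (n + M)" x], of "norm (a (n + M))"]
    by (simp add: norm_scaleC mult_ac)
qed

lemma nuclear_cadjoint:
  fixes D :: "'h::complex_hilbert \<Rightarrow> 'h"
  assumes D: "nuclear_rep D a v" "bounded_clinear D"
  shows "nuclear_rep (cadjoint D) v a"
  unfolding nuclear_rep_def
proof (intro conjI allI)
  show sm: "summable (\<lambda>n. norm (v n) * norm (a n))"
    using D(1) by (simp add: nuclear_rep_def mult.commute)
  fix x
  have "summable (\<lambda>n. cinner (a n) x *\<^sub>C v n)"
  proof (rule summable_comparison_test')
    show "summable (\<lambda>n. norm (v n) * norm (a n) * norm x)"
      by (intro summable_mult2 sm)
    show "norm (cinner (a n) x *\<^sub>C v n) \<le> norm (v n) * norm (a n) * norm x" for n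
      using mult_right_mono [OF cauchy_schwarz [of "a n" x], of "norm (v n)"]
      by (simp add: norm_scaleC mult_ac)
  qed
  then obtain S where S: "(\<lambda>n. cinner (a n) x *\<^sub>C v n) sums S"
    by (auto simp: summable_def)
  have "S = cadjoint D x"
  proof (rule cinner_eqI)
    fix z
    have "(\<lambda>n. cinner z (cinner (a n) x *\<^sub>C v n)) sums cinner z S"
      by (rule bounded_linear.sums [OF bounded_linear_cinner_right S])
    moreover have "(\<lambda>n. cinner x (cinner (v n) z *\<^sub>C a n)) sums cinner x (D z)"
      using D(1) unfolding nuclear_rep_def
      by (intro bounded_linear.sums [OF bounded_linear_cinner_right]) blast
    hence "(\<lambda>n. cnj (cinner x (cinner (v n) z *\<^sub>C a n))) sums cnj (cinner x (D z))"
      by (simp only: sums_cnj)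
    moreover have "cnj (cinner x (cinner (v n) z *\<^sub>C a n)) = cinner z (cinner (a n) x *\<^sub>C v n)" for n
      by (simp add: cinner_simps flip: cinner_commute)
    ultimately have "cinner z S = cnj (cinner x (D z))"
      by (simp add: sums_iff)
    also have "\<dots> = cinner z (cadjoint D x)"
      by (simp add: cinner_cadjoint [OF D(2)] flip: cinner_commute)
    finally show "cinner z S = cinner z (cadjoint D x)" .
  qed
  thus "(\<lambda>n. cinner (a n) x *\<^sub>C v n) sums cadjoint D x"
    using S by simp
qed

definition compact_op :: "('h::complex_inner \<Rightarrow> 'h) \<Rightarrow> bool" where
  "compact_op B \<longleftrightarrow> bounded_clinear B \<and> (\<exists>K. compact K \<and> B ` cball 0 1 \<subseteq> K)"

lemma compact_op_nuclear:
  fixes D :: "'h::complex_hilbert \<Rightarrow> 'h"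
  assumes D: "nuclear_rep D a v" "bounded_clinear D"
  shows "compact_op D"
proof -
  let ?K = "closure (D ` cball 0 1)"
  have "\<exists>k. finite k \<and> ?K \<subseteq> (\<Union>x\<in>k. ball x e)" if "e > 0" for e
  proof -
    have "e / 3 > 0" "summable (\<lambda>n. norm (a n) * norm (v n))"
      using that D(1) by (auto simp: nuclear_rep_def)
    from suminf_exist_split [OF this]
    obtain M where "norm (\<Sum>n. norm (a (n + M)) * norm (v (n + M))) < e / 3"
      by blast
    hence M: "(\<Sum>n. norm (a (n + M)) * norm (v (n + M))) < e / 3"
      by simp
    let ?B = "{(\<Sum>n<M. c n *\<^sub>C a n) |c. \<forall>n<M. cmod (c n) \<le> norm (v n)}"
    have "\<forall>\<epsilon>>0. \<exists>k. finite k \<and> ?B \<subseteq> (\<Union>x\<in>k. ball x \<epsilon>)"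
      using compact_coefficient_box [of a M "\<lambda>n. norm (v n)"]
      unfolding compact_eq_totally_bounded by (rule conjunct2)
    from this [rule_format, OF \<open>e / 3 > 0\<close>]
    obtain k where k: "finite k" "?B \<subseteq> (\<Union>x\<in>k. ball x (e / 3))"
      by (elim exE conjE)
    have "?K \<subseteq> (\<Union>x\<in>k. ball x e)"
    proof
      fix y
      assume "y \<in> ?K"
      hence "\<exists>z\<in>D ` cball 0 1. dist z y < e / 3"
        using \<open>e / 3 > 0\<close> unfolding closure_approachable by blast
      then obtain x where x: "norm x \<le> 1" "dist (D x) y < e / 3"
        by auto
      let ?F = "\<Sum>n<M. cinner (v n) x *\<^sub>C a n"
      have "cmod (cinner (v n) x) \<le> norm (v n)" for n
        using order_trans [OF cauchy_schwarz mult_left_mono [OF x(1) norm_ge_zero]] by simp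
      hence "?F \<in> ?B"
        by (intro CollectI exI [of _ "\<lambda>n. cinner (v n) x"]) simp
      then obtain z where z: "z \<in> k" "dist z ?F < e / 3"
        using k(2) by auto
      have "norm (D x - ?F) \<le> (\<Sum>n. norm (a (n + M)) * norm (v (n + M))) * norm x"
        by (rule nuclear_tail [OF D(1)])
      also have "\<dots> \<le> (\<Sum>n. norm (a (n + M)) * norm (v (n + M))) * 1"
        using x(1) D(1) unfolding nuclear_rep_def
        by (intro mult_left_mono suminf_nonneg summable_ignore_initial_segment
            [of "\<lambda>n. norm (a n) * norm (v n)"]) auto
      finally have "dist ?F (D x) < e / 3"
        using M by (simp add: dist_norm norm_minus_commute)
      hence "dist z y < e"
        using z(2) x(2) dist_triangle [of z y ?F] dist_triangle [of ?F y "D x"] by linarith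
      thus "y \<in> (\<Union>x\<in>k. ball x e)"
        using z(1) by auto
    qed
    thus ?thesis
      using k(1) by blast
  qed
  hence "compact ?K"
    by (simp add: compact_eq_totally_bounded complete_eq_closed)
  thus ?thesis
    unfolding compact_op_def using D(2) closure_subset by (intro conjI exI [of _ ?K])
qed

lemma compact_op_compose_left:
  assumes "bounded_clinear A" "compact_op B"
  shows "compact_op (\<lambda>x. A (B x))"
proof -
  obtain K where K: "compact K" "B ` cball 0 1 \<subseteq> K"
    using assms(2) by (auto simp: compact_op_def)
  have "compact (A ` K)"
    by (intro compact_continuous_image bounded_clinear_continuous assms K)
  moreover have "(\<lambda>x. A (B x)) ` cball 0 1 \<subseteq> A ` K"
    using K(2) by blast
  ultimately show ?thesis
    using assms bounded_clinear_compose unfolding compact_op_def by blast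
qed

lemma compact_op_compose_right:
  assumes "compact_op A" "bounded_clinear B"
  shows "compact_op (\<lambda>x. A (B x))"
proof -
  obtain K where K: "compact K" "A ` cball 0 1 \<subseteq> K" and A: "bounded_clinear A"
    using assms(1) by (auto simp: compact_op_def)
  obtain b where b: "b > 0" "\<And>x. norm (B x) \<le> b * norm x"
    using bounded_clinear_bound [OF assms(2)] by blast
  have "compact ((\<lambda>y. b *\<^sub>R y) ` K)"
    by (rule compact_scaling [OF K(1)])
  moreover have "(\<lambda>x. A (B x)) ` cball 0 1 \<subseteq> (\<lambda>y. b *\<^sub>R y) ` K"
  proof
    fix y
    assume "y \<in> (\<lambda>x. A (B x)) ` cball 0 1"
    then obtain x where x: "norm x \<le> 1" "y = A (B x)"
      by auto
    have "norm (B x) \<le> b"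
      using order_trans [OF b(2) mult_left_mono [OF x(1), of b]] b(1) by simp
    hence "A ((1 / b) *\<^sub>R B x) \<in> K"
      using b(1) K(2) by (auto simp: image_subset_iff)
    moreover have "y = b *\<^sub>R A ((1 / b) *\<^sub>R B x)"
      using b(1) bounded_clinear_linear [OF A] by (simp add: x(2) linear_simps)
    ultimately show "y \<in> (\<lambda>y. b *\<^sub>R y) ` K"
      by blast
  qed
  ultimately show ?thesis
    using assms(2) A bounded_clinear_compose unfolding compact_op_def by blast
qed

text \<open>Let \<open>m = \<parallel>B\<parallel>\<close>. For \<open>x\<^sub>n\<close> in the unit ball with \<open>\<parallel>B x\<^sub>n\<parallel> \<rightarrow> m\<close> the vectors \<open>B (B x\<^sub>n) - m\<^sup>2 x\<^sub>n\<close> tend to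
  \<open>0\<close>, and a limit point of \<open>B x\<^sub>n\<close> is the required eigenvector of \<open>B\<^sup>2\<close>.\<close>

lemma compact_symmetric_square_eigenvector:
  fixes B :: "'h::complex_inner \<Rightarrow> 'h"
  assumes B: "compact_op B" and sym: "symmetric_op B" and nz: "B x0 \<noteq> 0"
  obtains M x where "M > 0" "x \<noteq> 0" "B (B x) = complex_of_real M *\<^sub>C x"
proof -
  obtain K where K: "compact K" "B ` cball 0 1 \<subseteq> K" and bB: "bounded_clinear B"
    using B by (auto simp: compact_op_def)
  obtain b where b: "b > 0" "\<And>x. norm (B x) \<le> b * norm x"
    using bounded_clinear_bound [OF bB] by blast
  define m where "m = (SUP x\<in>cball 0 1. norm (B x))"
  have bdd: "bdd_above ((\<lambda>x. norm (B x)) ` cball 0 1)"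
  proof (rule bdd_aboveI2)
    fix x :: 'h
    assume "x \<in> cball 0 1"
    hence "norm x \<le> 1"
      by simp
    thus "norm (B x) \<le> b"
      using order_trans [OF b(2) mult_left_mono [of "norm x" 1 b]] b(1) by simp
  qed
  have unit: "norm (B x) \<le> m" if "norm x \<le> 1" for x
    unfolding m_def by (rule cSUP_upper [OF _ bdd]) (use that in simp)
  have le: "norm (B x) \<le> m * norm x" for x
  proof (cases "x = 0")
    case False
    have "norm (B ((1 / of_real (norm x)) *\<^sub>C x)) \<le> m"
      by (rule unit) (use False in \<open>simp add: norm_scaleC norm_divide\<close>)
    thus ?thesis
      using False by (simp add: bounded_clinear_scaleC [OF bB] norm_scaleC norm_divide field_simps)
  qed (simp add: bounded_clinear_zero [OF bB])
  have "x0 \<noteq> 0"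
    using nz bounded_clinear_zero [OF bB] by auto
  have m: "m > 0"
  proof -
    have "0 < norm (B x0)"
      using nz by simp
    also have "\<dots> \<le> m * norm x0"
      by (rule le)
    finally show ?thesis
      using \<open>x0 \<noteq> 0\<close> by (simp add: zero_less_mult_iff)
  qed
  have "\<exists>x. norm x \<le> 1 \<and> m - 1 / real (Suc n) < norm (B x)" for n
  proof -
    have "m - 1 / real (Suc n) < m"
      by simp
    thus ?thesis
      using less_cSUP_iff [OF _ bdd, of "m - 1 / real (Suc n)"] unfolding m_def by auto
  qed
  then obtain X where X: "\<And>n. norm (X n) \<le> 1" "\<And>n. m - 1 / real (Suc n) < norm (B (X n))"
    by metis
  have "\<forall>n. B (X n) \<in> K"
    using K(2) X(1) by auto
  then obtain l r where l: "strict_mono r" "(\<lambda>n. B (X (r n))) \<longlonglongrightarrow> l"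
    using K(1) [unfolded compact_def, THEN spec, of "\<lambda>n. B (X n)"] by (auto simp: o_def)
  have lim_norm: "(\<lambda>n. norm (B (X n))) \<longlonglongrightarrow> m"
  proof (rule tendsto_sandwich)
    have "(\<lambda>n. m - 1 / real (Suc n)) \<longlonglongrightarrow> m - 0"
      by (intro tendsto_intros lim_1_over_n [THEN LIMSEQ_Suc])
    thus "(\<lambda>n. m - 1 / real (Suc n)) \<longlonglongrightarrow> m"
      by simp
    show "\<forall>\<^sub>F n in sequentially. m - 1 / real (Suc n) \<le> norm (B (X n))"
      using X(2) by (intro always_eventually allI less_imp_le)
    show "\<forall>\<^sub>F n in sequentially. norm (B (X n)) \<le> m"
      using unit X(1) by (intro always_eventually) blast
  qed auto
  define Y where "Y = (\<lambda>n. B (B (X n)) - of_real (m\<^sup>2) *\<^sub>C X n)"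
  have Y: "(norm (Y n))\<^sup>2 \<le> m\<^sup>2 * (m\<^sup>2 - (norm (B (X n)))\<^sup>2)" for n
  proof -
    have "cinner (B (B (X n))) (X n) = cinner (B (X n)) (B (X n))"
      using sym by (simp add: symmetric_op_def)
    hence "(norm (Y n))\<^sup>2 = (norm (B (B (X n))))\<^sup>2 - 2 * m\<^sup>2 * (norm (B (X n)))\<^sup>2 + (m\<^sup>2)\<^sup>2 * (norm (X n))\<^sup>2"
      by (simp add: Y_def norm_diff_sq cinner_simps norm_scaleC power_mult_distrib Re_cinner_self
          flip: of_real_power)
    also have "\<dots> \<le> (m * norm (B (X n)))\<^sup>2 - 2 * m\<^sup>2 * (norm (B (X n)))\<^sup>2 + (m\<^sup>2)\<^sup>2 * 1"
      using le [of "B (X n)"] X(1) [of n]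
      by (intro add_mono diff_right_mono power_mono mult_left_mono) (auto simp: power_le_one)
    finally show ?thesis
      by (simp add: power_mult_distrib algebra_simps power2_eq_square)
  qed
  have "(\<lambda>n. m\<^sup>2 * (m\<^sup>2 - (norm (B (X n)))\<^sup>2)) \<longlonglongrightarrow> m\<^sup>2 * (m\<^sup>2 - m\<^sup>2)"
    by (intro tendsto_intros lim_norm)
  hence lim0: "(\<lambda>n. m\<^sup>2 * (m\<^sup>2 - (norm (B (X n)))\<^sup>2)) \<longlonglongrightarrow> 0"
    by simp
  have "(\<lambda>n. (norm (Y n))\<^sup>2) \<longlonglongrightarrow> 0"
    by (rule tendsto_sandwich [OF _ _ tendsto_const lim0]) (use Y in simp_all)
  hence "(\<lambda>n. sqrt ((norm (Y n))\<^sup>2)) \<longlonglongrightarrow> sqrt 0"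
    by (rule tendsto_real_sqrt)
  hence "Y \<longlonglongrightarrow> 0"
    by (simp add: tendsto_norm_zero_iff)
  hence Yr: "(\<lambda>n. Y (r n)) \<longlonglongrightarrow> 0"
    using LIMSEQ_subseq_LIMSEQ [OF _ l(1)] by (simp add: o_def)
  have "(\<lambda>n. B (B (X (r n))) - Y (r n)) \<longlonglongrightarrow> B l - 0"
    by (intro tendsto_intros bounded_clinear_tendsto [OF bB] l Yr)
  moreover have "B (B (X (r n))) - Y (r n) = of_real (m\<^sup>2) *\<^sub>C X (r n)" for n
    by (simp add: Y_def)
  ultimately have "(\<lambda>n. of_real (m\<^sup>2) *\<^sub>C X (r n)) \<longlonglongrightarrow> B l"
    by simp
  hence "(\<lambda>n. B (of_real (m\<^sup>2) *\<^sub>C X (r n))) \<longlonglongrightarrow> B (B l)"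
    by (rule bounded_clinear_tendsto [OF bB])
  moreover have "(\<lambda>n. of_real (m\<^sup>2) *\<^sub>C B (X (r n))) \<longlonglongrightarrow> of_real (m\<^sup>2) *\<^sub>C l"
    by (rule bounded_linear.tendsto [OF bounded_linear_scaleC_right l(2)])
  ultimately have "B (B l) = of_real (m\<^sup>2) *\<^sub>C l"
    unfolding bounded_clinear_scaleC [OF bB] by (rule LIMSEQ_unique)
  moreover have "norm l = m"
    using LIMSEQ_unique [OF tendsto_norm [OF l(2)]]
      LIMSEQ_subseq_LIMSEQ [OF lim_norm l(1)] by (simp add: o_def)
  ultimately show thesis
    using that [of "m\<^sup>2" l] m by auto
qed

lemma cadjoint_scaleC:
  fixes C :: "'h::complex_hilbert \<Rightarrow> 'h"
  shows "bounded_clinear C \<Longrightarrow> cadjoint (\<lambda>x. w *\<^sub>C C x) = (\<lambda>x. cnj w *\<^sub>C cadjoint C x)"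
  by (intro cadjointI bounded_clinear_const_scaleC)
    (simp_all add: cinner_simps cinner_cadjoint)

text \<open>An eigenspace of \<open>B\<^sup>2\<close> for a nonzero eigenvalue has a compact unit sphere and is invariant under the commuting
  self-adjoint operators \<open>Re C\<close> and \<open>Im C\<close>, which are diagonalised one after the other.\<close>

lemma joint_eigenvector:
  fixes B C :: "'h::complex_hilbert \<Rightarrow> 'h"
  assumes B: "compact_op B" "symmetric_op B" "B x0 \<noteq> 0"
    and C: "bounded_clinear C" "\<And>x. C (cadjoint C x) = cadjoint C (C x)"
    and comm: "\<And>x. B (C x) = C (B x)" "\<And>x. B (cadjoint C x) = cadjoint C (B x)"
  obtains x \<mu> where "x \<noteq> 0" "C x = \<mu> *\<^sub>C x" "B x \<noteq> 0"
proof -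
  have bB: "bounded_clinear B"
    using B by (simp add: compact_op_def)
  note C' = bounded_clinear_cadjoint [OF C(1)]
  define R A where "R = (\<lambda>x. (1/2) *\<^sub>C (C x + cadjoint C x))"
    and "A = (\<lambda>x. (1 / (2 * \<i>)) *\<^sub>C (C x - cadjoint C x))"
  have bR: "bounded_clinear R" and bA: "bounded_clinear A"
    unfolding R_def A_def
    by (intro bounded_clinear_const_scaleC bounded_clinear_plus bounded_clinear_minus C C')+
  have sR: "symmetric_op R" and sA: "symmetric_op A"
    unfolding symmetric_op_def R_def A_def
    by (simp_all add: cinner_simps cinner_cadjoint [OF C(1)] cinner_cadjoint' [OF C(1)] algebra_simps)
  have CRA: "C x = R x + \<i> *\<^sub>C A x" for x
    unfolding R_def A_def
    by (simp add: scaleC_scaleC scaleC_diff_right scaleC_add_right)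
      (simp add: scaleC_one flip: scaleC_add_left)
  have RA: "R (A x) = A (R x)" for x
    unfolding R_def A_def
    by (simp add: bounded_clinear_scaleC [OF C(1)] bounded_clinear_scaleC [OF C'] bounded_clinear_add [OF C(1)]
        bounded_clinear_add [OF C'] bounded_clinear_diff [OF C(1)] bounded_clinear_diff [OF C']
        bounded_clinear_uminus [OF C(1)] bounded_clinear_uminus [OF C'] C(2) scaleC_add_right scaleC_diff_right scaleC_scaleC)
  have BR: "B (R x) = R (B x)" and BA: "B (A x) = A (B x)" for x
    unfolding R_def A_def
    by (simp_all add: bounded_clinear_scaleC [OF bB] bounded_clinear_add [OF bB] bounded_clinear_diff [OF bB]
        bounded_clinear_uminus [OF bB] comm)
  obtain M y where M: "M > 0" and y: "y \<noteq> 0" "B (B y) = complex_of_real M *\<^sub>C y"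
    using compact_symmetric_square_eigenvector [OF B] by blast
  define N where "N = {x. B (B x) = complex_of_real M *\<^sub>C x}"
  have subN: "complex_vector.subspace N"
    unfolding N_def by (rule complex_vector.subspaceI)
      (simp_all add: bounded_clinear_zero [OF bB] bounded_clinear_add [OF bB] bounded_clinear_scaleC [OF bB]
        scaleC_add_right scaleC_scaleC mult.commute)
  have cl: "closed {x. F x = (c::complex) *\<^sub>C (x::'h)}" if "bounded_clinear F" for F c
    by (intro closed_Collect_eq bounded_clinear_continuous that continuous_intros)
  obtain K where K: "compact K" "B ` cball 0 1 \<subseteq> K"
    using B by (auto simp: compact_op_def)
  have "compact ((\<lambda>y. (1 / complex_of_real M) *\<^sub>C B y) ` K)"
    by (intro compact_continuous_image continuous_intros bounded_clinear_continuous bB K)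
  moreover have "N \<inter> {x. norm x = 1} \<subseteq> (\<lambda>y. (1 / complex_of_real M) *\<^sub>C B y) ` K"
  proof
    fix x
    assume "x \<in> N \<inter> {x. norm x = 1}"
    hence "x = (1 / complex_of_real M) *\<^sub>C B (B x)" "B x \<in> K"
      using M K(2) by (auto simp: N_def scaleC_scaleC scaleC_one image_subset_iff)
    thus "x \<in> (\<lambda>y. (1 / complex_of_real M) *\<^sub>C B y) ` K"
      by blast
  qed
  moreover have "closed (N \<inter> {x. norm x = 1})"
    unfolding N_def
    by (rule closed_Int [OF cl [OF bounded_clinear_compose [OF bB bB]]])
      (intro closed_Collect_eq continuous_intros)
  ultimately have cN: "compact (N \<inter> {x. norm x = 1})"
    using compact_Int_closed [of "(\<lambda>y. (1 / complex_of_real M) *\<^sub>C B y) ` K" "N \<inter> {x. norm x = 1}"]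
    by (simp only: inf.absorb2)
  have RN: "R x \<in> N" and AN: "A x \<in> N" if "x \<in> N" for x
    using that by (simp_all add: N_def BR BA bounded_clinear_scaleC [OF bR] bounded_clinear_scaleC [OF bA])
  have yN: "y \<in> N"
    using y by (simp add: N_def)
  obtain x1 \<rho> where x1: "x1 \<in> N" "norm x1 = 1" "R x1 = complex_of_real \<rho> *\<^sub>C x1"
    by (rule eigenvector_on_compact_sphere [OF bR sR subN RN cN yN y(1)], assumption) (rule that)
  define N' where "N' = N \<inter> {x. R x = complex_of_real \<rho> *\<^sub>C x}"
  have "complex_vector.subspace {x. R x = complex_of_real \<rho> *\<^sub>C x}"
    by (rule complex_vector.subspaceI)
      (simp_all add: bounded_clinear_zero [OF bR] bounded_clinear_add [OF bR] bounded_clinear_scaleC [OF bR]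
        scaleC_add_right scaleC_scaleC mult.commute)
  hence subN': "complex_vector.subspace N'"
    unfolding N'_def by (rule complex_vector.subspace_inter [OF subN])
  have AN': "A x \<in> N'" if "x \<in> N'" for x
    using that AN by (simp add: N'_def RA bounded_clinear_scaleC [OF bA])
  have "compact ((N \<inter> {x. norm x = 1}) \<inter> {x. R x = complex_of_real \<rho> *\<^sub>C x})"
    by (intro compact_Int_closed cN cl bR)
  hence cN': "compact (N' \<inter> {x. norm x = 1})"
    unfolding N'_def by (simp add: Int_ac)
  have x1': "x1 \<in> N'" "x1 \<noteq> 0"
    using x1 by (auto simp: N'_def)
  obtain x \<alpha> where x: "x \<in> N'" "norm x = 1" "A x = complex_of_real \<alpha> *\<^sub>C x"
    by (rule eigenvector_on_compact_sphere [OF bA sA subN' AN' cN' x1'], assumption) (rule that)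
  have "C x = (of_real \<rho> + \<i> * of_real \<alpha>) *\<^sub>C x"
    using x by (simp add: CRA N'_def scaleC_add_left scaleC_scaleC)
  moreover have "x \<noteq> 0"
    using x by auto
  moreover have "B x \<noteq> 0"
  proof
    assume "B x = 0"
    hence "complex_of_real M *\<^sub>C x = 0"
      using x(1) by (simp add: N'_def N_def bounded_clinear_zero [OF bB])
    thus False
      using M \<open>x \<noteq> 0\<close> by (simp add: complex_vector.scale_eq_0_iff)
  qed
  ultimately show thesis
    using that by blast
qed

lemma nonzero_orthogonal_vector:
  fixes S :: "'h::complex_inner set"
  assumes "infinite_dimensional TYPE('h)" "finite S"
  obtains x :: 'h where "x \<noteq> 0" "\<And>y. y \<in> S \<Longrightarrow> cinner y x = 0"
proof -
  have "ortho (\<lambda>_. 0 :: 'h) {..<0::nat}"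
    by (simp add: ortho_def)
  then obtain n :: nat and u where u: "ortho u {..<n}" "\<forall>y\<in>S. oproj u {..<n} y = y"
    by (rule gram_schmidt_extendE [OF _ assms(2)])
  have "cspan (u ` {..<n}) \<noteq> UNIV"
    using assms(1) unfolding infinite_dimensional_def by blast
  then obtain z where z: "z \<notin> cspan (u ` {..<n})"
    by blast
  define x where "x = z - oproj u {..<n} z"
  have "x \<noteq> 0"
    using z oproj_in_cspan [of u "{..<n}" z] by (auto simp: x_def)
  moreover have "cinner y x = 0" if "y \<in> S" for y
  proof -
    have "oproj u {..<n} x = 0"
      by (simp add: x_def oproj_diff oproj_idem u)
    have "cinner y x = cinner (oproj u {..<n} y) x"
      using u(2) that by simp
    also have "\<dots> = 0"
      by (simp add: oproj_selfadjoint \<open>oproj u {..<n} x = 0\<close>)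
    finally show ?thesis .
  qed
  ultimately show thesis
    using that by blast
qed

lemma normal_norm_cadjoint:
  fixes C :: "'h::complex_hilbert \<Rightarrow> 'h"
  assumes "bounded_clinear C" "\<And>x. C (cadjoint C x) = cadjoint C (C x)"
  shows "norm (cadjoint C x) = norm (C x)"
proof -
  have "cinner (cadjoint C x) (cadjoint C x) = cinner (C x) (C x)"
    by (simp add: cinner_cadjoint [OF assms(1)] cinner_cadjoint' [OF assms(1)] assms(2))
  thus ?thesis
    by (metis Re_cinner_self norm_ge_zero power2_eq_iff_nonneg)
qed

lemma collinear_complex_rotate:
  assumes "collinear S"
  obtains w d where "cmod w = 1" "\<And>\<mu>. \<mu> \<in> S \<Longrightarrow> Im (w * \<mu>) = d"
proof -
  obtain u where u: "\<And>x y. x \<in> S \<Longrightarrow> y \<in> S \<Longrightarrow> \<exists>c. x - y = c *\<^sub>R u"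
    using assms unfolding collinear_def by blast
  define w where "w = (if u = 0 then 1 else cnj u / of_real (cmod u))"
  have w: "cmod w = 1"
    by (simp add: w_def norm_divide)
  have "Im (w * u) = 0"
    by (simp add: w_def)
  have eq: "Im (w * x) = Im (w * y)" if xy: "x \<in> S" "y \<in> S" for x y
  proof -
    obtain c where c: "x - y = c *\<^sub>R u"
      using u [OF xy] by blast
    have "Im (w * x) - Im (w * y) = Im (w * (x - y))"
      by (simp add: algebra_simps)
    also have "\<dots> = c * Im (w * u)"
      by (simp add: c algebra_simps)
    finally show ?thesis
      using \<open>Im (w * u) = 0\<close> by simp
  qed
  define d where "d = Im (w * (SOME x. x \<in> S))"
  have "Im (w * \<mu>) = d" if "\<mu> \<in> S" for \<mu>
    unfolding d_def by (rule eq [OF that]) (rule someI [of "\<lambda>x. x \<in> S", OF that])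
  thus thesis
    using that w by blast
qed

text \<open>After a rotation the eigenvalues lie on the line \<open>Im z = d\<close>. With \<open>A = Im C\<close> the compact operator
  \<open>(A - d) C\<^sup>* C (A - d)\<close> vanishes: otherwise \<open>C\<close> would have an eigenvector outside its kernel, but
  \<open>A x = d x\<close> for every eigenvector \<open>x\<close> of \<open>C\<close>. Hence
  \<open>C (A - d) = 0\<close>. If \<open>d = 0\<close> this forces \<open>A = 0\<close>. If \<open>d \<noteq> 0\<close>, then \<open>A \<noteq> d\<close>, because a nuclear
  operator on an infinite-dimensional space is not a nonzero multiple of the identity, so
  \<open>0\<close> is an eigenvalue of \<open>C\<close>, which is off the line. This is where the infinite dimension of the
  space is essential.\<close>

lemma normal_collinear_imp_rotated_symmetric:
  fixes C :: "'h::complex_hilbert \<Rightarrow> 'h"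
  assumes inf: "infinite_dimensional TYPE('h)"
    and nuc: "nuclear_rep C a v" and normal: "normal_op C" and coll: "collinear (eigenvalues_op C)"
  obtains w where "cmod w = 1" "symmetric_op (\<lambda>x. w *\<^sub>C C x)"
proof -
  obtain w d where w: "cmod w = 1" and d: "\<And>\<mu>. \<mu> \<in> eigenvalues_op C \<Longrightarrow> Im (w * \<mu>) = d"
    using collinear_complex_rotate [OF coll] by blast
  have wne: "w \<noteq> 0"
    using w by auto
  have bC: "bounded_clinear C" and nC: "C (cadjoint C x) = cadjoint C (C x)" for x
    using normal by (auto simp: normal_op_def fun_eq_iff)
  have cC: "compact_op C" and cC': "compact_op (cadjoint C)"
    using nuc bC by (auto intro: compact_op_nuclear nuclear_cadjoint bounded_clinear_cadjoint)
  define D where "D = (\<lambda>x. w *\<^sub>C C x)"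
  have bD: "bounded_clinear D"
    unfolding D_def by (rule bounded_clinear_const_scaleC [OF bC])
  have D': "cadjoint D = (\<lambda>x. cnj w *\<^sub>C cadjoint C x)"
    unfolding D_def by (rule cadjoint_scaleC [OF bC])
  note bD' = bounded_clinear_cadjoint [OF bD] and bC' = bounded_clinear_cadjoint [OF bC]
  have nD: "D (cadjoint D x) = cadjoint D (D x)" for x
    unfolding D' unfolding D_def
    by (simp add: bounded_clinear_scaleC [OF bC] bounded_clinear_scaleC [OF bC'] scaleC_scaleC nC mult.commute)
  have cD: "compact_op D"
    unfolding D_def using compact_op_compose_left [OF bounded_clinear_const_scaleC [OF bounded_clinear_ident] cC] .
  have eigD: "Im \<mu> = d" if "x \<noteq> 0" "D x = \<mu> *\<^sub>C x" for x \<mu>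
  proof -
    have "C x = (1 / w) *\<^sub>C D x"
      using wne by (simp add: D_def scaleC_scaleC scaleC_one)
    also have "\<dots> = (\<mu> / w) *\<^sub>C x"
      by (simp add: that scaleC_scaleC)
    finally have "\<mu> / w \<in> eigenvalues_op C"
      using that(1) by (auto simp: eigenvalues_op_def)
    from d [OF this] show ?thesis
      using wne by simp
  qed
  define A where "A = (\<lambda>x. (1 / (2 * \<i>)) *\<^sub>C (D x - cadjoint D x))"
  define A' where "A' = (\<lambda>x. A x - of_real d *\<^sub>C x)"
  have bA: "bounded_clinear A"
    unfolding A_def by (intro bounded_clinear_const_scaleC bounded_clinear_minus bD bD')
  have bA': "bounded_clinear A'"
    unfolding A'_def by (intro bounded_clinear_minus bA bounded_clinear_const_scaleC bounded_clinear_ident)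
  have sA: "cinner (A x) y = cinner x (A y)" for x y
    unfolding A_def
    by (simp add: cinner_simps cinner_cadjoint [OF bD] cinner_cadjoint' [OF bD] algebra_simps)
  have sA': "cinner (A' x) y = cinner x (A' y)" for x y
    unfolding A'_def by (simp add: cinner_simps sA)
  have A'D: "A' (D x) = D (A' x)" and A'D': "A' (cadjoint D x) = cadjoint D (A' x)" for x
    unfolding A'_def A_def
    by (simp_all add: bounded_clinear_scaleC [OF bD] bounded_clinear_scaleC [OF bD'] bounded_clinear_diff [OF bD]
        bounded_clinear_diff [OF bD'] bounded_clinear_uminus [OF bD] bounded_clinear_uminus [OF bD'] nD)
  define B where "B = (\<lambda>x. A' (cadjoint D (D (A' x))))"
  have cB: "compact_op B"
    unfolding B_def
    by (rule compact_op_compose_left [OF bA'], rule compact_op_compose_left [OF bD'],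
        rule compact_op_compose_right [OF cD bA'])
  have sB: "symmetric_op B"
    unfolding symmetric_op_def B_def
    by (simp add: sA' cinner_cadjoint [OF bD] cinner_cadjoint' [OF bD])
  have BD: "B (D x) = D (B x)" and BD': "B (cadjoint D x) = cadjoint D (B x)" for x
    unfolding B_def by (simp_all add: A'D A'D' nD)
  have "B x = 0" for x
  proof (rule ccontr)
    assume "B x \<noteq> 0"
    then obtain z \<mu> where z: "z \<noteq> 0" "D z = \<mu> *\<^sub>C z" "B z \<noteq> 0"
      using joint_eigenvector [OF cB sB _ bD nD BD BD'] by blast
    define F where "F = (\<lambda>x. D x - \<mu> *\<^sub>C x)"
    have bF: "bounded_clinear F"
      unfolding F_def by (intro bounded_clinear_minus bD bounded_clinear_const_scaleC bounded_clinear_ident)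
    have F': "cadjoint F = (\<lambda>x. cadjoint D x - cnj \<mu> *\<^sub>C x)"
      by (rule cadjointI [OF bF]) (simp add: F_def cinner_simps cinner_cadjoint [OF bD])
    have "norm (cadjoint F z) = norm (F z)"
      by (rule normal_norm_cadjoint [OF bF], unfold F', unfold F_def)
        (simp add: bounded_clinear_diff [OF bD] bounded_clinear_diff [OF bD'] bounded_clinear_scaleC [OF bD]
          bounded_clinear_scaleC [OF bD'] nD scaleC_diff_right scaleC_scaleC mult.commute)
    moreover have "F z = 0"
      by (simp add: F_def z(2))
    ultimately have "cadjoint F z = 0"
      by simp
    hence "cadjoint D z = cnj \<mu> *\<^sub>C z"
      unfolding F' by simp
    hence "A z = (1 / (2 * \<i>) * (\<mu> - cnj \<mu>)) *\<^sub>C z"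
      by (simp add: A_def z(2) scaleC_scaleC flip: scaleC_diff_left)
    also have "1 / (2 * \<i>) * (\<mu> - cnj \<mu>) = of_real (Im \<mu>)"
      by (simp add: complex_eq_iff)
    finally have "A' z = 0"
      using eigD [OF z(1,2)] by (simp add: A'_def)
    hence "B z = 0"
      by (simp add: B_def bounded_clinear_zero [OF bD] bounded_clinear_zero [OF bD'] bounded_clinear_zero [OF bA'])
    thus False
      using z(3) by simp
  qed
  have DA': "D (A' x) = 0" for x
  proof -
    have "cinner (D (A' x)) (D (A' x)) = cinner x (B x)"
      by (simp add: B_def cinner_cadjoint [OF bD] sA')
    thus ?thesis
      using \<open>\<And>x. B x = 0\<close> by (simp add: cinner_eq_0_norm)
  qed
  have AA': "A (A' x) = 0" for x
    using normal_norm_cadjoint [OF bD nD, of "A' x"] by (simp add: A_def DA')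
  have "d = 0"
  proof (rule ccontr)
    assume "d \<noteq> 0"
    have A'0: "A' x = 0" for x
    proof (rule ccontr)
      assume "A' x \<noteq> 0"
      from eigD [OF this, of 0] show False
        using \<open>d \<noteq> 0\<close> by (simp add: DA')
    qed
    have "summable (\<lambda>n. norm (a n) * norm (v n))" "0 < \<bar>d\<bar>"
      using nuc \<open>d \<noteq> 0\<close> by (simp_all add: nuclear_rep_def)
    from suminf_exist_split [OF this(2,1)]
    obtain M where "norm (\<Sum>n. norm (a (n + M)) * norm (v (n + M))) < \<bar>d\<bar>"
      by blast
    hence M: "(\<Sum>n. norm (a (n + M)) * norm (v (n + M))) < \<bar>d\<bar>"
      by simp
    obtain x where x: "x \<noteq> 0" "\<And>y. y \<in> a ` {..<M} \<union> v ` {..<M} \<Longrightarrow> cinner y x = 0"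
      using nonzero_orthogonal_vector [OF inf, of "a ` {..<M} \<union> v ` {..<M}"] by blast
    have "norm (C x) \<le> (\<Sum>n. norm (a (n + M)) * norm (v (n + M))) * norm x"
      using nuclear_tail [OF nuc, of x M] x(2) by simp
    also have "\<dots> < \<bar>d\<bar> * norm x"
      using x(1) by (intro mult_strict_right_mono M) simp
    finally have Cx: "norm (C x) < \<bar>d\<bar> * norm x" .
    have "norm (A x) \<le> (norm (D x) + norm (cadjoint D x)) / 2"
      using norm_triangle_ineq4 [of "D x" "cadjoint D x"] by (simp add: A_def norm_scaleC norm_divide)
    also have "\<dots> = norm (C x)"
      unfolding normal_norm_cadjoint [OF bD nD] by (simp add: D_def norm_scaleC w)
    also have "\<dots> < \<bar>d\<bar> * norm x"
      by (rule Cx)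
    also have "\<bar>d\<bar> * norm x = norm (A x)"
      using A'0 [of x] by (simp add: A'_def norm_scaleC)
    finally show False
      by simp
  qed
  have "A x = 0" for x
  proof -
    have "cinner (A x) (A x) = cinner x (A (A' x))"
      by (simp add: A'_def \<open>d = 0\<close> sA)
    thus ?thesis
      by (simp add: AA' cinner_eq_0_norm)
  qed
  hence "cadjoint D x = D x" for x
    by (simp add: A_def complex_vector.scale_eq_0_iff)
  hence "symmetric_op D"
    unfolding symmetric_op_def by (simp add: cinner_cadjoint [OF bD])
  thus thesis
    using that w by (simp add: D_def)
qed

section \<open>Reduction to finite rank, and the closure of the numerical range\<close>

lemma nuclear_pairing_summable:
  fixes B :: "'h::complex_hilbert \<Rightarrow> 'h"
  assumes D: "nuclear_rep D a v" and B: "bounded_clinear B"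
  shows "summable (\<lambda>n. cinner (v n) (B (a n)))"
proof -
  obtain b where b: "b > 0" "\<And>x. norm (B x) \<le> b * norm x"
    using bounded_clinear_bound [OF B] by blast
  show ?thesis
  proof (rule summable_comparison_test')
    show "summable (\<lambda>n. b * (norm (a n) * norm (v n)))"
      using D by (intro summable_mult) (simp add: nuclear_rep_def)
    show "norm (cinner (v n) (B (a n))) \<le> b * (norm (a n) * norm (v n))" for n
      using order_trans [OF cauchy_schwarz mult_left_mono [OF b(2) norm_ge_zero], of "v n" "a n"]
      by (simp add: mult_ac)
  qed
qed

lemma ctrace_linear:
  fixes D B B' :: "'h::complex_hilbert \<Rightarrow> 'h"
  assumes D: "nuclear_rep D a v" and B: "bounded_clinear B" "bounded_clinear B'"
    and E: "\<exists>E::'h set. is_onb E"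
  shows "ctrace (\<lambda>x. D (c *\<^sub>C B x + d *\<^sub>C B' x)) = c * ctrace (\<lambda>x. D (B x)) + d * ctrace (\<lambda>x. D (B' x))"
proof -
  have "bounded_clinear (\<lambda>x. c *\<^sub>C B x + d *\<^sub>C B' x)"
    by (intro bounded_clinear_plus bounded_clinear_const_scaleC B)
  from ctrace_nuclear [OF D this E]
  have "ctrace (\<lambda>x. D (c *\<^sub>C B x + d *\<^sub>C B' x))
      = (\<Sum>n. c * cinner (v n) (B (a n)) + d * cinner (v n) (B' (a n)))"
    by (simp add: cinner_simps)
  also have "\<dots> = c * (\<Sum>n. cinner (v n) (B (a n))) + d * (\<Sum>n. cinner (v n) (B' (a n)))"
    using nuclear_pairing_summable [OF D B(1)] nuclear_pairing_summable [OF D B(2)]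
    by (simp add: suminf_mult flip: suminf_add)
  finally show ?thesis
    by (simp add: ctrace_nuclear [OF D _ E] B)
qed

text \<open>Since \<open>X = \<Sum>i<n. \<langle>f\<^sub>i, \<cdot>\<rangle> X f\<^sub>i\<close>, the trace of \<open>X B\<close> equals that of \<open>B X\<close> on the span of \<open>f\<close>. As \<open>f\<close> is
  arbitrary, this also contains the independence of the basis.\<close>

lemma ctrace_finite_rank:
  fixes X B :: "'h::complex_hilbert \<Rightarrow> 'h" and f :: "nat \<Rightarrow> 'h"
  assumes X: "bounded_clinear X" "\<And>x. X (oproj f {..<n} x) = X x" and B: "bounded_clinear B"
    and E: "\<exists>E::'h set. is_onb E"
  shows "ctrace (\<lambda>x. X (B x)) = (\<Sum>i<n. cinner (f i) (B (X (f i))))"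
proof -
  define v where "v = (\<lambda>i. if i < n then f i else 0)"
  have "(\<lambda>i. cinner (v i) x *\<^sub>C X (f i)) sums (\<Sum>i<n. cinner (v i) x *\<^sub>C X (f i))" for x
    by (rule sums_finite) (auto simp: v_def)
  moreover have "(\<Sum>i<n. cinner (v i) x *\<^sub>C X (f i)) = X x" for x
  proof -
    have "(\<Sum>i<n. cinner (v i) x *\<^sub>C X (f i)) = X (oproj f {..<n} x)"
      by (simp add: v_def oproj_def bounded_clinear_sum [OF X(1)] bounded_clinear_scaleC [OF X(1)])
    thus ?thesis
      by (simp add: X(2))
  qed
  moreover have "summable (\<lambda>i. norm (X (f i)) * norm (v i))"
    by (rule summable_finite [of "{..<n}"]) (auto simp: v_def)
  ultimately have "nuclear_rep X (\<lambda>i. X (f i)) v"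
    by (simp add: nuclear_rep_def)
  from ctrace_nuclear [OF this B E]
  have "ctrace (\<lambda>x. X (B x)) = (\<Sum>i. cinner (v i) (B (X (f i))))" .
  also have "\<dots> = (\<Sum>i<n. cinner (v i) (B (X (f i))))"
    by (rule suminf_finite) (auto simp: v_def)
  finally show ?thesis
    by (simp add: v_def)
qed

text \<open>The projection \<open>\<Pi>\<close> on the span of \<open>p\<close> does not change the first \<open>M\<close> terms of the nuclear series, so
  only the tail contributes to the difference of the traces of \<open>C B\<close> and \<open>\<Pi> C \<Pi> B\<close>. A compression is used
  rather than a truncated series because it preserves symmetry.\<close>

lemma ctrace_compression_close:
  fixes C B :: "'h::complex_hilbert \<Rightarrow> 'h" and p :: "nat \<Rightarrow> 'h"
  assumes C: "nuclear_rep C a v" and p: "ortho p {..<k}"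
    and fixed: "\<And>n. n < M \<Longrightarrow> oproj p {..<k} (a n) = a n" "\<And>n. n < M \<Longrightarrow> oproj p {..<k} (v n) = v n"
    and B: "bounded_clinear B" "b \<ge> 0" "\<And>x. norm (B x) \<le> b * norm x"
    and E: "\<exists>E::'h set. is_onb E"
  shows "cmod (ctrace (\<lambda>x. C (B x)) - ctrace (\<lambda>x. oproj p {..<k} (C (oproj p {..<k} (B x)))))
    \<le> 2 * b * (\<Sum>n. norm (a (n + M)) * norm (v (n + M)))"
proof -
  let ?P = "oproj p {..<k}"
  have le: "norm (?P x) \<le> norm x" for x
    by (rule norm_oproj_le [OF _ p]) simp
  have sm: "summable (\<lambda>n. norm (a n) * norm (v n))"
    using C by (simp add: nuclear_rep_def)
  have X: "nuclear_rep (\<lambda>x. ?P (C (?P x))) (\<lambda>n. ?P (a n)) (\<lambda>n. ?P (v n))"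
    unfolding nuclear_rep_def
  proof (intro conjI allI)
    show "summable (\<lambda>n. norm (?P (a n)) * norm (?P (v n)))"
      by (rule summable_comparison_test' [OF sm]) (simp add: mult_mono le)
    show "(\<lambda>n. cinner (?P (v n)) x *\<^sub>C ?P (a n)) sums ?P (C (?P x))" for x
    proof -
      have "(\<lambda>n. cinner (v n) (?P x) *\<^sub>C a n) sums C (?P x)"
        using C unfolding nuclear_rep_def by blast
      from bounded_linear.sums [OF bounded_clinear_linear [OF bounded_clinear_oproj] this, of p "{..<k}"]
      show ?thesis
        by (simp add: oproj_scaleC oproj_selfadjoint)
    qed
  qed
  define g where "g = (\<lambda>n. cinner (v n) (B (a n)) - cinner (?P (v n)) (B (?P (a n))))"
  have "g sums ((\<Sum>n. cinner (v n) (B (a n))) - (\<Sum>n. cinner (?P (v n)) (B (?P (a n)))))"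
    unfolding g_def using nuclear_pairing_summable [OF C B(1)] nuclear_pairing_summable [OF X B(1)]
    by (intro sums_diff summable_sums)
  hence "g sums (ctrace (\<lambda>x. C (B x)) - ctrace (\<lambda>x. ?P (C (?P (B x)))))"
    by (simp add: ctrace_nuclear [OF C B(1) E] ctrace_nuclear [OF X B(1) E])
  from sums_split_initial_segment [OF this, of M]
  have *: "(\<lambda>n. g (n + M)) sums (ctrace (\<lambda>x. C (B x)) - ctrace (\<lambda>x. ?P (C (?P (B x)))))"
    by (simp add: g_def fixed)
  have bound: "cmod (g n) \<le> 2 * b * (norm (a n) * norm (v n))" for n
  proof -
    have form: "cmod (cinner y (B x)) \<le> b * (norm (a n) * norm (v n))"
      if "norm x \<le> norm (a n)" "norm y \<le> norm (v n)" for x y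
    proof -
      have "cmod (cinner y (B x)) \<le> norm y * norm (B x)"
        by (rule cauchy_schwarz)
      also have "\<dots> \<le> norm y * (b * norm x)"
        by (intro mult_left_mono B) simp
      also have "\<dots> \<le> norm (v n) * (b * norm (a n))"
        using that B(2) by (intro mult_mono) auto
      finally show ?thesis
        by (simp add: mult_ac)
    qed
    have "cmod (g n) \<le> cmod (cinner (v n) (B (a n))) + cmod (cinner (?P (v n)) (B (?P (a n))))"
      unfolding g_def by (rule norm_triangle_ineq4)
    also have "\<dots> \<le> b * (norm (a n) * norm (v n)) + b * (norm (a n) * norm (v n))"
      by (intro add_mono form le order_refl)
    finally show ?thesis
      by simp
  qed
  show ?thesis
  proof (rule norm_sums_le [OF *])
    show "(\<lambda>n. 2 * b * (norm (a (n + M)) * norm (v (n + M)))) sums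
        (2 * b * (\<Sum>n. norm (a (n + M)) * norm (v (n + M))))"
      by (intro sums_mult summable_sums summable_ignore_initial_segment
          [of "\<lambda>n. norm (a n) * norm (v n)"] sm)
  qed (rule bound)
qed

lemma unitary_ident: "unitary_op (\<lambda>x::'h::complex_hilbert. x)" "cadjoint (\<lambda>x::'h. x) = (\<lambda>x. x)"
  using unitary_opI [of "\<lambda>x::'h. x" "\<lambda>x. x"] by (simp_all add: bounded_clinear_ident)

lemma cadjoint_commutes_oproj:
  assumes "unitary_op Q" "\<And>x. oproj g I (Q x) = Q (oproj g I x)"
  shows "oproj g I (cadjoint Q x) = cadjoint Q (oproj g I x)"
proof -
  have "oproj g I (cadjoint Q x) = cadjoint Q (Q (oproj g I (cadjoint Q x)))"
    by (simp add: unitary_cadjoint_left assms(1))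
  also have "Q (oproj g I (cadjoint Q x)) = oproj g I x"
    unfolding assms(2) [symmetric] by (simp add: unitary_cadjoint_right assms(1))
  finally show ?thesis .
qed

lemma oproj_unitary:
  assumes Q: "unitary_op Q" "\<And>x. oproj g I (Q x) = Q (oproj g I x)"
  shows "oproj (\<lambda>i. Q (g i)) I = oproj g I"
proof
  fix x
  note bQ = unitary_bounded [OF Q(1)]
  have "cinner (Q (g i)) x = cinner (g i) (cadjoint Q x)" for i
    by (rule cinner_cadjoint [OF bQ])
  hence "oproj (\<lambda>i. Q (g i)) I x = Q (oproj g I (cadjoint Q x))"
    by (simp add: oproj_def bounded_clinear_sum [OF bQ] bounded_clinear_scaleC [OF bQ])
  also have "\<dots> = oproj g I x"
    by (simp add: unitary_cadjoint_right [OF Q(1)] flip: Q(2))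
  finally show "oproj (\<lambda>i. Q (g i)) I x = oproj g I x" .
qed

lemma bounded_clinear_conjugation:
  assumes "unitary_op U" "bounded_clinear T"
  shows "bounded_clinear (\<lambda>x. cadjoint U (T (U x)))"
  using bounded_clinear_cadjoint [OF unitary_bounded [OF assms(1)]]
    bounded_clinear_compose [OF assms(2) unitary_bounded [OF assms(1)]]
  by (rule bounded_clinear_compose)

text \<open>Let \<open>L\<close> be the finite-dimensional space spanned by the range of \<open>X\<close> and its image under \<open>V\<close>. The
  unitary \<open>V\<close> may be replaced by one that preserves \<open>L\<close>. The Hermitian one among \<open>X\<close> and the
  compression of \<open>T\<close> to \<open>L\<close> is diagonalised, and the convex combination belonging to two orthonormal
  bases of \<open>L\<close> is realised by a third one. The two cases correspond to each other by the cyclicity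
  of the trace: \<open>tr (X W\<^sup>* T W) = tr (T W X W\<^sup>*)\<close>.\<close>

lemma finite_rank_convex:
  fixes X T V :: "'h::complex_hilbert \<Rightarrow> 'h" and p :: "nat \<Rightarrow> 'h"
  assumes E: "\<exists>E::'h set. is_onb E"
    and p: "ortho p {..<k}" and X: "bounded_clinear X"
    and XP: "\<And>x. X (oproj p {..<k} x) = X x" and PX: "\<And>x. oproj p {..<k} (X x) = X x"
    and T: "bounded_clinear T" and sym: "symmetric_op X \<or> symmetric_op T"
    and V: "unitary_op V" and t: "0 \<le> t" "t \<le> 1"
  shows "\<exists>W. unitary_op W \<and> ctrace (\<lambda>x. X (cadjoint W (T (W x)))) =
    complex_of_real (1 - t) * ctrace (\<lambda>x. X (T x)) +
    complex_of_real t * ctrace (\<lambda>x. X (cadjoint V (T (V x))))"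
proof -
  have oVp: "ortho (\<lambda>i. V (p i)) {..<k}"
    by (rule ortho_unitary [OF V p])
  obtain n :: nat and f where f: "n \<ge> k" "\<forall>i<k. f i = p i" "ortho f {..<n}"
      "\<forall>x\<in>(\<lambda>i. V (p i)) ` {..<k}. oproj f {..<n} x = x"
      "\<forall>i<n. f i \<in> cspan (p ` {..<k} \<union> (\<lambda>i. V (p i)) ` {..<k})"
    by (rule gram_schmidt_extendE [OF p finite_imageI [OF finite_lessThan]]) (rule that)
  obtain n' :: nat and f' where f': "n' \<ge> k" "\<forall>i<k. f' i = V (p i)" "ortho f' {..<n'}"
      "\<forall>x\<in>p ` {..<k}. oproj f' {..<n'} x = x"
      "\<forall>i<n'. f' i \<in> cspan ((\<lambda>i. V (p i)) ` {..<k} \<union> p ` {..<k})"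
    by (rule gram_schmidt_extendE [OF oVp finite_imageI [OF finite_lessThan]]) (rule that)
  have fp: "oproj f {..<n} (p i) = p i" if "i < k" for i
    using oproj_family [OF _ f(3), of i] f(1,2) that by simp
  have f'Vp: "oproj f' {..<n'} (V (p i)) = V (p i)" if "i < k" for i
    using oproj_family [OF _ f'(3), of i] f'(1,2) that by simp
  have ff': "oproj f' {..<n'} = oproj f {..<n}"
  proof (rule oproj_eqI)
    fix i
    assume "i \<in> {..<n'}"
    hence "f' i \<in> cspan ((\<lambda>i. V (p i)) ` {..<k} \<union> p ` {..<k})"
      using f'(5) by blast
    thus "oproj f {..<n} (f' i) = f' i"
      by (rule oproj_cspan) (use f(4) fp in auto)
  next
    fix i
    assume "i \<in> {..<n}"
    hence "f i \<in> cspan (p ` {..<k} \<union> (\<lambda>i. V (p i)) ` {..<k})"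
      using f(5) by blast
    thus "oproj f' {..<n'} (f i) = f i"
      by (rule oproj_cspan) (use f'(4) f'Vp in auto)
  qed
  hence n: "n' = n"
    using ortho_same_card [OF f'(3) f(3)] by blast
  define PL where "PL = oproj f {..<n}"
  obtain V' where V': "unitary_op V'" and V'f: "\<forall>i<n. V' (f i) = f' i"
    and "\<forall>i<n. cadjoint V' (f' i) = f i"
    and V'comm: "\<forall>x. oproj f {..<n} (V' x) = V' (oproj f {..<n} x)"
    by (rule unitary_between_bases [OF f(3) f'(3) [unfolded n] ff' [unfolded n]]) (rule that)
  have V'PL: "PL (V' x) = V' (PL x)" for x
    using V'comm by (simp add: PL_def)
  have V'p: "V' (oproj p {..<k} x) = V (oproj p {..<k} x)" for x
  proof -
    have "V' (p i) = V (p i)" if "i < k" for i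
      using V'f f(1,2) f'(2) that by (metis less_le_trans)
    thus ?thesis
      by (simp add: oproj_def bounded_clinear_sum unitary_bounded V V' bounded_clinear_scaleC)
  qed
  have PLP: "PL (oproj p {..<k} x) = oproj p {..<k} x" for x
    unfolding PL_def by (rule oproj_cspan [OF oproj_in_cspan]) (use fp in auto)
  have PLX: "PL (X x) = X x" for x
    by (metis PLP PX)
  have PPL: "oproj p {..<k} (PL x) = oproj p {..<k} x" for x
    by (rule cinner_eqI) (metis PLP PL_def oproj_selfadjoint)
  have XPL: "X (PL x) = X x" for x
    by (metis PPL XP)
  \<comment> \<open>Only the values of \<open>V\<close> on the range of \<open>X\<close> enter the trace.\<close>
  have VV': "ctrace (\<lambda>x. X (cadjoint V (T (V x)))) = ctrace (\<lambda>x. X (cadjoint V' (T (V' x))))"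
  proof -
    have "cinner (p i) (cadjoint V (T (V (X (p i))))) = cinner (p i) (cadjoint V' (T (V' (X (p i)))))"
      if "i < k" for i
    proof -
      have "V' (p i) = V (p i)" "V' (X (p i)) = V (X (p i))"
        using V'p [of "p i"] V'p [of "X (p i)"] oproj_family [OF _ p, of i] that by (simp_all add: PX)
      thus ?thesis
        by (simp add: unitary_bounded V V' flip: cinner_cadjoint)
    qed
    thus ?thesis
      by (simp add: ctrace_finite_rank [OF X XP _ E] bounded_clinear_conjugation V V' T)
  qed
  show ?thesis
  proof (cases "symmetric_op X")
    case True
    obtain g s where g: "ortho g {..<n}" "oproj g {..<n} = PL"
      and Xg: "\<And>i. i < n \<Longrightarrow> X (g i) = complex_of_real (s i) *\<^sub>C g i"
      and s: "\<And>i j. i \<le> j \<Longrightarrow> j < n \<Longrightarrow> s j \<le> s i"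
      using sorted_eigenbasis [OF X True f(3)] PLX unfolding PL_def by blast
    have tr: "ctrace (\<lambda>x. X (B x)) = (\<Sum>i<n. complex_of_real (s i) * cinner (g i) (B (g i)))"
      if B: "bounded_clinear B" for B
      using ctrace_finite_rank [OF X _ B E, of g n]
      by (simp add: g(2) XPL Xg bounded_clinear_scaleC [OF B] cinner_simps)
    have trU: "ctrace (\<lambda>x. X (cadjoint U (T (U x)))) = (\<Sum>i<n. complex_of_real (s i) * cinner (U (g i)) (T (U (g i))))"
      if "unitary_op U" for U
      by (simp add: tr bounded_clinear_conjugation that T cinner_cadjoint [OF unitary_bounded [OF that]])
    have g': "ortho (\<lambda>i. V' (g i)) {..<n}" "oproj (\<lambda>i. V' (g i)) {..<n} = oproj g {..<n}"
      using V'PL by (simp_all add: ortho_unitary V' g oproj_unitary)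
    obtain h where h: "ortho h {..<n}" "oproj h {..<n} = oproj g {..<n}"
      and hs: "(\<Sum>i<n. complex_of_real (s i) * cinner (h i) (T (h i))) =
        complex_of_real (1 - t) * (\<Sum>i<n. complex_of_real (s i) * cinner (g i) (T (g i))) +
        complex_of_real t * (\<Sum>i<n. complex_of_real (s i) * cinner (V' (g i)) (T (V' (g i))))"
      using convex_combination_of_bases [where s = s, OF T g(1) g' s t] by blast
    obtain W where W: "unitary_op W" "\<forall>i<n. W (g i) = h i"
      and "\<forall>i<n. cadjoint W (h i) = g i" "\<forall>x. oproj g {..<n} (W x) = W (oproj g {..<n} x)"
      by (rule unitary_between_bases [OF g(1) h]) (rule that)
    have "ctrace (\<lambda>x. X (cadjoint W (T (W x)))) = (\<Sum>i<n. complex_of_real (s i) * cinner (h i) (T (h i)))"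
      unfolding trU [OF W(1)] by (simp add: W(2))
    thus ?thesis
      using W(1) by (intro exI [of _ W]) (simp add: hs VV' trU [OF V'] tr [OF T])
  next
    case False
    hence "symmetric_op T"
      using sym by blast
    hence sT: "cinner (T x) y = cinner x (T y)" for x y
      by (simp add: symmetric_op_def)
    \<comment> \<open>the compression of \<open>T\<close> to \<open>L\<close>\<close>
    define Y where "Y = (\<lambda>x. PL (T (PL x)))"
    have bPL: "bounded_clinear PL"
      unfolding PL_def by (rule bounded_clinear_oproj)
    have sPL: "cinner (PL x) y = cinner x (PL y)" for x y
      unfolding PL_def by (rule oproj_selfadjoint)
    have PLPL: "PL (PL x) = PL x" for x
      unfolding PL_def by (simp add: oproj_idem f(3))
    have bY: "bounded_clinear Y"
      unfolding Y_def
      by (rule bounded_clinear_compose [OF bPL bounded_clinear_compose [OF T bPL]])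
    have sY: "symmetric_op Y"
      unfolding symmetric_op_def Y_def by (simp add: sPL sT)
    have "oproj f {..<n} (Y x) = Y x" for x
      using PLPL by (simp add: Y_def PL_def)
    then obtain g s where g: "ortho g {..<n}" "oproj g {..<n} = PL"
      and Yg: "\<And>i. i < n \<Longrightarrow> Y (g i) = complex_of_real (s i) *\<^sub>C g i"
      and s: "\<And>i j. i \<le> j \<Longrightarrow> j < n \<Longrightarrow> s j \<le> s i"
      using sorted_eigenbasis [OF bY sY f(3)] unfolding PL_def by blast
    have PLg: "PL (g i) = g i" if "i < n" for i
      using oproj_family [OF _ g(1), of i] that by (simp add: g(2))
    have tr: "ctrace (\<lambda>x. X (cadjoint Q (T (Q x)))) =
        (\<Sum>i<n. complex_of_real (s i) * cinner (cadjoint Q (g i)) (X (cadjoint Q (g i))))"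
      if Q: "unitary_op Q" and QPL: "\<And>x. PL (Q x) = Q (PL x)" for Q
    proof -
      let ?q = "\<lambda>i. cadjoint Q (g i)"
      have "oproj g {..<n} (Q x) = Q (oproj g {..<n} x)" for x
        by (simp add: g(2) QPL)
      hence "oproj ?q {..<n} = oproj g {..<n}"
        by (rule oproj_unitary [OF unitary_cadjoint [OF Q] cadjoint_commutes_oproj [OF Q]])
      hence "ctrace (\<lambda>x. X (cadjoint Q (T (Q x)))) = (\<Sum>i<n. cinner (?q i) (cadjoint Q (T (Q (X (?q i))))))"
        using ctrace_finite_rank [OF X _ bounded_clinear_conjugation [OF Q T] E, of ?q n]
        by (simp add: g(2) XPL)
      also have "\<dots> = (\<Sum>i<n. complex_of_real (s i) * cinner (?q i) (X (?q i)))"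
      proof (rule sum.cong [OF refl])
        fix i
        assume "i \<in> {..<n}"
        hence i: "i < n"
          by simp
        define z where "z = Q (X (?q i))"
        have PLz: "PL z = z"
          by (simp add: z_def QPL PLX)
        have "cinner (?q i) (cadjoint Q (T z)) = cinner (g i) (T z)"
          by (simp add: unitary_cinner unitary_cadjoint Q)
        also have "\<dots> = cinner (PL (g i)) (T (PL z))"
          by (simp add: PLg i PLz)
        also have "\<dots> = cinner (Y (g i)) z"
          by (simp add: Y_def sPL sT)
        also have "\<dots> = of_real (s i) * cinner (g i) z"
          by (simp add: Yg i cinner_simps)
        also have "cinner (g i) z = cinner (?q i) (X (?q i))"
          unfolding z_def by (simp add: cinner_cadjoint' [OF unitary_bounded [OF Q]])
        finally show "cinner (?q i) (cadjoint Q (T (Q (X (?q i))))) = of_real (s i) * cinner (?q i) (X (?q i))"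
          by (simp add: z_def)
      qed
      finally show ?thesis .
    qed
    have g': "ortho (\<lambda>i. cadjoint V' (g i)) {..<n}" "oproj (\<lambda>i. cadjoint V' (g i)) {..<n} = oproj g {..<n}"
    proof -
      have "oproj g {..<n} (V' x) = V' (oproj g {..<n} x)" for x
        by (simp add: g(2) V'PL)
      thus "oproj (\<lambda>i. cadjoint V' (g i)) {..<n} = oproj g {..<n}"
        by (rule oproj_unitary [OF unitary_cadjoint [OF V'] cadjoint_commutes_oproj [OF V']])
      show "ortho (\<lambda>i. cadjoint V' (g i)) {..<n}"
        by (rule ortho_unitary [OF unitary_cadjoint [OF V'] g(1)])
    qed
    obtain h where h: "ortho h {..<n}" "oproj h {..<n} = oproj g {..<n}"
      and hs: "(\<Sum>i<n. complex_of_real (s i) * cinner (h i) (X (h i))) =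
        complex_of_real (1 - t) * (\<Sum>i<n. complex_of_real (s i) * cinner (g i) (X (g i))) +
        complex_of_real t * (\<Sum>i<n. complex_of_real (s i) * cinner (cadjoint V' (g i)) (X (cadjoint V' (g i))))"
      using convex_combination_of_bases [where s = s, OF X g(1) g' s t] by blast
    obtain W where W: "unitary_op W" and "\<forall>i<n. W (h i) = g i"
      and W': "\<forall>i<n. cadjoint W (g i) = h i" "\<forall>x. oproj h {..<n} (W x) = W (oproj h {..<n} x)"
      by (rule unitary_between_bases [OF h(1) g(1) h(2) [symmetric]]) (rule that)
    have "ctrace (\<lambda>x. X (cadjoint W (T (W x)))) = (\<Sum>i<n. complex_of_real (s i) * cinner (h i) (X (h i)))"
      using tr [OF W] W' by (simp add: h(2) g(2))
    moreover have "ctrace (\<lambda>x. X (T x)) = (\<Sum>i<n. complex_of_real (s i) * cinner (g i) (X (g i)))"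
      using tr [OF unitary_ident(1)] by (simp add: unitary_ident(2))
    ultimately show ?thesis
      using W by (intro exI [of _ W]) (simp add: hs VV' tr [OF V' V'PL])
  qed
qed

text \<open>The error of the compression of \<open>C\<close> is uniform in the unitary operators, because all conjugates of \<open>T\<close>
  have the same norm bound. Replacing \<open>T\<close> by \<open>U\<^sub>0\<^sup>* T U\<^sub>0\<close> moves the first of the two points to the identity.\<close>

lemma nuclear_convex_approximately:
  fixes C T :: "'h::complex_hilbert \<Rightarrow> 'h"
  assumes E: "\<exists>E::'h set. is_onb E"
    and C: "bounded_clinear C" "nuclear_rep C a v" and T: "bounded_clinear T"
    and sym: "symmetric_op C \<or> symmetric_op T"
    and U: "unitary_op U0" "unitary_op U1" and t: "0 \<le> t" "t \<le> 1" and \<epsilon>: "\<epsilon> > 0"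
  shows "\<exists>U. unitary_op U \<and> cmod (ctrace (\<lambda>x. C (cadjoint U (T (U x)))) -
    (complex_of_real (1 - t) * ctrace (\<lambda>x. C (cadjoint U0 (T (U0 x)))) +
     complex_of_real t * ctrace (\<lambda>x. C (cadjoint U1 (T (U1 x)))))) < \<epsilon>"
proof -
  obtain b where b: "b > 0" "\<And>x. norm (T x) \<le> b * norm x"
    using bounded_clinear_bound [OF T] by blast
  have "summable (\<lambda>n. norm (a n) * norm (v n))" "0 < \<epsilon> / (4 * b)"
    using C(2) b(1) \<epsilon> by (simp_all add: nuclear_rep_def)
  from suminf_exist_split [OF this(2,1)]
  obtain M where "norm (\<Sum>n. norm (a (n + M)) * norm (v (n + M))) < \<epsilon> / (4 * b)"
    by blast
  hence "(\<Sum>n. norm (a (n + M)) * norm (v (n + M))) < \<epsilon> / (4 * b)"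
    by (simp add: abs_less_iff)
  hence M: "2 * b * (\<Sum>n. norm (a (n + M)) * norm (v (n + M))) < \<epsilon> / 2"
    using b(1) by (simp add: field_simps)
  have "ortho (\<lambda>_. 0 :: 'h) {..<0::nat}"
    by (simp add: ortho_def)
  then obtain k :: nat and p where p: "ortho p {..<k}"
      "\<forall>y\<in>a ` {..<M} \<union> v ` {..<M}. oproj p {..<k} y = y"
    by (rule gram_schmidt_extendE [where S = "a ` {..<M} \<union> v ` {..<M}"]) auto
  let ?P = "oproj p {..<k}"
  define X where "X = (\<lambda>x. ?P (C (?P x)))"
  have bX: "bounded_clinear X"
    unfolding X_def
    by (rule bounded_clinear_compose [OF bounded_clinear_oproj
        bounded_clinear_compose [OF C(1) bounded_clinear_oproj]])
  have XP: "X (?P x) = X x" and PX: "?P (X x) = X x" for x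
    unfolding X_def by (simp_all add: oproj_idem p(1))
  define T0 where "T0 = (\<lambda>x. cadjoint U0 (T (U0 x)))"
  define V where "V = (\<lambda>x. cadjoint U0 (U1 x))"
  have bT0: "bounded_clinear T0"
    unfolding T0_def by (rule bounded_clinear_conjugation [OF U(1) T])
  have V: "unitary_op V" "cadjoint V = (\<lambda>x. cadjoint U1 (U0 x))"
    unfolding V_def using unitary_compose [OF unitary_cadjoint [OF U(1)] U(2)]
    by (simp_all add: cadjoint_cadjoint unitary_bounded U)
  have V1: "cadjoint V (T0 (V x)) = cadjoint U1 (T (U1 x))" for x
    unfolding V(2) by (simp add: T0_def V_def unitary_cadjoint_right U)
  have "symmetric_op X \<or> symmetric_op T0"
    using sym
  proof
    assume "symmetric_op C"
    thus ?thesis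
      by (simp add: symmetric_op_def X_def oproj_selfadjoint)
  next
    assume "symmetric_op T"
    thus ?thesis
      by (simp add: symmetric_op_def T0_def cinner_cadjoint cinner_cadjoint' unitary_bounded U)
  qed
  from finite_rank_convex [OF E p(1) bX XP PX bT0 this V(1) t]
  obtain W where W: "unitary_op W" and WX: "ctrace (\<lambda>x. X (cadjoint W (T0 (W x)))) =
      complex_of_real (1 - t) * ctrace (\<lambda>x. X (T0 x)) +
      complex_of_real t * ctrace (\<lambda>x. X (cadjoint U1 (T (U1 x))))"
    unfolding V1 by blast
  define U where "U = (\<lambda>x. U0 (W x))"
  have U': "unitary_op U" "cadjoint U = (\<lambda>x. cadjoint W (cadjoint U0 x))"
    unfolding U_def by (rule unitary_compose [OF \<open>unitary_op U0\<close> W])+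
  have U'T: "cadjoint U (T (U x)) = cadjoint W (T0 (W x))" for x
    unfolding U'(2) by (simp add: U_def T0_def)
  define e where "e = (\<lambda>U. ctrace (\<lambda>x. C (cadjoint U (T (U x)))) - ctrace (\<lambda>x. X (cadjoint U (T (U x)))))"
  have e: "cmod (e U) < \<epsilon> / 2" if "unitary_op U" for U
  proof -
    have "norm (cadjoint U (T (U x))) \<le> b * norm x" for x
      using b(2) [of "U x"] by (simp add: unitary_norm unitary_cadjoint that)
    hence "cmod (e U) \<le> 2 * b * (\<Sum>n. norm (a (n + M)) * norm (v (n + M)))"
      unfolding e_def X_def using p(2) b(1)
      by (intro ctrace_compression_close C p E bounded_clinear_conjugation that T) auto
    thus ?thesis
      using M by simp
  qed
  have "ctrace (\<lambda>x. C (cadjoint U (T (U x)))) -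
    (complex_of_real (1 - t) * ctrace (\<lambda>x. C (cadjoint U0 (T (U0 x)))) +
     complex_of_real t * ctrace (\<lambda>x. C (cadjoint U1 (T (U1 x)))))
    = e U - (complex_of_real (1 - t) * e U0 + complex_of_real t * e U1)"
    using WX unfolding e_def U'T by (simp add: T0_def algebra_simps)
  also have "cmod \<dots> \<le> cmod (e U) + ((1 - t) * cmod (e U0) + t * cmod (e U1))"
  proof -
    have "cmod (complex_of_real (1 - t) * e U0 + complex_of_real t * e U1)
        \<le> cmod (complex_of_real (1 - t) * e U0) + cmod (complex_of_real t * e U1)"
      by (rule norm_triangle_ineq)
    also have "\<dots> = (1 - t) * cmod (e U0) + t * cmod (e U1)"
      using t by (simp only: norm_mult norm_of_real abs_of_nonneg diff_ge_0_iff_ge)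
    finally show ?thesis
      using norm_triangle_ineq4 [of "e U"] by (smt (verit))
  qed
  also have "\<dots> < \<epsilon> / 2 + ((1 - t) * (\<epsilon> / 2) + t * (\<epsilon> / 2))"
    using e [OF U'(1)] e [OF \<open>unitary_op U0\<close>] e [OF \<open>unitary_op U1\<close>] t
    by (intro add_less_le_mono add_mono mult_left_mono) simp_all
  also have "\<dots> = \<epsilon>"
    by (simp add: field_simps)
  finally show ?thesis
    using U'(1) by blast
qed

lemma convex_closureI:
  fixes S :: "complex set"
  assumes "\<And>p q t \<epsilon>. p \<in> S \<Longrightarrow> q \<in> S \<Longrightarrow> 0 \<le> t \<Longrightarrow> t \<le> 1 \<Longrightarrow> 0 < \<epsilon> \<Longrightarrow>
    \<exists>z\<in>S. cmod (z - (complex_of_real (1 - t) * p + complex_of_real t * q)) < \<epsilon>"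
  shows "convex (closure S)"
  unfolding convex_alt
proof (intro ballI allI impI)
  fix x y :: complex and t :: real
  assume x: "x \<in> closure S" and y: "y \<in> closure S" and t: "0 \<le> t \<and> t \<le> 1"
  show "(1 - t) *\<^sub>R x + t *\<^sub>R y \<in> closure S"
    unfolding closure_approachable
  proof (intro allI impI)
    fix \<epsilon> :: real
    assume "\<epsilon> > 0"
    hence "\<epsilon> / 2 > 0"
      by simp
    then obtain p q where p: "p \<in> S" "cmod (p - x) < \<epsilon> / 2" and q: "q \<in> S" "cmod (q - y) < \<epsilon> / 2"
      using x y unfolding closure_approachable dist_norm by blast
    obtain z where z: "z \<in> S" "cmod (z - (complex_of_real (1 - t) * p + complex_of_real t * q)) < \<epsilon> / 2"
      using assms [OF p(1) q(1) _ _ \<open>\<epsilon> / 2 > 0\<close>] t by blast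
    let ?w = "complex_of_real (1 - t) * (p - x) + complex_of_real t * (q - y)"
    have "cmod ?w \<le> cmod (complex_of_real (1 - t) * (p - x)) + cmod (complex_of_real t * (q - y))"
      by (rule norm_triangle_ineq)
    also have "\<dots> = (1 - t) * cmod (p - x) + t * cmod (q - y)"
      using t by (simp only: norm_mult norm_of_real abs_of_nonneg diff_ge_0_iff_ge)
    also have "\<dots> \<le> (1 - t) * (\<epsilon> / 2) + t * (\<epsilon> / 2)"
      using t p(2) q(2) by (intro add_mono mult_left_mono) simp_all
    finally have w: "cmod ?w \<le> \<epsilon> / 2"
      by (simp add: field_simps)
    have eq: "z - ((1 - t) *\<^sub>R x + t *\<^sub>R y) = (z - (complex_of_real (1 - t) * p + complex_of_real t * q)) + ?w"
      by (simp add: scaleR_conv_of_real algebra_simps)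
    have "cmod (z - ((1 - t) *\<^sub>R x + t *\<^sub>R y)) < \<epsilon>"
      using norm_triangle_ineq [of "z - (complex_of_real (1 - t) * p + complex_of_real t * q)" ?w] w z(2)
      unfolding eq by linarith
    thus "\<exists>z\<in>S. dist z ((1 - t) *\<^sub>R x + t *\<^sub>R y) < \<epsilon>"
      using z(1) by (auto simp: dist_norm)
  qed
qed

theorem theorem3p8:
  fixes C T :: "'h::complex_hilbert \<Rightarrow> 'h"
  assumes "infinite_dimensional TYPE('h)"
    and "separable_space (euclidean :: 'h topology)"
    and "trace_class C"
    and "bounded_clinear T"
    and "(normal_op C \<and> collinear (eigenvalues_op C)) \<or> essentially_selfadjoint T"
  shows "convex (closure (C_numerical_range C T))"
proof (rule convex_closureI)
  fix p q :: complex and t \<epsilon> :: real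
  assume "p \<in> C_numerical_range C T" "q \<in> C_numerical_range C T" and t: "0 \<le> t" "t \<le> 1" and \<epsilon>: "0 < \<epsilon>"
  then obtain U0 U1 where U: "unitary_op U0" "unitary_op U1"
    and p: "p = ctrace (\<lambda>x. C (cadjoint U0 (T (U0 x))))"
    and q: "q = ctrace (\<lambda>x. C (cadjoint U1 (T (U1 x))))"
    by (auto simp: C_numerical_range_def o_def)
  have bC: "bounded_clinear C" and E: "\<exists>E::'h set. is_onb E"
    using assms(3) by (auto simp: trace_class_def)
  obtain a v where nuc: "nuclear_rep C a v"
    using trace_class_nuclear [OF assms(3)] .
  \<comment> \<open>In the first case the phase that makes \<open>C\<close> self-adjoint is moved over to \<open>T\<close>; in the second case
    the affine relation between \<open>T\<close> and a self-adjoint operator carries over to the traces.\<close>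
  have "\<exists>U. unitary_op U \<and>
      cmod (ctrace (\<lambda>x. C (cadjoint U (T (U x)))) - (complex_of_real (1 - t) * p + complex_of_real t * q)) < \<epsilon>"
    using assms(5)
  proof
    assume "normal_op C \<and> collinear (eigenvalues_op C)"
    then obtain w where w: "cmod w = 1" and sym: "symmetric_op (\<lambda>x. w *\<^sub>C C x)"
      using normal_collinear_imp_rotated_symmetric [OF assms(1) nuc] by blast
    have ww: "w * cnj w = 1"
      using w by (simp flip: complex_norm_square)
    have nucD: "nuclear_rep (\<lambda>x. w *\<^sub>C C x) (\<lambda>n. w *\<^sub>C a n) v"
      unfolding nuclear_rep_def
    proof (intro conjI allI)
      show "summable (\<lambda>n. norm (w *\<^sub>C a n) * norm (v n))"
        using nuc by (simp add: nuclear_rep_def norm_scaleC w)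
      show "(\<lambda>n. cinner (v n) x *\<^sub>C w *\<^sub>C a n) sums (w *\<^sub>C C x)" for x
      proof -
        have "(\<lambda>n. w *\<^sub>C cinner (v n) x *\<^sub>C a n) sums (w *\<^sub>C C x)"
          using nuc unfolding nuclear_rep_def
          by (intro bounded_linear.sums [OF bounded_linear_scaleC_right]) blast
        thus ?thesis
          by (simp add: scaleC_scaleC mult.commute)
      qed
    qed
    have bT': "bounded_clinear (\<lambda>x. cnj w *\<^sub>C T x)" and bD: "bounded_clinear (\<lambda>x. w *\<^sub>C C x)"
      by (intro bounded_clinear_const_scaleC assms(4) bC)+
    have move: "w *\<^sub>C C (cadjoint U (cnj w *\<^sub>C T (U x))) = C (cadjoint U (T (U x)))"
      if "unitary_op U" for U x
      using that by (simp add: bounded_clinear_scaleC bounded_clinear_cadjoint unitary_bounded bC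
          scaleC_scaleC scaleC_one ww)
    obtain U where U': "unitary_op U"
      and d: "cmod (ctrace (\<lambda>x. w *\<^sub>C C (cadjoint U (cnj w *\<^sub>C T (U x)))) -
        (complex_of_real (1 - t) * ctrace (\<lambda>x. w *\<^sub>C C (cadjoint U0 (cnj w *\<^sub>C T (U0 x)))) +
         complex_of_real t * ctrace (\<lambda>x. w *\<^sub>C C (cadjoint U1 (cnj w *\<^sub>C T (U1 x)))))) < \<epsilon>"
      using nuclear_convex_approximately [OF E bD nucD bT' disjI1 [OF sym] U t \<epsilon>] by blast
    show ?thesis
      using U' d unfolding move [OF U'] move [OF U(1)] move [OF U(2)] p q by blast
  next
    assume "essentially_selfadjoint T"
    then obtain \<theta> \<xi> where sa: "selfadjoint_op (\<lambda>x. exp (- \<i> * complex_of_real \<theta>) *\<^sub>C (T x - \<xi> *\<^sub>C x))"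
      by (auto simp: essentially_selfadjoint_def)
    define S where "S = (\<lambda>x. exp (- \<i> * complex_of_real \<theta>) *\<^sub>C (T x - \<xi> *\<^sub>C x))"
    define c where "c = exp (\<i> * complex_of_real \<theta>)"
    have c: "cmod c = 1" "c * exp (- \<i> * complex_of_real \<theta>) = 1"
      by (simp_all add: c_def flip: exp_add)
    have bS: "bounded_clinear S" and sS: "symmetric_op S"
      using sa selfadjoint_imp_symmetric by (simp_all add: S_def selfadjoint_op_def)
    have TS: "T x = c *\<^sub>C S x + \<xi> *\<^sub>C x" for x
    proof -
      have "c *\<^sub>C S x = T x - \<xi> *\<^sub>C x"
        unfolding S_def scaleC_scaleC c(2) scaleC_one ..
      thus ?thesis
        by simp
    qed
    have tr: "ctrace (\<lambda>x. C (cadjoint U (T (U x))))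
        = c * ctrace (\<lambda>x. C (cadjoint U (S (U x)))) + \<xi> * ctrace (\<lambda>x. C x)" if "unitary_op U" for U
    proof -
      have "cadjoint U (T (U x)) = c *\<^sub>C cadjoint U (S (U x)) + \<xi> *\<^sub>C x" for x
        using that by (simp add: TS bounded_clinear_add bounded_clinear_scaleC bounded_clinear_cadjoint
            unitary_bounded unitary_cadjoint_left)
      thus ?thesis
        using ctrace_linear [OF nuc bounded_clinear_conjugation [OF that bS] bounded_clinear_ident E]
        by simp
    qed
    obtain U where U': "unitary_op U" and d: "cmod (ctrace (\<lambda>x. C (cadjoint U (S (U x)))) -
        (complex_of_real (1 - t) * ctrace (\<lambda>x. C (cadjoint U0 (S (U0 x)))) +
         complex_of_real t * ctrace (\<lambda>x. C (cadjoint U1 (S (U1 x)))))) < \<epsilon>"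
      using nuclear_convex_approximately [OF E bC nuc bS disjI2 [OF sS] U t \<epsilon>] by blast
    have "ctrace (\<lambda>x. C (cadjoint U (T (U x)))) - (complex_of_real (1 - t) * p + complex_of_real t * q)
      = c * (ctrace (\<lambda>x. C (cadjoint U (S (U x)))) -
        (complex_of_real (1 - t) * ctrace (\<lambda>x. C (cadjoint U0 (S (U0 x)))) +
         complex_of_real t * ctrace (\<lambda>x. C (cadjoint U1 (S (U1 x))))))"
      unfolding p q tr [OF U'] tr [OF U(1)] tr [OF U(2)] by (simp add: algebra_simps)
    thus ?thesis
      using U' d c(1) by (intro exI [of _ U]) (simp add: norm_mult)
  qed
  thus "\<exists>z\<in>C_numerical_range C T. cmod (z - (complex_of_real (1 - t) * p + complex_of_real t * q)) < \<epsilon>"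
    by (auto simp: C_numerical_range_def o_def)
qed

end
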